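(* Let $p$ be a prime, $X$ a nonempty totally ordered set, $S$ the free profinite group on $X$, and $n\geq 2$. For every nonempty words $u,v\in X^*$ with $s=|u|+|v|\leq n$ one has $$\sum_{w\in X^s}(u\,ш\,v)_w\,\alpha_{w,n}=0$$ in $H^2(S^{[n,p]},\mathbb{Z}/p)$, where $u\,ш\,v$ denotes the shuffle product of $u$ and $v$ and $(u\,ш\,v)_w$ is its coefficient at $w$.
   Context: $X^*$ is the free monoid of words in $X$, $|w|$ the length of $w$, and $X^s$ the set of words of length $s$. Shuffle product: for nonempty words $u,v$ of lengths $a,b$, and disjoint sets $I,J$ with $|I|=a$, $|J|=b$, $I\cup J=\{1,\ldots,a+b\}$, let $w(I,J,u,v)$ be the word of length $a+b$ whose restriction to the positions in $I$ is $u$ and whose restriction to the positions in $J$ is $v$. Then $u\,ш\,v=\sum_{(I,J)}w(I,J,u,v)\in\mathbb{Z}\langle X\rangle$ (the ring of non-commuting polynomials), the sum being over all such pairs $(I,J)$, i.e. shuffles are counted with multiplicity. For a profinite group $G$: $G^{(1,p)}=G$, $G^{(n+1,p)}=(G^{(n,p)})^p[G,G^{(n,p)}]$ (closed subgroup generated by all $h^p$ and $[g,h]=g^{-1}h^{-1}gh$, $g\in G$, $h\in G^{(n,p)}$), and $G^{[n,p]}=G/G^{(n,p)}$. Cohomology is profinite cohomology with trivial action on $\mathbb{Z}/p$. The free profinite group $S=S_X$ on basis $X$: $X\subseteq S$ generates $S$ topologically, the inclusion converges to $1$ (every open normal subgroup contains all but finitely many elements of $X$), and every map $X\to G$ to a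 profinite group converging to $1$ extends uniquely to a continuous homomorphism $S\to G$. For a profinite commutative ring $R$, $\Lambda_R\colon S\to R\langle\langle X\rangle\rangle^\times$ is the continuous (Magnus) homomorphism into the units of the ring of non-commuting formal power series with $\Lambda_R(x)=1+x$, $x\in X$; $\epsilon_{w,R}(\sigma)$ is the coefficient of $w$ in $\Lambda_R(\sigma)$. For $1\leq s\leq n$ let $\mathbb{U}=\mathbb{U}_{s+1}(\mathbb{Z}/p^{n-s+1})$ be the group of unipotent upper-triangular $(s+1)\times(s+1)$ matrices over $\mathbb{Z}/p^{n-s+1}$. It is known that $\mathbb{U}^{(n,p)}=I_{s+1}+\mathbb{Z}p^{n-s}E_{1,s+1}$ is central in $\mathbb{U}$; identify it with $\mathbb{Z}/p$ via $I_{s+1}+ap^{n-s}E_{1,s+1}\mapsto a\pmod p$. Let $\gamma_{n,s}\in H^2(\mathbb{U}^{[n,p]},\mathbb{Z}/p)$ be the class of the central extension $0\to\mathbb{Z}/p\to\mathbb{U}\to\mathbb{U}^{[n,p]}\to1$. For a word $w=(x_1\cdots x_s)$, let $\rho^w\colon S\to\mathbb{U}$ be the continuous homomorphism with $(i,j)$ entry $\epsilon_{(x_i\cdots x_{j-1}),\mathbb{Z}/p^{n-s+1}}(\sigma)$ for $i<j$, $\bar\rho^w\colon S^{[n,p]}\to\mathbb{U}^{[n,p]}$ the induced map, and $\alpha_{w,n}=(\bar\rho^w)^*\gamma_{n,s}\in H^2(S^{[n,p]},\mathbb{Z}/p)$. *)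

theory Defs
  imports
    "HOL-Analysis.Analysis"
    "HOL-Algebra.Elementary_Groups"
    "HOL-Number_Theory.Residues"
begin

section \<open>Profinite groups\<close>

locale topological_group = group G
  for G :: "('a, 'b) monoid_scheme" (structure) +
  fixes T :: "'a topology"
  assumes topspace_eq: "topspace T = carrier G"
    and continuous_mult: "continuous_map (prod_topology T T) T (\<lambda>(x, y). x \<otimes> y)"
    and continuous_inv: "continuous_map T T (\<lambda>x. inv x)"

locale profinite_group = topological_group +
  assumes compact: "compact_space T"
    and Hausdorff: "Hausdorff_space T"
    and totally_disconnected: "connectedin T C \<Longrightarrow> \<exists>x. C \<subseteq> {x}"

definition continuous_hom ::
  "('a, 'b) monoid_scheme \<Rightarrow> 'a topology \<Rightarrow> ('c, 'd) monoid_scheme \<Rightarrow> 'c topology \<Rightarrow> ('a \<Rightarrow> 'c) set"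
  where "continuous_hom G T H T' = {f \<in> hom G H. continuous_map T T' f}"

definition closed_subgroup_generated ::
  "('a, 'b) monoid_scheme \<Rightarrow> 'a topology \<Rightarrow> 'a set \<Rightarrow> 'a set"
  where "closed_subgroup_generated G T A = \<Inter>{H. subgroup H G \<and> closedin T H \<and> A \<subseteq> H}"

definition converges_to_one ::
  "'x set \<Rightarrow> ('x \<Rightarrow> 'a) \<Rightarrow> ('a, 'b) monoid_scheme \<Rightarrow> 'a topology \<Rightarrow> bool"
  where "converges_to_one X f G T \<longleftrightarrow>
    (\<forall>N. normal N G \<and> openin T N \<longrightarrow> finite {x \<in> X. f x \<notin> N})"

text \<open>
  HOL cannot quantify over all types inside a formula, so the universal property is stated for
  profinite groups whose elements live in the type \<^typ>\<open>'a list \<Rightarrow> int\<close>. This loses nothing. Every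
  finite group has an isomorphic copy on this type; the universal property for finite groups, by
  passing to the limit over open normal subgroups, gives it for all profinite groups.
  Homomorphisms are taken to be \<^const>\<open>extensional\<close>, so that uniqueness refers to the values on the
  carrier only.
\<close>

locale free_profinite_group = profinite_group S T
  for S :: "('a, 'b) monoid_scheme" and T :: "'a topology" +
  fixes X :: "'a set"
  assumes basis_subset: "X \<subseteq> carrier S"
    and basis_generates: "closed_subgroup_generated S T X = carrier S"
    and basis_converges: "converges_to_one X (\<lambda>x. x) S T"
    and universal: "\<And>(G :: ('a list \<Rightarrow> int) monoid) T' f.
      profinite_group G T' \<Longrightarrow> f \<in> X \<rightarrow> carrier G \<Longrightarrow> converges_to_one X f G T' \<Longrightarrow>
      \<exists>!h. h \<in> continuous_hom S T G T' \<and> h \<in> extensional (carrier S) \<and> (\<forall>x\<in>X. h x = f x)"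


section \<open>The lower \<open>p\<close>-central filtration\<close>

text \<open>The filtration is indexed from 1; the value at index 0 is irrelevant.\<close>

fun lower_p_central ::
  "nat \<Rightarrow> ('a, 'b) monoid_scheme \<Rightarrow> 'a topology \<Rightarrow> nat \<Rightarrow> 'a set"
  where
    "lower_p_central p G T 0 = carrier G"
  | "lower_p_central p G T (Suc 0) = carrier G"
  | "lower_p_central p G T (Suc (Suc n)) = closed_subgroup_generated G T
      ({h [^]\<^bsub>G\<^esub> p | h. h \<in> lower_p_central p G T (Suc n)} \<union>
       {inv\<^bsub>G\<^esub> g \<otimes>\<^bsub>G\<^esub> inv\<^bsub>G\<^esub> h \<otimes>\<^bsub>G\<^esub> g \<otimes>\<^bsub>G\<^esub> h | g h. g \<in> carrier G \<and> h \<in> lower_p_central p G T (Suc n)})"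

definition p_quotient ::
  "nat \<Rightarrow> nat \<Rightarrow> ('a, 'b) monoid_scheme \<Rightarrow> 'a topology \<Rightarrow> 'a set monoid"
  where "p_quotient p n G T = G Mod lower_p_central p G T n"

definition p_proj ::
  "nat \<Rightarrow> nat \<Rightarrow> ('a, 'b) monoid_scheme \<Rightarrow> 'a topology \<Rightarrow> 'a \<Rightarrow> 'a set"
  where "p_proj p n G T g = lower_p_central p G T n #>\<^bsub>G\<^esub> g"

definition quotient_topology :: "'a topology \<Rightarrow> ('a \<Rightarrow> 'c) \<Rightarrow> 'c topology"
  where "quotient_topology T f =
    topology (\<lambda>U. U \<subseteq> f ` topspace T \<and> openin T {x \<in> topspace T. f x \<in> U})"

lemma openin_quotient_topology:
  "openin (quotient_topology T f) U \<longleftrightarrow>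
    U \<subseteq> f ` topspace T \<and> openin T {x \<in> topspace T. f x \<in> U}"
proof -
  have "istopology (\<lambda>U. U \<subseteq> f ` topspace T \<and> openin T {x \<in> topspace T. f x \<in> U})"
    unfolding istopology_def
  proof (intro conjI allI impI)
    fix U V
    assume U: "U \<subseteq> f ` topspace T \<and> openin T {x \<in> topspace T. f x \<in> U}"
      and V: "V \<subseteq> f ` topspace T \<and> openin T {x \<in> topspace T. f x \<in> V}"
    have "{x \<in> topspace T. f x \<in> U \<inter> V} = {x \<in> topspace T. f x \<in> U} \<inter> {x \<in> topspace T. f x \<in> V}"
      by auto
    with U V show "openin T {x \<in> topspace T. f x \<in> U \<inter> V}" by auto
    from U show "U \<inter> V \<subseteq> f ` topspace T" by auto
  next
    fix \<K>
    assume K: "\<forall>K\<in>\<K>. K \<subseteq> f ` topspace T \<and> openin T {x \<in> topspace T. f x \<in> K}"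
    have "{x \<in> topspace T. f x \<in> \<Union>\<K>} = (\<Union>K\<in>\<K>. {x \<in> topspace T. f x \<in> K})"
      by auto
    with K show "openin T {x \<in> topspace T. f x \<in> \<Union>\<K>}" by auto
    from K show "\<Union>\<K> \<subseteq> f ` topspace T" by blast
  qed
  then show ?thesis
    by (simp add: quotient_topology_def)
qed

lemma quotient_map_quotient_topology: "quotient_map T (quotient_topology T f) f"
proof -
  have "f ` topspace T \<subseteq> topspace (quotient_topology T f)"
    by (rule openin_subset) (auto simp: openin_quotient_topology cong: conj_cong)
  moreover have "topspace (quotient_topology T f) \<subseteq> f ` topspace T"
    using openin_topspace[of "quotient_topology T f"] by (simp only: openin_quotient_topology)
  ultimately show ?thesis
    unfolding quotient_map_def by (auto simp: openin_quotient_topology)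
qed

definition p_quotient_topology ::
  "nat \<Rightarrow> nat \<Rightarrow> ('a, 'b) monoid_scheme \<Rightarrow> 'a topology \<Rightarrow> 'a set topology"
  where "p_quotient_topology p n G T = quotient_topology T (p_proj p n G T)"

text \<open>
  The map \<open>G\<^sup>[\<^sup>n\<^sup>,\<^sup>p\<^sup>] \<rightarrow> H\<^sup>[\<^sup>n\<^sup>,\<^sup>p\<^sup>]\<close> induced by a continuous homomorphism \<open>f\<close>: the image of a coset \<open>c\<close>
  is the common value of the projections of \<open>f g\<close> for \<open>g \<in> c\<close>.
\<close>

definition p_induced ::
  "nat \<Rightarrow> nat \<Rightarrow> ('a, 'b) monoid_scheme \<Rightarrow> 'a topology \<Rightarrow> ('c, 'd) monoid_scheme \<Rightarrow> 'c topology \<Rightarrow>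
    ('a \<Rightarrow> 'c) \<Rightarrow> 'a set \<Rightarrow> 'c set"
  where "p_induced p n G T H T' f =
    (\<lambda>c \<in> carrier (p_quotient p n G T). the_elem ((\<lambda>g. p_proj p n H T' (f g)) ` c))"


section \<open>Second cohomology with trivial action\<close>

text \<open>
  Inhomogeneous continuous cochains of the topological group \<open>(G, T)\<close> with values in a discrete
  abelian group \<open>A\<close>, written multiplicatively, on which \<open>G\<close> acts trivially. Cochains are
  \<^const>\<open>extensional\<close>, so that they are equal iff they agree on the carrier.
\<close>

definition cocycles2 ::
  "('a, 'b) monoid_scheme \<Rightarrow> 'a topology \<Rightarrow> ('c, 'd) monoid_scheme \<Rightarrow> ('a \<times> 'a \<Rightarrow> 'c) set"
  where "cocycles2 G T A =
    {f \<in> extensional (carrier G \<times> carrier G).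
      continuous_map (prod_topology T T) (discrete_topology (carrier A)) f \<and>
      (\<forall>g\<in>carrier G. \<forall>h\<in>carrier G. \<forall>k\<in>carrier G.
        f (h, k) \<otimes>\<^bsub>A\<^esub> f (g, h \<otimes>\<^bsub>G\<^esub> k) = f (g \<otimes>\<^bsub>G\<^esub> h, k) \<otimes>\<^bsub>A\<^esub> f (g, h))}"

definition cocycle2_group ::
  "('a, 'b) monoid_scheme \<Rightarrow> 'a topology \<Rightarrow> ('c, 'd) monoid_scheme \<Rightarrow> ('a \<times> 'a \<Rightarrow> 'c) monoid"
  where "cocycle2_group G T A =
    \<lparr>carrier = cocycles2 G T A,
     mult = (\<lambda>f f'. \<lambda>x \<in> carrier G \<times> carrier G. f x \<otimes>\<^bsub>A\<^esub> f' x),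
     one = (\<lambda>x \<in> carrier G \<times> carrier G. \<one>\<^bsub>A\<^esub>)\<rparr>"

definition coboundary1 ::
  "('a, 'b) monoid_scheme \<Rightarrow> ('c, 'd) monoid_scheme \<Rightarrow> ('a \<Rightarrow> 'c) \<Rightarrow> 'a \<times> 'a \<Rightarrow> 'c"
  where "coboundary1 G A b =
    (\<lambda>(g, h) \<in> carrier G \<times> carrier G. b h \<otimes>\<^bsub>A\<^esub> inv\<^bsub>A\<^esub> (b (g \<otimes>\<^bsub>G\<^esub> h)) \<otimes>\<^bsub>A\<^esub> b g)"

definition coboundaries2 ::
  "('a, 'b) monoid_scheme \<Rightarrow> 'a topology \<Rightarrow> ('c, 'd) monoid_scheme \<Rightarrow> ('a \<times> 'a \<Rightarrow> 'c) set"
  where "coboundaries2 G T A =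
    coboundary1 G A ` {b. continuous_map T (discrete_topology (carrier A)) b}"

definition H2 ::
  "('a, 'b) monoid_scheme \<Rightarrow> 'a topology \<Rightarrow> ('c, 'd) monoid_scheme \<Rightarrow> ('a \<times> 'a \<Rightarrow> 'c) set monoid"
  where "H2 G T A = cocycle2_group G T A Mod coboundaries2 G T A"

definition cohomology_class ::
  "('a, 'b) monoid_scheme \<Rightarrow> 'a topology \<Rightarrow> ('c, 'd) monoid_scheme \<Rightarrow> ('a \<times> 'a \<Rightarrow> 'c) \<Rightarrow>
    ('a \<times> 'a \<Rightarrow> 'c) set"
  where "cohomology_class G T A f = coboundaries2 G T A #>\<^bsub>cocycle2_group G T A\<^esub> f"

text \<open>
  The pullback \<open>H\<^sup>2(H, A) \<rightarrow> H\<^sup>2(G, A)\<close> along \<open>\<phi> : G \<rightarrow> H\<close>, as the common class of the pullbacks of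
  all representatives.
\<close>

definition H2_pullback ::
  "('a, 'b) monoid_scheme \<Rightarrow> 'a topology \<Rightarrow> ('c, 'd) monoid_scheme \<Rightarrow> ('a \<Rightarrow> 'h) \<Rightarrow>
    ('h \<times> 'h \<Rightarrow> 'c) set \<Rightarrow> ('a \<times> 'a \<Rightarrow> 'c) set"
  where "H2_pullback G T A \<phi> c =
    the_elem ((\<lambda>f. cohomology_class G T A (\<lambda>(g, h) \<in> carrier G \<times> carrier G. f (\<phi> g, \<phi> h))) ` c)"

text \<open>
  The class of a central extension \<open>1 \<rightarrow> A \<rightarrow> E \<rightarrow> Q \<rightarrow> 1\<close> with maps \<open>\<iota>\<close> and \<open>\<pi>\<close>: for a continuous section
  \<open>s\<close> of \<open>\<pi>\<close>, it is represented by the cocycle \<open>f\<close> with \<open>s a \<cdot> s b = \<iota> (f (a, b)) \<cdot> s (a b)\<close>. The class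
  does not depend on the section.
\<close>

definition factor_set ::
  "('a, 'e) monoid_scheme \<Rightarrow> ('a \<Rightarrow> 'b) \<Rightarrow> ('b, 'f) monoid_scheme \<Rightarrow> ('c, 'd) monoid_scheme \<Rightarrow>
    ('c \<Rightarrow> 'b) \<Rightarrow> 'c \<times> 'c \<Rightarrow> 'a"
  where "factor_set A \<iota> E Q s =
    (\<lambda>(a, b) \<in> carrier Q \<times> carrier Q.
      inv_into (carrier A) \<iota> (s a \<otimes>\<^bsub>E\<^esub> s b \<otimes>\<^bsub>E\<^esub> inv\<^bsub>E\<^esub> (s (a \<otimes>\<^bsub>Q\<^esub> b))))"

definition extension_class ::
  "('a, 'e) monoid_scheme \<Rightarrow> ('a \<Rightarrow> 'b) \<Rightarrow> ('b, 'f) monoid_scheme \<Rightarrow> 'b topology \<Rightarrow> ('b \<Rightarrow> 'c) \<Rightarrow>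
    ('c, 'd) monoid_scheme \<Rightarrow> 'c topology \<Rightarrow> ('c \<times> 'c \<Rightarrow> 'a) set"
  where "extension_class A \<iota> E TE \<pi> Q TQ = cohomology_class Q TQ A
    (factor_set A \<iota> E Q (SOME s. continuous_map TQ TE s \<and> (\<forall>q\<in>carrier Q. \<pi> (s q) = q)))"


section \<open>The Magnus homomorphism\<close>

definition power_series_ring :: "('r, 'e) ring_scheme \<Rightarrow> 'x set \<Rightarrow> ('x list \<Rightarrow> 'r) ring"
  where "power_series_ring R X =
    \<lparr>carrier = lists X \<rightarrow>\<^sub>E carrier R,
     mult = (\<lambda>f g. \<lambda>w \<in> lists X. \<Oplus>\<^bsub>R\<^esub>i \<in> {..length w}. f (take i w) \<otimes>\<^bsub>R\<^esub> g (drop i w)),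
     one = (\<lambda>w \<in> lists X. if w = [] then \<one>\<^bsub>R\<^esub> else \<zero>\<^bsub>R\<^esub>),
     zero = (\<lambda>w \<in> lists X. \<zero>\<^bsub>R\<^esub>),
     add = (\<lambda>f g. \<lambda>w \<in> lists X. f w \<oplus>\<^bsub>R\<^esub> g w)\<rparr>"

definition power_series_var :: "('r, 'e) ring_scheme \<Rightarrow> 'x set \<Rightarrow> 'x \<Rightarrow> 'x list \<Rightarrow> 'r"
  where "power_series_var R X x = (\<lambda>w \<in> lists X. if w = [x] then \<one>\<^bsub>R\<^esub> else \<zero>\<^bsub>R\<^esub>)"

definition power_series_units_topology ::
  "('r, 'e) ring_scheme \<Rightarrow> 'r topology \<Rightarrow> 'x set \<Rightarrow> ('x list \<Rightarrow> 'r) topology"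
  where "power_series_units_topology R TR X =
    subtopology (product_topology (\<lambda>_. TR) (lists X)) (Units (power_series_ring R X))"

definition magnus_hom ::
  "('r, 'e) ring_scheme \<Rightarrow> 'r topology \<Rightarrow> ('a, 'b) monoid_scheme \<Rightarrow> 'a topology \<Rightarrow> 'a set \<Rightarrow>
    'a \<Rightarrow> 'a list \<Rightarrow> 'r"
  where "magnus_hom R TR S T X =
    (THE \<Lambda>. \<Lambda> \<in> continuous_hom S T (units_of (power_series_ring R X)) (power_series_units_topology R TR X) \<and>
      \<Lambda> \<in> extensional (carrier S) \<and>
      (\<forall>x\<in>X. \<Lambda> x = \<one>\<^bsub>power_series_ring R X\<^esub> \<oplus>\<^bsub>power_series_ring R X\<^esub> power_series_var R X x))"

definition magnus_coeff ::
  "('r, 'e) ring_scheme \<Rightarrow> 'r topology \<Rightarrow> ('a, 'b) monoid_scheme \<Rightarrow> 'a topology \<Rightarrow> 'a set \<Rightarrow>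
    'a list \<Rightarrow> 'a \<Rightarrow> 'r"
  where "magnus_coeff R TR S T X w \<sigma> = magnus_hom R TR S T X \<sigma> w"


section \<open>Unipotent matrices and the classes \<open>\<alpha>\<close>\<close>

definition unipotent_group :: "nat \<Rightarrow> ('r, 'e) ring_scheme \<Rightarrow> (nat \<times> nat \<Rightarrow> 'r) monoid"
  where "unipotent_group m R =
    \<lparr>carrier = {M \<in> {1..m} \<times> {1..m} \<rightarrow>\<^sub>E carrier R.
       (\<forall>i\<in>{1..m}. M (i, i) = \<one>\<^bsub>R\<^esub>) \<and> (\<forall>i\<in>{1..m}. \<forall>j\<in>{1..m}. j < i \<longrightarrow> M (i, j) = \<zero>\<^bsub>R\<^esub>)},
     mult = (\<lambda>M N. \<lambda>(i, j) \<in> {1..m} \<times> {1..m}. \<Oplus>\<^bsub>R\<^esub>l \<in> {1..m}. M (i, l) \<otimes>\<^bsub>R\<^esub> N (l, j)),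
     one = (\<lambda>(i, j) \<in> {1..m} \<times> {1..m}. if i = j then \<one>\<^bsub>R\<^esub> else \<zero>\<^bsub>R\<^esub>)\<rparr>"

text \<open>The ring \<open>\<int>/p\<^sup>n\<^sup>-\<^sup>s\<^sup>+\<^sup>1\<close> (for \<open>1 \<le> s \<le> n\<close>) and the group \<open>\<bbbU> = \<bbbU>\<^sub>s\<^sub>+\<^sub>1(\<int>/p\<^sup>n\<^sup>-\<^sup>s\<^sup>+\<^sup>1)\<close>, both discrete.\<close>

definition Zmod :: "nat \<Rightarrow> nat \<Rightarrow> nat \<Rightarrow> int ring"
  where "Zmod p n s = residue_ring (int p ^ (n - s + 1))"

definition UU :: "nat \<Rightarrow> nat \<Rightarrow> nat \<Rightarrow> (nat \<times> nat \<Rightarrow> int) monoid"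
  where "UU p n s = unipotent_group (s + 1) (Zmod p n s)"

definition UU_topology :: "nat \<Rightarrow> nat \<Rightarrow> nat \<Rightarrow> (nat \<times> nat \<Rightarrow> int) topology"
  where "UU_topology p n s = discrete_topology (carrier (UU p n s))"

text \<open>
  \<open>a \<mapsto> I + a p\<^sup>n\<^sup>-\<^sup>s E\<^sub>1\<^sub>,\<^sub>s\<^sub>+\<^sub>1\<close>, inverse to the identification of \<open>\<bbbU>\<^sup>(\<^sup>n\<^sup>,\<^sup>p\<^sup>)\<close> with \<open>\<int>/p\<close>. No reduction is
  needed: \<open>0 \<le> a < p\<close> gives \<open>0 \<le> a p\<^sup>n\<^sup>-\<^sup>s < p\<^sup>n\<^sup>-\<^sup>s\<^sup>+\<^sup>1\<close>.
\<close>

definition UU_incl :: "nat \<Rightarrow> nat \<Rightarrow> nat \<Rightarrow> int \<Rightarrow> nat \<times> nat \<Rightarrow> int"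
  where "UU_incl p n s a =
    (\<lambda>(i, j) \<in> {1..s + 1} \<times> {1..s + 1}.
      if i = 1 \<and> j = s + 1 then a * int p ^ (n - s) else if i = j then 1 else 0)"

definition gamma :: "nat \<Rightarrow> nat \<Rightarrow> nat \<Rightarrow>
    ((nat \<times> nat \<Rightarrow> int) set \<times> (nat \<times> nat \<Rightarrow> int) set \<Rightarrow> int) set"
  where "gamma p n s =
    extension_class (integer_mod_group p) (UU_incl p n s) (UU p n s) (UU_topology p n s)
      (p_proj p n (UU p n s) (UU_topology p n s))
      (p_quotient p n (UU p n s) (UU_topology p n s))
      (p_quotient_topology p n (UU p n s) (UU_topology p n s))"

text \<open>For \<open>w = (x\<^sub>1 \<dots> x\<^sub>s)\<close> and \<open>i < j\<close>, the word \<open>(x\<^sub>i \<dots> x\<^sub>j\<^sub>-\<^sub>1)\<close> is \<^term>\<open>take (j - i) (drop (i - 1) w)\<close>.\<close>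

definition rho ::
  "nat \<Rightarrow> nat \<Rightarrow> ('a, 'b) monoid_scheme \<Rightarrow> 'a topology \<Rightarrow> 'a set \<Rightarrow> 'a list \<Rightarrow> 'a \<Rightarrow> nat \<times> nat \<Rightarrow> int"
  where "rho p n S T X w \<sigma> =
    (let s = length w; R = Zmod p n s in
      (\<lambda>(i, j) \<in> {1..s + 1} \<times> {1..s + 1}.
        if i < j then magnus_coeff R (discrete_topology (carrier R)) S T X (take (j - i) (drop (i - 1) w)) \<sigma>
        else if i = j then 1 else 0))"

definition alpha ::
  "nat \<Rightarrow> nat \<Rightarrow> ('a, 'b) monoid_scheme \<Rightarrow> 'a topology \<Rightarrow> 'a set \<Rightarrow> 'a list \<Rightarrow>
    ('a set \<times> 'a set \<Rightarrow> int) set"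
  where "alpha p n S T X w =
    (let s = length w in
      H2_pullback (p_quotient p n S T) (p_quotient_topology p n S T) (integer_mod_group p)
        (p_induced p n S T (UU p n s) (UU_topology p n s) (rho p n S T X w))
        (gamma p n s))"


section \<open>The shuffle product\<close>

text \<open>
  The coefficient of \<open>w\<close> in the shuffle product counts the pairs \<open>(I, J)\<close> of complementary sets of
  positions (numbered from 0) for which \<open>w\<close> is the word that restricts to \<open>u\<close> on \<open>I\<close> and to \<open>v\<close> on \<open>J\<close>.
\<close>

definition shuffle :: "'x list \<Rightarrow> 'x list \<Rightarrow> 'x list \<Rightarrow> int"
  where "shuffle u v w = int (card {(I, J).
    I \<inter> J = {} \<and> card I = length u \<and> card J = length v \<and> I \<union> J = {..<length u + length v} \<and>
    length w = length u + length v \<and> nths w I = u \<and> nths w J = v})"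

lemma finite_shuffle_support: "finite {w. shuffle u v w \<noteq> 0}"
proof (rule finite_subset)
  show "{w. shuffle u v w \<noteq> 0} \<subseteq> {w. set w \<subseteq> set u \<union> set v \<and> length w = length u + length v}"
  proof safe
    fix w x
    assume "shuffle u v w \<noteq> 0"
    then have "card {(I, J).
      I \<inter> J = {} \<and> card I = length u \<and> card J = length v \<and> I \<union> J = {..<length u + length v} \<and>
      length w = length u + length v \<and> nths w I = u \<and> nths w J = v} \<noteq> 0" (is "card ?C \<noteq> 0")
      by (simp add: shuffle_def)
    then obtain IJ where "IJ \<in> ?C"
      by (cases "?C = {}") auto
    then obtain I J where IJ: "I \<union> J = {..<length u + length v}"
      "length w = length u + length v" "nths w I = u" "nths w J = v"
      by auto
    then show "length w = length u + length v" by simp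
    assume "x \<in> set w" "x \<notin> set v"
    then obtain i where i: "i < length w" "w ! i = x" by (auto simp: in_set_conv_nth)
    with IJ(1,2) have "i \<in> I \<or> i \<in> J" by auto
    with i IJ(3,4) \<open>x \<notin> set v\<close> show "x \<in> set u" by (auto simp: set_nths)
  qed
  show "finite {w. set w \<subseteq> set u \<union> set v \<and> length w = length u + length v}"
    by (rule finite_lists_length_eq) simp
qed

end

theory Submission
  imports Defs
begin

text \<open>
  Write \<open>N = S\<^sup>(\<^sup>n\<^sup>,\<^sup>p\<^sup>)\<close>. The class \<open>\<alpha>\<^sub>w\<close> becomes trivial on \<open>S\<close>, where \<open>\<rho>\<^sup>w\<close> splits the pulled back
  extension: comparing \<open>\<rho>\<^sup>w\<close> with a section yields a cochain \<open>\<theta>\<^sub>w\<close> on \<open>S\<close> whose coboundary is, up to sign,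
  a cocycle of \<open>\<alpha>\<^sub>w\<close>, and on the cosets of \<open>N\<close> it varies by the homomorphism
  \<open>p\<^sup>s\<^sup>-\<^sup>n \<epsilon>\<^sub>w : N \<rightarrow> \<int>/p\<close>. So \<open>\<Sum>\<^sub>w (u \<sqdot> v)\<^sub>w \<theta>\<^sub>w\<close> (over the shuffles \<open>u \<sqdot> v\<close>) descends to \<open>S/N\<close>, and kills
  \<open>\<Sum>\<^sub>w (u \<sqdot> v)\<^sub>w \<alpha>\<^sub>w\<close>, as soon as \<open>\<Sum>\<^sub>w (u \<sqdot> v)\<^sub>w \<epsilon>\<^sub>w\<close> vanishes on \<open>N\<close>. Magnus series are grouplike:
  \<open>\<epsilon>\<^sub>u \<epsilon>\<^sub>v\<close> is the sum of \<open>\<epsilon>\<^sub>w\<close> over the infiltrations \<open>w\<close> of \<open>u\<close> and \<open>v\<close>, that is over the shuffles and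
  some shorter words. On \<open>N\<close> all coefficients at nonempty words shorter than \<open>s\<close> vanish in
  \<open>\<int>/p\<^sup>n\<^sup>-\<^sup>s\<^sup>+\<^sup>1\<close>, because \<open>\<rho>\<^sup>w\<close> maps \<open>N\<close> into \<open>\<bbbU>\<^sup>(\<^sup>n\<^sup>,\<^sup>p\<^sup>)\<close>; only the shuffles are left.
\<close>

section \<open>Infiltrations and shuffles\<close>

text \<open>Exponentials instead of \<open>1 + x\<close> would satisfy the shuffle relations
  exactly, but need denominators that \<int>/q lacks, where q = p^(n-s+1). With \<open>1 + x\<close>
  shorter words intrude, and what disposes of them is a count of weights. The k-th filtration step
  of \<open>UU\<close> forces entries at distance d from the diagonal to be divisible by p^(k-d), as
  far as q allows. At k = n this means zero for d < s, but only divisibility by p^(n-s) at the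
  corner d = s. A relation modulo q between corner entries can thus be divided by p^(n-s), which
  leaves a relation modulo p, in the coefficient group of \<open>H2\<close>. All coefficients must
  be taken modulo the same q, so those of short words are read off from matrices of full size s + 1.
  Since S is generated by X only topologically, being grouplike is propagated from X as a closed
  condition that defines a subgroup. The cochains on S do explicitly the work of the transgression
  in the five-term sequence: a homomorphism on N that extends to a suitable cochain on S yields a
  class on S/N, and the zero homomorphism yields a coboundary.\<close>

fun conv :: "('x list \<Rightarrow> 'r::comm_ring_1) \<Rightarrow> ('x list \<Rightarrow> 'r) \<Rightarrow> 'x list \<Rightarrow> 'r" where
  "conv F G [] = F [] * G []"
| "conv F G (x # w) = F [] * G (x # w) + conv (\<lambda>w. F (x # w)) G w"

lemma conv_eq_sum: "conv F G w = (\<Sum>i\<le>length w. F (take i w) * G (drop i w))"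
  by (induction F G w rule: conv.induct) (simp_all add: sum.atMost_Suc_shift del: sum.atMost_Suc)

lemma conv_add_left: "conv (\<lambda>w. F w + F' w) G w = conv F G w + conv F' G w"
  by (simp add: conv_eq_sum algebra_simps sum.distrib)

lemma conv_scale_left: "conv (\<lambda>w. c * F w) G w = c * conv F G w"
  by (simp add: conv_eq_sum algebra_simps sum_distrib_left)

text \<open>The left derivative \<open>\<lambda>w. conv F G (x # w)\<close> is a multiple of a
  derivative of \<open>G\<close> plus a convolution with a derivative of \<open>F\<close>. So the
  induction on the word has to run for all \<open>F\<close> and \<open>G\<close> at once, and
  linearity in the left argument closes it.\<close>

lemma conv_assoc: "conv (conv F G) H w = conv F (conv G H) w"
proof (induction w arbitrary: F G)
  case Nil
  then show ?case by (simp add: algebra_simps)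
next
  case (Cons x w)
  have "(\<lambda>w. conv F G (x # w)) = (\<lambda>w. F [] * G (x # w) + conv (\<lambda>w. F (x # w)) G w)"
    by simp
  then show ?case
    using Cons by (simp add: conv_add_left conv_scale_left algebra_simps)
qed

definition unit_series :: "'x list \<Rightarrow> 'r::comm_ring_1" where
  "unit_series w = of_bool (w = [])"

lemma conv_unit_left [simp]: "conv unit_series F w = F w"
proof (cases w)
  case (Cons x v)
  have "conv (\<lambda>w. unit_series (x # w)) F v = 0"
    by (simp add: conv_eq_sum unit_series_def)
  with Cons show ?thesis by (simp add: unit_series_def)
qed (simp add: unit_series_def)

lemma conv_unit_right [simp]: "conv F unit_series w = F w"
  by (induction w arbitrary: F) (simp_all add: unit_series_def)

lemma conv_cong:
  assumes "\<And>i. i \<le> length w \<Longrightarrow> F (take i w) = F' (take i w)"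
    and "\<And>i. i \<le> length w \<Longrightarrow> G (drop i w) = G' (drop i w)"
  shows "conv F G w = conv F' G' w"
  unfolding conv_eq_sum using assms by (intro sum.cong) auto

lemma conv_mod:
  fixes F G :: "'x list \<Rightarrow> int"
  shows "conv (\<lambda>w. F w mod q) G w mod q = conv F G w mod q"
    and "conv F (\<lambda>w. G w mod q) w mod q = conv F G w mod q"
  unfolding conv_eq_sum
  by (subst mod_sum_eq[symmetric], simp add: mod_mult_left_eq mod_mult_right_eq mod_sum_eq)+

text \<open>The infiltration product of Chen, Fox and Lyndon, as a list in order to keep
  multiplicities. Without the merging of two equal letters in the last clause it would list the
  shuffles.\<close>

fun infiltration :: "'x list \<Rightarrow> 'x list \<Rightarrow> 'x list list" where
  "infiltration [] v = [v]"
| "infiltration (x # u) [] = [x # u]"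
| "infiltration (x # u) (y # v) = map ((#) x) (infiltration u (y # v))
     @ map ((#) y) (infiltration (x # u) v)
     @ (if x = y then map ((#) x) (infiltration u v) else [])"

lemma infiltration_Nil_right [simp]: "infiltration u [] = [u]"
  by (cases u) auto

lemma infiltration_Cons_Cons_cases:
  assumes "w \<in> set (infiltration (x # u) (y # v))"
  obtains (left) w' where "w = x # w'" "w' \<in> set (infiltration u (y # v))"
    | (right) w' where "w = y # w'" "w' \<in> set (infiltration (x # u) v)"
    | (both) w' where "w = x # w'" "x = y" "w' \<in> set (infiltration u v)"
  using assms by (auto split: if_splits)

lemma set_infiltration:
  "w \<in> set (infiltration u v) \<Longrightarrow> set w \<subseteq> set u \<union> set v"
proof (induction u v arbitrary: w rule: infiltration.induct)
  case (3 x u y v)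
  from "3.prems" show ?case
    by (cases rule: infiltration_Cons_Cons_cases) (use "3.IH" in \<open>simp; blast\<close>)+
qed auto

lemma set_infiltration_lists:
  "u \<in> lists X \<Longrightarrow> v \<in> lists X \<Longrightarrow> w \<in> set (infiltration u v) \<Longrightarrow> w \<in> lists X"
  using set_infiltration[of w u v] by (simp add: subset_iff lists_eq_set) blast

lemma length_infiltration:
  "w \<in> set (infiltration u v) \<Longrightarrow> length u \<le> length w \<and> length v \<le> length w \<and> length w \<le> length u + length v"
proof (induction u v arbitrary: w rule: infiltration.induct)
  case (3 x u y v)
  from "3.prems" show ?case
  proof (cases rule: infiltration_Cons_Cons_cases)
    case (left w')
    with "3.IH"(1)[of w'] show ?thesis by simp
  next
    case (right w')
    with "3.IH"(2)[of w'] show ?thesis by simp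
  next
    case (both w')
    with "3.IH"(3)[of w'] show ?thesis by simp
  qed
qed auto

text \<open>The coefficient at u \<otimes> v of the image of \<open>F\<close> under the coproduct
  dual to infiltration.\<close>

definition coproduct :: "('x list \<Rightarrow> 'r::comm_ring_1) \<Rightarrow> 'x list \<Rightarrow> 'x list \<Rightarrow> 'r" where
  "coproduct F u v = (\<Sum>w\<leftarrow>infiltration u v. F w)"

lemma coproduct_Nil [simp]: "coproduct F [] v = F v" "coproduct F u [] = F u"
  by (simp_all add: coproduct_def)

lemma coproduct_Cons_Cons:
  "coproduct F (x # u) (y # v) = coproduct (\<lambda>w. F (x # w)) u (y # v)
     + coproduct (\<lambda>w. F (y # w)) (x # u) v
     + of_bool (x = y) * coproduct (\<lambda>w. F (x # w)) u v"
  by (simp add: coproduct_def o_def)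

lemma coproduct_add: "coproduct (\<lambda>w. F w + G w) u v = coproduct F u v + coproduct G u v"
  by (simp add: coproduct_def sum_list_addf)

lemma coproduct_scale: "coproduct (\<lambda>w. c * F w) u v = c * coproduct F u v"
  by (simp add: coproduct_def sum_list_const_mult)

lemma coproduct_cong:
  "(\<And>w. w \<in> set (infiltration u v) \<Longrightarrow> F w = G w) \<Longrightarrow> coproduct F u v = coproduct G u v"
  unfolding coproduct_def by (metis map_cong)

text \<open>Multiplication in the completed tensor square of the series ring: both words are cut
  independently.\<close>

definition conv2 ::
  "('x list \<Rightarrow> 'x list \<Rightarrow> 'r::comm_ring_1) \<Rightarrow> ('x list \<Rightarrow> 'x list \<Rightarrow> 'r) \<Rightarrow> 'x list \<Rightarrow> 'x list \<Rightarrow> 'r"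
  where "conv2 P Q u v =
    (\<Sum>i\<le>length u. \<Sum>j\<le>length v. P (take i u) (take j v) * Q (drop i u) (drop j v))"

lemma conv2_tensor: "conv2 (\<lambda>u v. F u * F' v) (\<lambda>u v. G u * G' v) u v = conv F G u * conv F' G' v"
  by (simp add: conv2_def conv_eq_sum sum_product algebra_simps)

text \<open>The reason is that infiltration is dual to the ring homomorphism determined by
  \<open>x \<mapsto> x \<otimes> 1 + 1 \<otimes> x + x \<otimes> x\<close>, under which \<open>1 + x\<close> is grouplike.\<close>

lemma coproduct_conv: "coproduct (conv F G) u v = conv2 (coproduct F) (coproduct G) u v"
proof (induction u v arbitrary: F G rule: infiltration.induct)
  case (1 v)
  then show ?case by (simp add: conv2_def conv_eq_sum)
next
  case (2 x u)
  then show ?case by (simp add: conv2_def conv_eq_sum)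
next
  case (3 x u y v)
  have eq: "(\<lambda>w. conv F G (z # w)) = (\<lambda>w. F [] * G (z # w) + conv (\<lambda>w. F (z # w)) G w)" for z
    by simp
  have "coproduct (conv F G) (x # u) (y # v) = F [] * coproduct G (x # u) (y # v)
      + conv2 (coproduct (\<lambda>w. F (x # w))) (coproduct G) u (y # v)
      + conv2 (coproduct (\<lambda>w. F (y # w))) (coproduct G) (x # u) v
      + of_bool (x = y) * conv2 (coproduct (\<lambda>w. F (x # w))) (coproduct G) u v"
    unfolding coproduct_Cons_Cons eq coproduct_add coproduct_scale
    using 3 by (auto simp: algebra_simps)
  \<comment> \<open>Split both sums at index 0. The term with \<open>i = j = 0\<close> is the first
    summand. Where both indices are positive, \<open>coproduct_Cons_Cons\<close> gives three terms,
    and those with exactly one index 0 complete the first two of them to full sums.\<close>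
  also have "\<dots> = conv2 (coproduct F) (coproduct G) (x # u) (y # v)"
    by (auto simp: conv2_def sum.atMost_Suc_shift coproduct_Cons_Cons
        algebra_simps sum.distrib sum_distrib_left simp del: sum.atMost_Suc)
  finally show ?case .
qed

lemma coproduct_unit: "coproduct unit_series u v = of_bool (u = [] \<and> v = [])"
  by (induction u v rule: infiltration.induct)
    (simp_all add: coproduct_Cons_Cons unit_series_def, simp_all add: coproduct_def)

text \<open>The merging clause supplies the cross term: for \<open>u = v = [x]\<close> the right
  side is 1, the two shuffles \<open>[x, x]\<close> contribute 0, and the merged word
  \<open>[x]\<close> contributes 1.\<close>

lemma coproduct_one_plus_var:
  fixes x :: 'x
  defines "F \<equiv> \<lambda>w::'x list. of_bool (w = []) + of_bool (w = [x])"
  shows "coproduct F u v = F u * F v"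
proof -
  consider "u = []" | "v = []" | a u' b v' where "u = a # u'" "v = b # v'"
    by (meson neq_Nil_conv)
  then show ?thesis
  proof cases
    case 3
    have "coproduct (\<lambda>w. F (a # w)) u v = of_bool (a = x) * of_bool (u = [] \<and> v = [])" for a u v
    proof -
      have "(\<lambda>w. F (a # w)) = (\<lambda>w. of_bool (a = x) * unit_series w)"
        by (auto simp: F_def unit_series_def)
      then show ?thesis by (simp only: coproduct_scale coproduct_unit)
    qed
    with 3 show ?thesis by (auto simp: coproduct_Cons_Cons F_def)
  qed (simp_all add: F_def)
qed

text \<open>Congruences, because the coefficients will be representatives modulo \<open>q\<close>;
  words over \<open>X\<close> only, because an extensional series has no meaningful values
  elsewhere.\<close>

definition grouplike :: "int \<Rightarrow> 'x set \<Rightarrow> ('x list \<Rightarrow> int) \<Rightarrow> bool" where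
  "grouplike q X F \<longleftrightarrow> F [] = 1 \<and>
    (\<forall>u\<in>lists X. \<forall>v\<in>lists X. [coproduct F u v = F u * F v] (mod q))"

lemma grouplikeD:
  "grouplike q X F \<Longrightarrow> u \<in> lists X \<Longrightarrow> v \<in> lists X \<Longrightarrow> [coproduct F u v = F u * F v] (mod q)"
  unfolding grouplike_def by blast

lemma cong_coproduct:
  "(\<And>w. w \<in> set (infiltration u v) \<Longrightarrow> [F w = G w] (mod q)) \<Longrightarrow>
    [coproduct F u v = coproduct G u v] (mod (q::int))"
proof -
  have "(\<And>w. w \<in> set ws \<Longrightarrow> [F w = G w] (mod q)) \<Longrightarrow> [(\<Sum>w\<leftarrow>ws. F w) = (\<Sum>w\<leftarrow>ws. G w)] (mod q)" for ws
    by (induction ws) (auto intro: cong_add)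
  then show "(\<And>w. w \<in> set (infiltration u v) \<Longrightarrow> [F w = G w] (mod q)) \<Longrightarrow> ?thesis"
    unfolding coproduct_def by blast
qed

lemma cong_conv2:
  assumes "\<And>i j. i \<le> length u \<Longrightarrow> j \<le> length v \<Longrightarrow> [P (take i u) (take j v) = P' (take i u) (take j v)] (mod q)"
    and "\<And>i j. i \<le> length u \<Longrightarrow> j \<le> length v \<Longrightarrow> [Q (drop i u) (drop j v) = Q' (drop i u) (drop j v)] (mod q)"
  shows "[conv2 P Q u v = conv2 P' Q' u v] (mod (q::int))"
  unfolding conv2_def using assms by (intro cong_sum cong_mult) auto

lemma lists_take_drop: "w \<in> lists X \<Longrightarrow> take i w \<in> lists X" "w \<in> lists X \<Longrightarrow> drop i w \<in> lists X"
  by (auto dest: in_set_takeD in_set_dropD)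

text \<open>\<open>coproduct_conv\<close> and \<open>conv2_tensor\<close> turn the two sides into
  products in the tensor square, whose factors agree by hypothesis.\<close>

lemma grouplike_mult:
  assumes F: "grouplike q X F" and G: "grouplike q X G"
    and H: "\<And>w. w \<in> lists X \<Longrightarrow> [H w = conv F G w] (mod q)" "H [] = 1"
  shows "grouplike q X H"
  unfolding grouplike_def
proof (intro conjI ballI)
  fix u v assume uv: "u \<in> lists X" "v \<in> lists X"
  have "[coproduct H u v = coproduct (conv F G) u v] (mod q)"
    using H uv by (intro cong_coproduct) (meson set_infiltration_lists)
  also have "coproduct (conv F G) u v = conv2 (coproduct F) (coproduct G) u v"
    by (rule coproduct_conv)
  also have "[\<dots> = conv2 (\<lambda>u v. F u * F v) (\<lambda>u v. G u * G v) u v] (mod q)"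
    by (intro cong_conv2 grouplikeD[OF F] grouplikeD[OF G] lists_take_drop uv)
  also have "conv2 (\<lambda>u v. F u * F v) (\<lambda>u v. G u * G v) u v = conv F G u * conv F G v"
    by (rule conv2_tensor)
  also have "[conv F G u * conv F G v = H u * H v] (mod q)"
    using H uv by (intro cong_mult) (auto intro: cong_sym)
  finally show "[coproduct H u v = H u * H v] (mod q)" .
qed fact

text \<open>The coproduct of \<open>G\<close> and G \<otimes> G are both right inverses of the
  coproduct of \<open>F\<close>. Its constant term is 1, so it can be cancelled on the left; the
  cancellation is an induction on the total length of the two words.\<close>

lemma grouplike_inverse:
  assumes F: "grouplike q X F" and G: "G [] = 1"
    and FG: "\<And>w. w \<in> lists X \<Longrightarrow> [conv F G w = unit_series w] (mod q)"
  shows "grouplike q X G"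
  unfolding grouplike_def
proof (intro conjI ballI)
  fix u v assume uv: "u \<in> lists X" "v \<in> lists X"
  then show "[coproduct G u v = G u * G v] (mod q)"
  proof (induction "length u + length v" arbitrary: u v rule: less_induct)
    case less
    let ?G = "\<lambda>u v. G u * G v"
    let ?D = "\<lambda>u v. coproduct G u v - G u * G v"
    have "[conv2 (coproduct F) (coproduct G) u v = coproduct unit_series u v] (mod q)"
      unfolding coproduct_conv[symmetric] using FG less.prems
      by (intro cong_coproduct) (meson set_infiltration_lists)
    also have "coproduct unit_series u v = unit_series u * unit_series v"
      by (simp add: coproduct_unit unit_series_def)
    also have "[\<dots> = conv F G u * conv F G v] (mod q)"
      using FG less.prems by (intro cong_mult) (auto intro: cong_sym)
    also have "conv F G u * conv F G v = conv2 (\<lambda>u v. F u * F v) ?G u v"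
      by (rule conv2_tensor[symmetric])
    also have "[\<dots> = conv2 (coproduct F) ?G u v] (mod q)"
      by (intro cong_conv2 cong_sym[OF grouplikeD[OF F]] lists_take_drop less.prems cong_refl)
    finally have a: "[conv2 (coproduct F) (coproduct G) u v - conv2 (coproduct F) ?G u v = 0] (mod q)"
      by (simp add: cong_diff_iff_cong_0)
    have b: "conv2 (coproduct F) (coproduct G) u v - conv2 (coproduct F) ?G u v = conv2 (coproduct F) ?D u v"
      by (simp add: conv2_def sum_subtractf algebra_simps)
    \<comment> \<open>Cutting anything off \<open>u\<close> or \<open>v\<close> leaves a shorter
      pair, at which the difference vanishes by induction. Only the uncut pair remains, with
      coefficient \<open>F [] = 1\<close>.\<close>
    have c: "[conv2 (coproduct F) ?D u v =
        (\<Sum>i\<le>length u. \<Sum>j\<le>length v. of_bool (i = 0 \<and> j = 0) * ?D u v)] (mod q)"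
      unfolding conv2_def
    proof (intro cong_sum)
      fix i j assume ij: "i \<in> {..length u}" "j \<in> {..length v}"
      show "[coproduct F (take i u) (take j v) * ?D (drop i u) (drop j v) = of_bool (i = 0 \<and> j = 0) * ?D u v] (mod q)"
      proof (cases "i = 0 \<and> j = 0")
        case True
        with F show ?thesis by (simp add: grouplike_def)
      next
        case False
        with ij have "length (drop i u) + length (drop j v) < length u + length v" by auto
        then have "[?D (drop i u) (drop j v) = 0] (mod q)"
          using less.hyps[of "drop i u" "drop j v"] less.prems
          by (auto simp: cong_diff_iff_cong_0 dest: in_set_dropD)
        then have "[coproduct F (take i u) (take j v) * ?D (drop i u) (drop j v) =
            coproduct F (take i u) (take j v) * 0] (mod q)"
          by (rule cong_scalar_left)
        moreover have "of_bool (i = 0 \<and> j = 0) * ?D u v = 0" using False by auto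
        ultimately show ?thesis by (simp only: mult_zero_right)
      qed
    qed
    have d: "(\<Sum>i\<le>length u. \<Sum>j\<le>length v. of_bool (i = 0 \<and> j = 0) * ?D u v) = ?D u v"
    proof -
      have "(\<Sum>j\<le>length v. of_bool (i = 0 \<and> j = 0) * ?D u v) = (if i = 0 then ?D u v else 0)" for i :: nat
        by (simp add: of_bool_def if_distrib[of "\<lambda>t. t * _"] cong: if_cong)
      then show ?thesis by simp
    qed
    have "[?D u v = 0] (mod q)"
      using cong_trans[OF cong_sym[OF c] a[unfolded b]] unfolding d .
    then show ?case by (simp add: cong_diff_iff_cong_0)
  qed
qed fact

section \<open>Shuffles as infiltrations of maximal length\<close>

definition shuffle_sets :: "'x list \<Rightarrow> 'x list \<Rightarrow> 'x list \<Rightarrow> nat set set" where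
  "shuffle_sets u v w = {I. I \<subseteq> {..<length w} \<and> nths w I = u \<and> nths w ({..<length w} - I) = v}"

lemma finite_shuffle_sets [simp]: "finite (shuffle_sets u v w)"
  by (rule finite_subset[of _ "Pow {..<length w}"]) (auto simp: shuffle_sets_def)

lemma shuffle_sets_length: "shuffle_sets u v w \<noteq> {} \<Longrightarrow> length w = length u + length v"
proof -
  assume "shuffle_sets u v w \<noteq> {}"
  then obtain I where I: "I \<subseteq> {..<length w}" "nths w I = u" "nths w ({..<length w} - I) = v"
    by (auto simp: shuffle_sets_def)
  have "length u = card I"
    using I(1,2) by (auto simp: length_nths intro!: arg_cong[of _ _ card])
  moreover have "length v = card ({..<length w} - I)"
    using I(1,3) by (auto simp: length_nths intro!: arg_cong[of _ _ card])
  moreover have "card I \<le> card {..<length w}"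
    using I(1) by (intro card_mono) auto
  ultimately show ?thesis
    using I(1) by (simp add: card_Diff_subset finite_subset[OF I(1)])
qed

text \<open>\<open>J\<close> is the complement of \<open>I\<close>, and the conditions on
  cardinalities and length follow from the two restrictions of \<open>w\<close>. So it is enough to
  count the sets \<open>I\<close>.\<close>

lemma shuffle_eq_card: "shuffle u v w = int (card (shuffle_sets u v w))"
proof -
  let ?C = "{(I, J). I \<inter> J = {} \<and> card I = length u \<and> card J = length v \<and>
    I \<union> J = {..<length u + length v} \<and>
    length w = length u + length v \<and> nths w I = u \<and> nths w J = v}"
  have "?C = (\<lambda>I. (I, {..<length w} - I)) ` shuffle_sets u v w" (is "_ = ?f ` _")
  proof (intro equalityI subsetI)
    fix z assume z: "z \<in> ?C"
    obtain I J where zIJ: "z = (I, J)" by (cases z)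
    have *: "I \<inter> J = {} \<and> card I = length u \<and> card J = length v \<and>
        I \<union> J = {..<length u + length v} \<and>
        length w = length u + length v \<and> nths w I = u \<and> nths w J = v"
      using z unfolding zIJ mem_Collect_eq prod.case .
    then have IJ: "I \<inter> J = {}" "I \<union> J = {..<length w}" "nths w I = u" "nths w J = v"
      by (elim conjE, simp only:)+
    have "I \<subseteq> {..<length w}" and J: "J = {..<length w} - I"
      using IJ(1,2) by blast+
    then have "I \<in> shuffle_sets u v w"
      using IJ(3,4) unfolding shuffle_sets_def J by blast
    then show "z \<in> ?f ` shuffle_sets u v w"
      unfolding zIJ J by (rule imageI)
  next
    fix z assume "z \<in> ?f ` shuffle_sets u v w"
    then obtain I where z: "z = ?f I" and I: "I \<in> shuffle_sets u v w" by (rule imageE)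
    then have len: "length w = length u + length v"
      using shuffle_sets_length by blast
    from I have sub: "I \<subseteq> {..<length w}" and u: "nths w I = u" and v: "nths w ({..<length w} - I) = v"
      by (auto simp: shuffle_sets_def)
    have "card I = length u"
      using sub u by (auto simp: length_nths intro!: arg_cong[of _ _ card])
    moreover have "card ({..<length w} - I) = length v"
      using sub v by (auto simp: length_nths intro!: arg_cong[of _ _ card])
    moreover have "I \<union> ({..<length w} - I) = {..<length u + length v}"
      using sub len by auto
    ultimately show "z \<in> ?C"
      unfolding z mem_Collect_eq prod.case using len u v by blast
  qed
  moreover have "inj_on ?f (shuffle_sets u v w)"
    by (rule inj_onI) (metis prod.inject)
  ultimately have "card ?C = card (shuffle_sets u v w)"
    by (simp only: card_image)
  then show ?thesis
    unfolding shuffle_def by (simp only:)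
qed

lemma count_list_map_Cons: "count_list (map ((#) x) ws) (z # w) = of_bool (x = z) * count_list ws w"
  by (induction ws) auto

text \<open>An infiltration of maximal length has merged nothing. In the induction on
  \<open>w\<close>, position 0 lies in \<open>I\<close> or in its complement, which matches the
  first two parts of the recursion.\<close>

lemma count_infiltration:
  "length w = length u + length v \<Longrightarrow> count_list (infiltration u v) w = card (shuffle_sets u v w)"
proof (induction w arbitrary: u v)
  case Nil
  then have "shuffle_sets u v [] = {{}}" by (auto simp: shuffle_sets_def)
  with Nil show ?case by simp
next
  case (Cons z w)
  \<comment> \<open>\<open>A\<close> and \<open>B\<close> collect the shuffles of the tail whose
    removed first letter came from \<open>u\<close>, respectively from \<open>v\<close>. They are
    empty if that letter is not \<open>z\<close> or does not exist.\<close>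
  define A where "A = (if u \<noteq> [] \<and> hd u = z then shuffle_sets (tl u) v w else {})"
  define B where "B = (if v \<noteq> [] \<and> hd v = z then shuffle_sets u (tl v) w else {})"
  have Suc0: "{j. Suc j \<in> I} \<subseteq> {..<n}" if "I \<subseteq> {..<Suc n}" for I n
    using that by auto
  have split: "shuffle_sets u v (z # w) = (\<lambda>I. insert 0 (Suc ` I)) ` A \<union> (\<lambda>I. Suc ` I) ` B" (is "?L = ?R")
  proof (intro equalityI subsetI)
    fix I assume I: "I \<in> ?L"
    define I' where "I' = {j. Suc j \<in> I}"
    have compl: "{j. Suc j < Suc (length w) \<and> Suc j \<notin> I} = {..<length w} - I'"
      by (auto simp: I'_def)
    have sub: "I' \<subseteq> {..<length w}" using I by (auto simp: shuffle_sets_def I'_def)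
    show "I \<in> ?R"
    proof (cases "0 \<in> I")
      case True
      then have "I = insert 0 (Suc ` I')"
        unfolding I'_def by (auto simp: image_iff) (metis not0_implies_Suc)
      moreover have "I' \<in> A"
        using I True sub compl by (auto simp: A_def shuffle_sets_def nths_Cons I'_def[symmetric])
      ultimately show ?thesis by blast
    next
      case False
      then have "I = Suc ` I'"
        unfolding I'_def by (auto simp: image_iff) (metis not0_implies_Suc)
      moreover have "I' \<in> B"
        using I False sub compl by (auto simp: B_def shuffle_sets_def nths_Cons I'_def[symmetric])
      ultimately show ?thesis by blast
    qed
  next
    fix I assume "I \<in> ?R"
    then consider I' where "I' \<in> A" "I = insert 0 (Suc ` I')" | I' where "I' \<in> B" "I = Suc ` I'"
      by blast
    then show "I \<in> ?L"
    proof cases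
      case 1
      have "{j. Suc j \<in> I} = I'" "{j. Suc j < Suc (length w) \<and> Suc j \<notin> I} = {..<length w} - I'"
        using 1 by auto
      with 1 show ?thesis
        by (cases u) (auto simp: A_def shuffle_sets_def nths_Cons split: if_splits)
    next
      case 2
      have "{j. Suc j \<in> I} = I'" "{j. Suc j < Suc (length w) \<and> Suc j \<notin> I} = {..<length w} - I'"
        using 2 by auto
      with 2 show ?thesis
        by (cases v) (auto simp: B_def shuffle_sets_def nths_Cons split: if_splits)
    qed
  qed
  have "card (shuffle_sets u v (z # w)) = card ((\<lambda>I. insert 0 (Suc ` I)) ` A) + card ((\<lambda>I. Suc ` I) ` B)"
    unfolding split by (rule card_Un_disjoint) (auto simp: A_def B_def)
  also have "card ((\<lambda>I. insert 0 (Suc ` I)) ` A) = card A"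
    by (rule card_image) (auto simp: inj_on_def)
  also have "card ((\<lambda>I. Suc ` I) ` B) = card B"
    by (rule card_image) (auto simp: inj_on_def inj_image_eq_iff)
  finally have card: "card (shuffle_sets u v (z # w)) = card A + card B" .
  show ?case
  proof (cases "u = [] \<or> v = []")
    case True
    \<comment> \<open>With an empty word the recursion of \<open>infiltration\<close> stops, so the
      admissible sets are determined directly: no position or every position belongs to
      \<open>I\<close>.\<close>
    have *: "card (shuffle_sets [] v w) = of_bool (v = w)" "card (shuffle_sets v [] w) = of_bool (v = w)"
      if "length v = length w" for v
    proof -
      have all: "nths w {..<length w} = w"
        by (rule nths_all) simp
      have "shuffle_sets [] v w = (if v = w then {{}} else {})"
      proof -
        have e: "I = {}" if "I \<subseteq> {..<length w}" "nths w I = []" for I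
        proof -
          have "card I = 0"
          proof -
            have "card {i. i < length w \<and> i \<in> I} = 0" using that(2) by (metis length_nths list.size(3))
            moreover have "{i. i < length w \<and> i \<in> I} = I" using that(1) by auto
            ultimately show ?thesis by simp
          qed
          with that(1) show ?thesis using finite_subset by fastforce
        qed
        show ?thesis by (auto simp: shuffle_sets_def all dest: e)
      qed
      moreover have "shuffle_sets v [] w = (if v = w then {{..<length w}} else {})"
      proof -
        have e: "I = {..<length w}" if "I \<subseteq> {..<length w}" "nths w ({..<length w} - I) = []" for I
        proof -
          have "card {i. i < length w \<and> i \<in> {..<length w} - I} = 0"
            using that(2) by (metis length_nths list.size(3))
          moreover have "{i. i < length w \<and> i \<in> {..<length w} - I} = {..<length w} - I" by auto
          ultimately have "{..<length w} - I = {}" by (auto simp: card_eq_0_iff)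
          with that(1) show ?thesis by auto
        qed
        show ?thesis by (auto simp: shuffle_sets_def all dest: e)
      qed
      ultimately show "card (shuffle_sets [] v w) = of_bool (v = w)" "card (shuffle_sets v [] w) = of_bool (v = w)"
        by auto
    qed
    show ?thesis
    proof (cases "u = []")
      case True
      with Cons.prems obtain y v' where v: "v = y # v'" by (cases v) auto
      with True Cons.prems have "length v' = length w" by simp
      from *(1)[OF this] have "card A = 0" "card B = of_bool (y = z \<and> v' = w)"
        unfolding A_def B_def v True by auto
      then show ?thesis
        unfolding card by (simp add: v True)
    next
      case False
      with \<open>u = [] \<or> v = []\<close> obtain x u' where u: "u = x # u'" and v: "v = []" by (cases u) auto
      with Cons.prems have "length u' = length w" by simp
      from *(2)[OF this] have "card A = of_bool (x = z \<and> u' = w)" "card B = 0"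
        unfolding A_def B_def u v by auto
      then show ?thesis
        unfolding card by (simp add: u v)
    qed
  next
    case False
    then obtain x u' y v' where uv: "u = x # u'" "v = y # v'"
      by (meson neq_Nil_conv)
    \<comment> \<open>Words from the merging clause are too short: one position would have served
      two letters.\<close>
    have "w \<notin> set (infiltration u' v')"
      using Cons.prems uv length_infiltration[of w u' v'] by auto
    then have "count_list (infiltration u' v') w = 0" by simp
    then show ?thesis
      using Cons.IH[of u' v] Cons.IH[of u v'] Cons.prems uv
      unfolding card by (auto simp: A_def B_def count_list_map_Cons)
  qed
qed

lemma sum_list_map_eq_sum_of_nat_count:
  fixes F :: "'x \<Rightarrow> 'r::comm_semiring_1"
  shows "(\<Sum>x\<leftarrow>xs. F x) = (\<Sum>x\<in>set xs. of_nat (count_list xs x) * F x)"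
proof -
  \<comment> \<open>An arbitrary finite superset \<open>Y\<close> keeps the index set fixed during
    the induction on the list.\<close>
  have "(\<Sum>x\<leftarrow>xs. F x) = (\<Sum>x\<in>Y. of_nat (count_list xs x) * F x)" if "finite Y" "set xs \<subseteq> Y" for Y
    using that(2)
  proof (induction xs)
    case (Cons a xs)
    have "(\<Sum>x\<in>Y. of_nat (count_list (a # xs) x) * F x) =
        (\<Sum>x\<in>Y. (if x = a then F x else 0) + of_nat (count_list xs x) * F x)"
      by (intro sum.cong) (auto simp: algebra_simps)
    also have "\<dots> = F a + (\<Sum>x\<in>Y. of_nat (count_list xs x) * F x)"
      using Cons.prems that(1) by (simp add: sum.distrib)
    finally show ?case using Cons by simp
  qed simp
  then show ?thesis by blast
qed

text \<open>Infiltrations that are not shuffles are shorter than \<open>length u + length v\<close>,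
  and nonempty because \<open>u\<close> is; there \<open>F\<close> vanishes.\<close>

lemma coproduct_eq_sum_shuffle:
  assumes "u \<noteq> []" "v \<noteq> []" "u \<in> lists X" "v \<in> lists X"
    and F: "\<And>w. w \<in> lists X \<Longrightarrow> w \<noteq> [] \<Longrightarrow> length w < length u + length v \<Longrightarrow> F w = 0"
  shows "coproduct F u v =
    (\<Sum>w | w \<in> lists X \<and> length w = length u + length v \<and> shuffle u v w \<noteq> 0. shuffle u v w * F w)"
proof -
  let ?W = "{w. w \<in> lists X \<and> length w = length u + length v \<and> shuffle u v w \<noteq> 0}"
  have "coproduct F u v = (\<Sum>w\<in>set (infiltration u v). int (count_list (infiltration u v) w) * F w)"
    unfolding coproduct_def by (rule sum_list_map_eq_sum_of_nat_count)
  also have "\<dots> = (\<Sum>w\<in>?W. shuffle u v w * F w)"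
  proof (rule sum.mono_neutral_cong_right)
    show W: "?W \<subseteq> set (infiltration u v)"
    proof
      fix w assume "w \<in> ?W"
      then have "count_list (infiltration u v) w \<noteq> 0"
        by (simp add: count_infiltration shuffle_eq_card)
      then show "w \<in> set (infiltration u v)"
        using count_notin by fastforce
    qed
    show "\<forall>w\<in>set (infiltration u v) - ?W. int (count_list (infiltration u v) w) * F w = 0"
    proof
      fix w assume w: "w \<in> set (infiltration u v) - ?W"
      then have wX: "w \<in> lists X" using set_infiltration_lists[OF assms(3,4)] by blast
      show "int (count_list (infiltration u v) w) * F w = 0"
      proof (cases "length w = length u + length v")
        case True
        with w wX show ?thesis by (auto simp: count_infiltration shuffle_eq_card)
      next
        case False
        with w assms(1) length_infiltration[of w u v] have "w \<noteq> []" "length w < length u + length v" by auto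
        with F wX show ?thesis by simp
      qed
    qed
    show "\<And>w. w \<in> ?W \<Longrightarrow> int (count_list (infiltration u v) w) * F w = shuffle u v w * F w"
      by (simp add: count_infiltration shuffle_eq_card)
  qed simp
  finally show ?thesis .
qed

section \<open>The lower \<open>p\<close>-central filtration\<close>

lemma continuous_homI:
  "f \<in> hom G H \<Longrightarrow> continuous_map T T' f \<Longrightarrow> f \<in> continuous_hom G T H T'"
  by (simp add: continuous_hom_def)

section \<open>Closed subgroups and the filtration of a topological group\<close>

context topological_group
begin

lemma closedin_carrier: "closedin T (carrier G)"
  using topspace_eq closedin_topspace by metis

lemma continuous_map_mult:
  assumes "continuous_map U T f" "continuous_map U T g"
  shows "continuous_map U T (\<lambda>x. f x \<otimes> g x)"
proof -
  have "continuous_map U (prod_topology T T) (\<lambda>x. (f x, g x))"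
    using assms by (simp add: continuous_map_pairedI)
  from continuous_map_compose[OF this continuous_mult] show ?thesis
    by (simp add: o_def)
qed

lemma continuous_map_const_carrier: "g \<in> carrier G \<Longrightarrow> continuous_map T T (\<lambda>x. g)"
  by (simp add: topspace_eq)

lemma subgroup_closed_subgroup_generated:
  assumes "A \<subseteq> carrier G"
  shows "subgroup (closed_subgroup_generated G T A) G"
  unfolding closed_subgroup_generated_def
  by (rule subgroups_Inter) (use assms closedin_carrier subgroup_self in auto)

lemma closedin_closed_subgroup_generated:
  assumes "A \<subseteq> carrier G"
  shows "closedin T (closed_subgroup_generated G T A)"
  unfolding closed_subgroup_generated_def
  by (rule closedin_Inter) (use assms closedin_carrier subgroup_self in auto)

lemma subset_closed_subgroup_generated: "A \<subseteq> closed_subgroup_generated G T A"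
  unfolding closed_subgroup_generated_def by blast

lemma closed_subgroup_generated_minimal:
  "subgroup K G \<Longrightarrow> closedin T K \<Longrightarrow> A \<subseteq> K \<Longrightarrow> closed_subgroup_generated G T A \<subseteq> K"
  unfolding closed_subgroup_generated_def by blast

lemma lower_p_central_generators:
  assumes "K \<subseteq> carrier G"
  shows "{h [^] (p::nat) | h. h \<in> K} \<union>
    {inv g \<otimes> inv h \<otimes> g \<otimes> h | g h. g \<in> carrier G \<and> h \<in> K} \<subseteq> carrier G"
  using assms by (auto intro!: m_closed inv_closed nat_pow_closed)

lemma lower_p_central_Suc:
  "n \<ge> 1 \<Longrightarrow> lower_p_central p G T (Suc n) = closed_subgroup_generated G T
      ({h [^] p | h. h \<in> lower_p_central p G T n} \<union>
       {inv g \<otimes> inv h \<otimes> g \<otimes> h | g h. g \<in> carrier G \<and> h \<in> lower_p_central p G T n})"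
  by (cases n) auto

lemma subgroup_lower_p_central: "subgroup (lower_p_central p G T n) G"
proof (induction n)
  case 0
  show ?case by (simp add: subgroup_self)
next
  case (Suc n)
  show ?case
  proof (cases "n = 0")
    case False
    then show ?thesis
      using lower_p_central_generators[OF subgroup.subset[OF Suc]]
      by (simp add: lower_p_central_Suc subgroup_closed_subgroup_generated)
  qed (simp add: subgroup_self)
qed

lemma lower_p_central_subset: "lower_p_central p G T n \<subseteq> carrier G"
  by (rule subgroup.subset) (rule subgroup_lower_p_central)

end

lemma closedin_preimage_subgroup:
  assumes "topological_group G T" "topological_group H T'" "f \<in> continuous_hom G T H T'"
    and "subgroup K H" "closedin T' K"
  shows "subgroup {x \<in> carrier G. f x \<in> K} G" "closedin T {x \<in> carrier G. f x \<in> K}"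
proof -
  interpret G: topological_group G T by fact
  interpret H: topological_group H T' by fact
  interpret K: subgroup K H by fact
  from assms have hom: "f \<in> hom G H" and cont: "continuous_map T T' f"
    by (auto simp: continuous_hom_def)
  interpret group_hom G H f
    by unfold_locales (rule hom)
  show "subgroup {x \<in> carrier G. f x \<in> K} G"
    by (rule G.subgroupI) auto
  show "closedin T {x \<in> carrier G. f x \<in> K}"
    using closedin_continuous_map_preimage[OF cont assms(5)] G.topspace_eq by simp
qed

text \<open>By induction on the step: the preimage of the next step in \<open>H\<close> is a closed
  subgroup that contains the generating powers and commutators in \<open>G\<close>, so minimality of
  the generated closed subgroup applies.\<close>

lemma continuous_hom_lower_p_central:
  assumes "topological_group G T" "topological_group H T'" "f \<in> continuous_hom G T H T'"
  shows "f ` lower_p_central p G T n \<subseteq> lower_p_central p H T' n"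
proof (induction n)
  case 0
  from assms(3) show ?case by (auto simp: continuous_hom_def hom_def)
next
  case (Suc n)
  interpret G: topological_group G T by fact
  interpret H: topological_group H T' by fact
  from assms have hom: "f \<in> hom G H"
    by (simp add: continuous_hom_def)
  interpret group_hom G H f
    by unfold_locales (rule hom)
  show ?case
  proof (cases "n = 0")
    case False
    let ?LG = "lower_p_central p G T n" and ?LH = "lower_p_central p H T' n"
    let ?A = "{h [^]\<^bsub>H\<^esub> p | h. h \<in> ?LH} \<union>
      {inv\<^bsub>H\<^esub> g \<otimes>\<^bsub>H\<^esub> inv\<^bsub>H\<^esub> h \<otimes>\<^bsub>H\<^esub> g \<otimes>\<^bsub>H\<^esub> h | g h. g \<in> carrier H \<and> h \<in> ?LH}"
    let ?K = "closed_subgroup_generated H T' ?A"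
    note A = H.lower_p_central_generators[OF H.lower_p_central_subset[of p n], of p]
    note K = closedin_preimage_subgroup[OF assms
        H.subgroup_closed_subgroup_generated[OF A] H.closedin_closed_subgroup_generated[OF A]]
    have "closed_subgroup_generated G T ({h [^]\<^bsub>G\<^esub> p | h. h \<in> ?LG} \<union>
       {inv\<^bsub>G\<^esub> g \<otimes>\<^bsub>G\<^esub> inv\<^bsub>G\<^esub> h \<otimes>\<^bsub>G\<^esub> g \<otimes>\<^bsub>G\<^esub> h | g h. g \<in> carrier G \<and> h \<in> ?LG})
      \<subseteq> {x \<in> carrier G. f x \<in> ?K}"
    proof (rule G.closed_subgroup_generated_minimal[OF K], intro subsetI)
      fix x assume x: "x \<in> {h [^]\<^bsub>G\<^esub> p | h. h \<in> ?LG} \<union>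
         {inv\<^bsub>G\<^esub> g \<otimes>\<^bsub>G\<^esub> inv\<^bsub>G\<^esub> h \<otimes>\<^bsub>G\<^esub> g \<otimes>\<^bsub>G\<^esub> h | g h. g \<in> carrier G \<and> h \<in> ?LG}"
      then have xG: "x \<in> carrier G"
        using G.lower_p_central_generators[OF G.lower_p_central_subset[of p n], of p] by blast
      from x consider h where "h \<in> ?LG" "x = h [^]\<^bsub>G\<^esub> p"
        | g h where "g \<in> carrier G" "h \<in> ?LG" "x = inv\<^bsub>G\<^esub> g \<otimes>\<^bsub>G\<^esub> inv\<^bsub>G\<^esub> h \<otimes>\<^bsub>G\<^esub> g \<otimes>\<^bsub>G\<^esub> h"
        by blast
      then have "f x \<in> ?A"
      proof cases
        case 1
        then have h: "h \<in> carrier G" "f h \<in> ?LH"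
          using G.lower_p_central_subset Suc by blast+
        then have "f x = f h [^]\<^bsub>H\<^esub> p" using 1 by (simp add: hom_nat_pow)
        with h show ?thesis by blast
      next
        case 2
        then have h: "h \<in> carrier G" "f h \<in> ?LH"
          using G.lower_p_central_subset Suc by blast+
        then have "f x = inv\<^bsub>H\<^esub> f g \<otimes>\<^bsub>H\<^esub> inv\<^bsub>H\<^esub> f h \<otimes>\<^bsub>H\<^esub> f g \<otimes>\<^bsub>H\<^esub> f h"
          using 2 by simp
        moreover have "f g \<in> carrier H" using 2 by simp
        ultimately show ?thesis using h by blast
      qed
      then show "x \<in> {x \<in> carrier G. f x \<in> ?K}"
        using xG G.subset_closed_subgroup_generated H.subset_closed_subgroup_generated by fast
    qed
    with False show ?thesis
      by (auto simp: G.lower_p_central_Suc H.lower_p_central_Suc)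
  qed auto
qed

section \<open>The quotients by the filtration as topological groups\<close>

context topological_group
begin

text \<open>Conjugation is a continuous endomorphism, so normality is an instance of
  functoriality.\<close>

lemma normal_lower_p_central: "lower_p_central p G T n \<lhd> G"
  unfolding normal_inv_iff
proof (intro conjI ballI subgroup_lower_p_central)
  fix g h assume g: "g \<in> carrier G" and h: "h \<in> lower_p_central p G T n"
  let ?c = "\<lambda>x. g \<otimes> x \<otimes> inv g"
  have "?c \<in> hom G G"
    using g inv_solve_left by (auto simp: hom_def m_assoc)
  moreover have "continuous_map T T ?c"
    using g by (intro continuous_map_mult continuous_map_const_carrier) auto
  ultimately have "?c \<in> continuous_hom G T G T"
    by (rule continuous_homI)
  from continuous_hom_lower_p_central[OF _ _ this] h show "?c h \<in> lower_p_central p G T n"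
    using topological_group_axioms by blast
qed

text \<open>The saturation of an open set is the union of its translates by elements of
  \<open>N\<close>, and translations are continuous.\<close>

lemma open_map_quotient:
  assumes "N \<lhd> G"
  shows "open_map T (quotient_topology T (\<lambda>g. N #> g)) (\<lambda>g. N #> g)"
  unfolding open_map_def
proof (intro allI impI)
  fix U assume U: "openin T U"
  interpret N: normal N G by fact
  have UG: "U \<subseteq> carrier G"
    using openin_subset[OF U] topspace_eq by simp
  have "{x \<in> topspace T. N #> x \<in> (\<lambda>g. N #> g) ` U} = (\<Union>k\<in>N. {x \<in> topspace T. k \<otimes> x \<in> U})"
  proof (intro equalityI subsetI)
    fix x assume "x \<in> {x \<in> topspace T. N #> x \<in> (\<lambda>g. N #> g) ` U}"
    then obtain y where x: "x \<in> carrier G" and y: "y \<in> U" "N #> x = N #> y"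
      by (auto simp: topspace_eq)
    then have "y \<in> N #> x" using UG rcos_self[of y N] N.subgroup_axioms by auto
    then obtain k where "k \<in> N" "y = k \<otimes> x" by (auto simp: r_coset_def)
    with x y show "x \<in> (\<Union>k\<in>N. {x \<in> topspace T. k \<otimes> x \<in> U})"
      by (auto simp: topspace_eq)
  next
    fix x assume "x \<in> (\<Union>k\<in>N. {x \<in> topspace T. k \<otimes> x \<in> U})"
    then obtain k where k: "k \<in> N" "x \<in> carrier G" "k \<otimes> x \<in> U"
      by (auto simp: topspace_eq)
    then have "N #> (k \<otimes> x) = N #> x"
      by (metis N.subgroup_axioms N.subset coset_join3 coset_mult_assoc N.mem_carrier subgroup.rcos_const is_group)
    then show "x \<in> {x \<in> topspace T. N #> x \<in> (\<lambda>g. N #> g) ` U}"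
      using k by (auto simp: topspace_eq intro: rev_image_eqI)
  qed
  moreover have "openin T {x \<in> topspace T. k \<otimes> x \<in> U}" if "k \<in> N" for k
    using that U continuous_map_mult[OF continuous_map_const_carrier continuous_map_id[unfolded id_def]]
    by (intro openin_continuous_map_preimage) auto
  ultimately show "openin (quotient_topology T (\<lambda>g. N #> g)) ((\<lambda>g. N #> g) ` U)"
    unfolding openin_quotient_topology using UG topspace_eq by auto
qed

text \<open>For the multiplication to descend, the square of the projection must be a quotient map.
  A product of quotient maps can fail to be one; here it is one because the projection is
  open.\<close>

lemma topological_group_FactGroup:
  assumes "N \<lhd> G"
  shows "topological_group (G Mod N) (quotient_topology T (\<lambda>g. N #> g))" (is "topological_group ?Q ?TQ")
proof -
  interpret N: normal N G by fact
  interpret Q: group "G Mod N" by (rule N.factorgroup_is_group)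
  let ?f = "\<lambda>g. N #> g"
  have q: "quotient_map T ?TQ ?f"
    by (rule quotient_map_quotient_topology)
  then have f: "continuous_map T ?TQ ?f"
    by (rule quotient_imp_continuous_map)
  have top: "topspace ?TQ = carrier ?Q"
    using quotient_imp_surjective_map[OF q] by (simp add: topspace_eq carrier_FactGroup)
  have "quotient_map (prod_topology T T) (prod_topology ?TQ ?TQ) (\<lambda>(x, y). (?f x, ?f y))"
  proof (rule continuous_open_imp_quotient_map)
    show "continuous_map (prod_topology T T) (prod_topology ?TQ ?TQ) (\<lambda>(x, y). (?f x, ?f y))"
      using f by (auto simp: case_prod_unfold intro!: continuous_map_pairedI
          continuous_map_compose[OF continuous_map_fst f, unfolded o_def]
          continuous_map_compose[OF continuous_map_snd f, unfolded o_def])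
    show "open_map (prod_topology T T) (prod_topology ?TQ ?TQ) (\<lambda>(x, y). (?f x, ?f y))"
      unfolding open_map_def
    proof (intro allI impI)
      fix W assume W: "openin (prod_topology T T) W"
      show "openin (prod_topology ?TQ ?TQ) ((\<lambda>(x, y). (?f x, ?f y)) ` W)"
        unfolding openin_prod_topology_alt
      proof (intro allI impI)
        fix a b assume "(a, b) \<in> (\<lambda>(x, y). (?f x, ?f y)) ` W"
        then obtain x y where xy: "(x, y) \<in> W" "a = ?f x" "b = ?f y" by auto
        then obtain U V where UV: "openin T U" "openin T V" "x \<in> U" "y \<in> V" "U \<times> V \<subseteq> W"
          using W unfolding openin_prod_topology_alt by meson
        have "openin ?TQ (?f ` U)" "openin ?TQ (?f ` V)"
          using open_map_quotient[OF assms] UV by (auto simp: open_map_def)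
        moreover have "a \<in> ?f ` U" "b \<in> ?f ` V" "?f ` U \<times> ?f ` V \<subseteq> (\<lambda>(x, y). (?f x, ?f y)) ` W"
          using xy UV by (auto simp: image_iff)
        ultimately show "\<exists>U V. openin ?TQ U \<and> openin ?TQ V \<and> a \<in> U \<and> b \<in> V \<and>
            U \<times> V \<subseteq> (\<lambda>(x, y). (?f x, ?f y)) ` W"
          by blast
      qed
    qed
    show "(\<lambda>(x, y). (?f x, ?f y)) ` topspace (prod_topology T T) = topspace (prod_topology ?TQ ?TQ)"
      by (auto simp: top topspace_eq carrier_FactGroup image_iff)
  qed
  moreover have "continuous_map (prod_topology T T) ?TQ
      ((\<lambda>(x, y). x \<otimes>\<^bsub>?Q\<^esub> y) \<circ> (\<lambda>(x, y). (?f x, ?f y)))"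
  proof (rule continuous_map_eq[OF continuous_map_compose[OF continuous_mult f]])
    fix z assume "z \<in> topspace (prod_topology T T)"
    then show "(?f \<circ> (\<lambda>(x, y). x \<otimes> y)) z = ((\<lambda>(x, y). x \<otimes>\<^bsub>?Q\<^esub> y) \<circ> (\<lambda>(x, y). (?f x, ?f y))) z"
      by (auto simp: topspace_eq N.rcos_sum)
  qed
  ultimately have "continuous_map (prod_topology ?TQ ?TQ) ?TQ (\<lambda>(x, y). x \<otimes>\<^bsub>?Q\<^esub> y)"
    by (rule continuous_compose_quotient_map)
  moreover have "continuous_map ?TQ ?TQ (\<lambda>x. inv\<^bsub>?Q\<^esub> x)"
  proof (rule continuous_compose_quotient_map[OF q],
      rule continuous_map_eq[OF continuous_map_compose[OF continuous_inv f]])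
    fix x assume "x \<in> topspace T"
    then have "x \<in> carrier G" by (simp add: topspace_eq)
    then show "(?f \<circ> (\<lambda>x. inv x)) x = ((\<lambda>x. inv\<^bsub>?Q\<^esub> x) \<circ> ?f) x"
      using N.inv_FactGroup[of "?f x"] N.rcos_inv by (auto simp: carrier_FactGroup)
  qed
  ultimately show ?thesis
    using top by unfold_locales auto
qed

lemma topological_group_p_quotient:
  "topological_group (p_quotient p n G T) (p_quotient_topology p n G T)"
  using topological_group_FactGroup[OF normal_lower_p_central]
  by (simp add: p_quotient_def p_quotient_topology_def p_proj_def[abs_def])

lemma quotient_map_p_proj: "quotient_map T (p_quotient_topology p n G T) (p_proj p n G T)"
  unfolding p_quotient_topology_def by (rule quotient_map_quotient_topology)

lemma p_proj_hom: "p_proj p n G T \<in> hom G (p_quotient p n G T)"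
  using normal.r_coset_hom_Mod[OF normal_lower_p_central]
  by (simp add: p_quotient_def p_proj_def[abs_def])

lemma p_proj_image: "p_proj p n G T ` carrier G = carrier (p_quotient p n G T)"
  by (simp add: p_quotient_def p_proj_def carrier_FactGroup)

lemma p_proj_eq_iff:
  assumes "g \<in> carrier G" "h \<in> carrier G"
  shows "p_proj p n G T g = p_proj p n G T h \<longleftrightarrow> (\<exists>k\<in>lower_p_central p G T n. g = k \<otimes> h)"
proof
  assume "p_proj p n G T g = p_proj p n G T h"
  then have "g \<in> lower_p_central p G T n #> h"
    using rcos_self[OF assms(1) subgroup_lower_p_central, of p n] by (simp add: p_proj_def)
  then show "\<exists>k\<in>lower_p_central p G T n. g = k \<otimes> h"
    by (auto simp: r_coset_def)
next
  assume "\<exists>k\<in>lower_p_central p G T n. g = k \<otimes> h"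
  then obtain k where k: "k \<in> lower_p_central p G T n" "g = k \<otimes> h" by blast
  then have "g \<in> lower_p_central p G T n #> h"
    using assms lower_p_central_subset by (auto intro: rcosI)
  then show "p_proj p n G T g = p_proj p n G T h"
    unfolding p_proj_def
    by (metis assms(2) repr_independence subgroup_lower_p_central)
qed

end

text \<open>As \<open>f\<close> respects the filtration, the values over a coset form a singleton.
  This gives \<open>the_elem\<close> in \<open>p_induced\<close> its meaning.\<close>

lemma p_induced_p_proj:
  assumes "topological_group G T" "topological_group H T'" "f \<in> continuous_hom G T H T'"
    and g: "g \<in> carrier G"
  shows "p_induced p n G T H T' f (p_proj p n G T g) = p_proj p n H T' (f g)"
proof -
  interpret G: topological_group G T by fact
  interpret H: topological_group H T' by fact
  have f: "f \<in> hom G H" using assms by (simp add: continuous_hom_def)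
  have "(\<lambda>g. p_proj p n H T' (f g)) ` p_proj p n G T g = {p_proj p n H T' (f g)}"
  proof (intro equalityI subsetI)
    fix c assume "c \<in> (\<lambda>g. p_proj p n H T' (f g)) ` p_proj p n G T g"
    then obtain k where k: "k \<in> lower_p_central p G T n" and c: "c = p_proj p n H T' (f (k \<otimes>\<^bsub>G\<^esub> g))"
      by (auto simp: p_proj_def r_coset_def)
    have kG: "k \<in> carrier G" using k G.lower_p_central_subset by blast
    have "f k \<in> lower_p_central p H T' n"
      using continuous_hom_lower_p_central[OF assms(1-3)] k by blast
    then have "p_proj p n H T' (f k \<otimes>\<^bsub>H\<^esub> f g) = p_proj p n H T' (f g)"
      using f g kG by (subst H.p_proj_eq_iff) (auto simp: hom_def)
    then show "c \<in> {p_proj p n H T' (f g)}"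
      using c f g kG by (simp add: hom_mult)
  next
    have "g \<in> p_proj p n G T g"
      unfolding p_proj_def by (rule G.rcos_self[OF g G.subgroup_lower_p_central])
    then show "c \<in> (\<lambda>g. p_proj p n H T' (f g)) ` p_proj p n G T g"
      if "c \<in> {p_proj p n H T' (f g)}" for c using that by blast
  qed
  then show ?thesis
    using g G.p_proj_image[of p n] by (auto simp: p_induced_def)
qed

lemma p_induced_continuous_hom:
  assumes "topological_group G T" "topological_group H T'" "f \<in> continuous_hom G T H T'"
  shows "p_induced p n G T H T' f \<in> continuous_hom (p_quotient p n G T) (p_quotient_topology p n G T)
    (p_quotient p n H T') (p_quotient_topology p n H T')"
proof (rule continuous_homI)
  interpret G: topological_group G T by fact
  interpret H: topological_group H T' by fact
  have f: "f \<in> hom G H" and fc: "continuous_map T T' f"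
    using assms by (auto simp: continuous_hom_def)
  note ind = p_induced_p_proj[OF assms]
  show "p_induced p n G T H T' f \<in> hom (p_quotient p n G T) (p_quotient p n H T')"
  proof (rule homI)
    fix c assume "c \<in> carrier (p_quotient p n G T)"
    then obtain g where g: "g \<in> carrier G" "c = p_proj p n G T g"
      using G.p_proj_image[of p n] by auto
    then show "p_induced p n G T H T' f c \<in> carrier (p_quotient p n H T')"
      using H.p_proj_image[of p n] f by (auto simp: ind hom_def)
    fix d assume "d \<in> carrier (p_quotient p n G T)"
    then obtain h where h: "h \<in> carrier G" "d = p_proj p n G T h"
      using G.p_proj_image[of p n] by auto
    have "c \<otimes>\<^bsub>p_quotient p n G T\<^esub> d = p_proj p n G T (g \<otimes>\<^bsub>G\<^esub> h)"
      using g h by (simp add: hom_mult[OF G.p_proj_hom])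
    moreover have "f g \<in> carrier H" "f h \<in> carrier H" using f g h by (auto simp: hom_def)
    ultimately show "p_induced p n G T H T' f (c \<otimes>\<^bsub>p_quotient p n G T\<^esub> d) =
        p_induced p n G T H T' f c \<otimes>\<^bsub>p_quotient p n H T'\<^esub> p_induced p n G T H T' f d"
      using g h by (simp add: ind hom_mult[OF f] hom_mult[OF H.p_proj_hom])
  qed
  have "continuous_map T (p_quotient_topology p n H T') (p_induced p n G T H T' f \<circ> p_proj p n G T)"
  proof (rule continuous_map_eq[OF continuous_map_compose[OF fc quotient_imp_continuous_map[OF H.quotient_map_p_proj]]])
    fix x assume "x \<in> topspace T"
    then show "(p_proj p n H T' \<circ> f) x = (p_induced p n G T H T' f \<circ> p_proj p n G T) x"
      by (simp add: G.topspace_eq ind)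
  qed
  then show "continuous_map (p_quotient_topology p n G T) (p_quotient_topology p n H T') (p_induced p n G T H T' f)"
    by (rule continuous_compose_quotient_map[OF G.quotient_map_p_proj])
qed

section \<open>Unipotent matrices\<close>

lemma (in residues) finsum_eq_sum_mod:
  "finite A \<Longrightarrow> f \<in> A \<rightarrow> carrier R \<Longrightarrow> finsum R f A = (\<Sum>x\<in>A. f x) mod m"
proof (induction A rule: finite_induct)
  case empty
  then show ?case by (simp add: res_zero_eq)
next
  case (insert a A)
  then show ?case
    by (simp add: finsum_insert res_add_eq mod_add_right_eq)
qed

lemma topological_group_discrete:
  assumes "group G"
  shows "topological_group G (discrete_topology (carrier G))"
proof -
  interpret group G by fact
  show ?thesis
    by unfold_locales (auto simp flip: prod_topology_discrete_topology)
qed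

definition mat_mult_mod :: "'i set \<Rightarrow> int \<Rightarrow> ('i \<times> 'i \<Rightarrow> int) \<Rightarrow> ('i \<times> 'i \<Rightarrow> int) \<Rightarrow> 'i \<times> 'i \<Rightarrow> int" where
  "mat_mult_mod I q M N = (\<lambda>(i, j) \<in> I \<times> I. (\<Sum>l\<in>I. M (i, l) * N (l, j)) mod q)"

text \<open>Inner reductions modulo \<open>q\<close> are absorbed by the outer one; what remains is
  an interchange of sums of integers.\<close>

lemma mat_mult_mod_assoc:
  "mat_mult_mod I q (mat_mult_mod I q M N) P = mat_mult_mod I q M (mat_mult_mod I q N P)"
proof -
  have "(\<Sum>l\<in>I. (\<Sum>k\<in>I. M (i, k) * N (k, l)) mod q * P (l, j)) mod q =
      (\<Sum>k\<in>I. M (i, k) * ((\<Sum>l\<in>I. N (k, l) * P (l, j)) mod q)) mod q" for i j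
  proof -
    have "(\<Sum>l\<in>I. (\<Sum>k\<in>I. M (i, k) * N (k, l)) mod q * P (l, j)) mod q =
        (\<Sum>l\<in>I. (\<Sum>k\<in>I. M (i, k) * N (k, l)) * P (l, j)) mod q"
      by (subst (1 2) mod_sum_eq[symmetric]) (simp only: mod_mult_left_eq)
    also have "(\<Sum>l\<in>I. (\<Sum>k\<in>I. M (i, k) * N (k, l)) * P (l, j)) =
        (\<Sum>l\<in>I. \<Sum>k\<in>I. M (i, k) * (N (k, l) * P (l, j)))"
      by (simp only: sum_distrib_right mult.assoc)
    also have "\<dots> = (\<Sum>k\<in>I. M (i, k) * (\<Sum>l\<in>I. N (k, l) * P (l, j)))"
      by (subst sum.swap) (simp only: sum_distrib_left)
    also have "\<dots> mod q = (\<Sum>k\<in>I. M (i, k) * ((\<Sum>l\<in>I. N (k, l) * P (l, j)) mod q)) mod q"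
      by (subst (1 2) mod_sum_eq[symmetric]) (simp only: mod_mult_right_eq)
    finally show ?thesis .
  qed
  then show ?thesis
    unfolding mat_mult_mod_def by (intro restrict_ext) (auto cong: sum.cong)
qed

section \<open>The group of unipotent matrices over \<int>/q\<close>

locale unipotent_setting =
  fixes p n s :: nat
  assumes p: "p > 1" and s: "1 \<le> s" "s \<le> n"
begin

definition q :: int where "q = int p ^ (n - s + 1)"

lemma q_gt_1: "q > 1"
  unfolding q_def using p by (intro one_less_power) auto

abbreviation "U \<equiv> UU p n s"

lemma carrier_UU:
  "M \<in> carrier U \<longleftrightarrow> M \<in> {1..s+1} \<times> {1..s+1} \<rightarrow>\<^sub>E {0..<q} \<and>
    (\<forall>i\<in>{1..s+1}. M (i, i) = 1) \<and> (\<forall>i\<in>{1..s+1}. \<forall>j\<in>{1..s+1}. j < i \<longrightarrow> M (i, j) = 0)"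
proof -
  have "{0..q - 1} = {0..<q}" by auto
  then show ?thesis
    by (simp add: UU_def unipotent_group_def Zmod_def residue_ring_def q_def)
qed

lemma UU_entry_range: "M \<in> carrier U \<Longrightarrow> i \<in> {1..s+1} \<Longrightarrow> j \<in> {1..s+1} \<Longrightarrow> M (i, j) \<in> {0..<q}"
  unfolding carrier_UU by auto

lemma UU_eqI:
  assumes "M \<in> carrier U" "N \<in> carrier U"
    and "\<And>i j. 1 \<le> i \<Longrightarrow> i < j \<Longrightarrow> j \<le> s + 1 \<Longrightarrow> M (i, j) = N (i, j)"
  shows "M = N"
proof (rule PiE_ext)
  show "M \<in> {1..s+1} \<times> {1..s+1} \<rightarrow>\<^sub>E {0..<q}" "N \<in> {1..s+1} \<times> {1..s+1} \<rightarrow>\<^sub>E {0..<q}"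
    using assms by (simp_all add: carrier_UU)
  fix x assume x: "x \<in> {1..s+1} \<times> {1..s+1}"
  obtain i j where ij: "x = (i, j)" by (cases x)
  consider "i < j" | "i = j" | "j < i" by linarith
  then show "M x = N x"
  proof cases
    case 1
    then show ?thesis using assms(3)[of i j] x ij by auto
  next
    case 2
    with assms(1,2)[unfolded carrier_UU] x ij show ?thesis by auto
  next
    case 3
    with assms(1,2)[unfolded carrier_UU] x ij show ?thesis by auto
  qed
qed

lemma mult_UU:
  assumes "M \<in> {1..s+1} \<times> {1..s+1} \<rightarrow>\<^sub>E {0..<q}" "N \<in> {1..s+1} \<times> {1..s+1} \<rightarrow>\<^sub>E {0..<q}"
  shows "M \<otimes>\<^bsub>U\<^esub> N = mat_mult_mod {1..s+1} q M N"
proof -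
  interpret R: residues q "residue_ring q"
    by unfold_locales (rule q_gt_1)
  have "(\<Oplus>\<^bsub>residue_ring q\<^esub>l\<in>{1..s+1}. M (i, l) \<otimes>\<^bsub>residue_ring q\<^esub> N (l, j)) = (\<Sum>l\<in>{1..s+1}. M (i, l) * N (l, j)) mod q"
    if "i \<in> {1..s+1}" "j \<in> {1..s+1}" for i j
  proof -
    have "(\<Oplus>\<^bsub>residue_ring q\<^esub>l\<in>{1..s+1}. M (i, l) \<otimes>\<^bsub>residue_ring q\<^esub> N (l, j)) =
        (\<Sum>l\<in>{1..s+1}. M (i, l) \<otimes>\<^bsub>residue_ring q\<^esub> N (l, j)) mod q"
      using assms that q_gt_1
      by (intro R.finsum_eq_sum_mod) (auto simp: R.res_mult_eq R.res_carrier_eq)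
    then show ?thesis by (simp only: R.res_mult_eq mod_sum_eq)
  qed
  note * = this
  have "U = unipotent_group (s + 1) (residue_ring q)"
    by (simp only: UU_def Zmod_def q_def)
  then have "M \<otimes>\<^bsub>U\<^esub> N = (\<lambda>(i, j) \<in> {1..s+1} \<times> {1..s+1}.
      \<Oplus>\<^bsub>residue_ring q\<^esub>l\<in>{1..s+1}. M (i, l) \<otimes>\<^bsub>residue_ring q\<^esub> N (l, j))"
    by (simp only: unipotent_group_def monoid.simps)
  also have "\<dots> = mat_mult_mod {1..s+1} q M N"
    unfolding mat_mult_mod_def by (rule restrict_ext) (simp only: mem_Sigma_iff split_paired_all prod.case *)
  finally show ?thesis .
qed

lemma sum_upper_triangular:
  assumes "M \<in> carrier U" "N \<in> carrier U" "1 \<le> i" "i < j" "j \<le> s + 1"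
  shows "(\<Sum>l\<in>{1..s+1}. M (i, l) * N (l, j)) = M (i, j) + N (i, j) + (\<Sum>l\<in>{i<..<j}. M (i, l) * N (l, j))"
proof -
  have "(\<Sum>l\<in>{1..s+1}. M (i, l) * N (l, j)) = (\<Sum>l\<in>insert i (insert j {i<..<j}). M (i, l) * N (l, j))"
  proof (rule sum.mono_neutral_right)
    show "\<forall>l\<in>{1..s+1} - insert i (insert j {i<..<j}). M (i, l) * N (l, j) = 0"
    proof
      fix l assume "l \<in> {1..s+1} - insert i (insert j {i<..<j})"
      then have "l \<in> {1..s+1}" "l < i \<or> j < l" by auto
      then show "M (i, l) * N (l, j) = 0"
        using assms unfolding carrier_UU by auto
    qed
  qed (use assms in auto)
  also have "\<dots> = M (i, j) + N (i, j) + (\<Sum>l\<in>{i<..<j}. M (i, l) * N (l, j))"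
    using assms unfolding carrier_UU by auto
  finally show ?thesis .
qed

lemma mult_UU_entry:
  assumes "M \<in> carrier U" "N \<in> carrier U" "1 \<le> i" "i < j" "j \<le> s + 1"
  shows "(M \<otimes>\<^bsub>U\<^esub> N) (i, j) = (M (i, j) + N (i, j) + (\<Sum>l\<in>{i<..<j}. M (i, l) * N (l, j))) mod q"
  using assms sum_upper_triangular[OF assms] by (subst mult_UU) (auto simp: carrier_UU mat_mult_mod_def)

lemma mult_UU_closed:
  assumes M: "M \<in> carrier U" and N: "N \<in> carrier U"
  shows "M \<otimes>\<^bsub>U\<^esub> N \<in> carrier U"
proof -
  have "(\<Sum>l\<in>{1..s+1}. M (i, l) * N (l, i)) = 1" if i: "i \<in> {1..s+1}" for i
  proof -
    have "M (i, l) * N (l, i) = (if l = i then 1 else 0)" if "l \<in> {1..s+1}" for l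
    proof -
      consider "l < i" | "l = i" | "i < l" by linarith
      then show ?thesis using M N i that unfolding carrier_UU by cases auto
    qed
    then have "(\<Sum>l\<in>{1..s+1}. M (i, l) * N (l, i)) = (\<Sum>l\<in>{1..s+1}. if l = i then 1 else 0)"
      by (intro sum.cong) auto
    also have "\<dots> = 1" using i by (subst sum.delta) auto
    finally show ?thesis .
  qed
  moreover have "(\<Sum>l\<in>{1..s+1}. M (i, l) * N (l, j)) = 0"
    if "i \<in> {1..s+1}" "j \<in> {1..s+1}" "j < i" for i j
  proof (rule sum.neutral, rule ballI)
    fix l assume l: "l \<in> {1..s+1}"
    have "l < i \<or> j < l" using that by linarith
    then show "M (i, l) * N (l, j) = 0" using M N l that unfolding carrier_UU by auto
  qed
  moreover have "M \<otimes>\<^bsub>U\<^esub> N = (\<lambda>(i, j) \<in> {1..s+1} \<times> {1..s+1}. (\<Sum>l\<in>{1..s+1}. M (i, l) * N (l, j)) mod q)"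
    using M N mult_UU[of M N] by (simp add: carrier_UU mat_mult_mod_def)
  ultimately show ?thesis
    using q_gt_1 by (subst carrier_UU) auto
qed

lemma one_UU: "\<one>\<^bsub>U\<^esub> = (\<lambda>(i, j) \<in> {1..s+1} \<times> {1..s+1}. if i = j then 1 else 0)"
  by (simp add: UU_def unipotent_group_def Zmod_def residue_ring_def cong: if_cong)

lemma one_UU_entry: "1 \<le> i \<Longrightarrow> i < j \<Longrightarrow> j \<le> s + 1 \<Longrightarrow> \<one>\<^bsub>U\<^esub> (i, j) = 0"
  by (simp add: one_UU)

lemma one_UU_closed: "\<one>\<^bsub>U\<^esub> \<in> carrier U"
  using q_gt_1 by (subst carrier_UU) (auto simp: one_UU)

lemma monoid_UU: "monoid U"
proof (rule monoidI)
  fix M N P assume MNP: "M \<in> carrier U" "N \<in> carrier U" "P \<in> carrier U"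
  then have E: "M \<in> {1..s+1} \<times> {1..s+1} \<rightarrow>\<^sub>E {0..<q}" "N \<in> {1..s+1} \<times> {1..s+1} \<rightarrow>\<^sub>E {0..<q}"
    "P \<in> {1..s+1} \<times> {1..s+1} \<rightarrow>\<^sub>E {0..<q}"
    "M \<otimes>\<^bsub>U\<^esub> N \<in> {1..s+1} \<times> {1..s+1} \<rightarrow>\<^sub>E {0..<q}" "N \<otimes>\<^bsub>U\<^esub> P \<in> {1..s+1} \<times> {1..s+1} \<rightarrow>\<^sub>E {0..<q}"
    using mult_UU_closed[of M N] mult_UU_closed[of N P] by (auto simp: carrier_UU)
  show "M \<otimes>\<^bsub>U\<^esub> N \<otimes>\<^bsub>U\<^esub> P = M \<otimes>\<^bsub>U\<^esub> (N \<otimes>\<^bsub>U\<^esub> P)"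
    by (simp only: mult_UU[OF E(1,2)] mult_UU[OF E(2,3)] mult_UU[OF E(4,3)[unfolded mult_UU[OF E(1,2)]]]
        mult_UU[OF E(1,5)[unfolded mult_UU[OF E(2,3)]]] mat_mult_mod_assoc)
next
  fix M assume M: "M \<in> carrier U"
  show "\<one>\<^bsub>U\<^esub> \<otimes>\<^bsub>U\<^esub> M = M"
  proof (rule UU_eqI)
    fix i j assume ij: "1 \<le> i" "i < j" "j \<le> s + 1"
    have "(\<Sum>l\<in>{i<..<j}. \<one>\<^bsub>U\<^esub> (i, l) * M (l, j)) = 0"
      using ij by (intro sum.neutral) (auto simp: one_UU_entry)
    with M ij UU_entry_range[OF M, of i j] show "(\<one>\<^bsub>U\<^esub> \<otimes>\<^bsub>U\<^esub> M) (i, j) = M (i, j)"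
      by (simp add: mult_UU_entry one_UU_closed one_UU_entry)
  qed (use M one_UU_closed mult_UU_closed in auto)
  show "M \<otimes>\<^bsub>U\<^esub> \<one>\<^bsub>U\<^esub> = M"
  proof (rule UU_eqI)
    fix i j assume ij: "1 \<le> i" "i < j" "j \<le> s + 1"
    have "(\<Sum>l\<in>{i<..<j}. M (i, l) * \<one>\<^bsub>U\<^esub> (l, j)) = 0"
      using ij by (intro sum.neutral) (auto simp: one_UU_entry)
    with M ij UU_entry_range[OF M, of i j] show "(M \<otimes>\<^bsub>U\<^esub> \<one>\<^bsub>U\<^esub>) (i, j) = M (i, j)"
      by (simp add: mult_UU_entry one_UU_closed one_UU_entry)
  qed (use M one_UU_closed mult_UU_closed in auto)
qed (auto simp: mult_UU_closed one_UU_closed)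

text \<open>The divisor demanded of entries on the \<open>d\<close>-th superdiagonal at stage
  \<open>k\<close>. Truncated subtraction makes the demand void for
  \<open>d \<ge> k\<close>.\<close>

definition level :: "nat \<Rightarrow> nat \<Rightarrow> int" where
  "level k d = int p ^ min (k - d) (n - s + 1)"

lemma level_dvd_q: "level k d dvd q"
  unfolding level_def q_def by (rule le_imp_power_dvd) simp

lemma level_antimono: "d \<le> d' \<Longrightarrow> level k d' dvd level k d"
  unfolding level_def by (rule le_imp_power_dvd) simp

text \<open>Moving outwards by at least one superdiagonal pays for the passage to the next stage;
  this is the gain in commutators.\<close>

lemma level_Suc_dvd: "d < d' \<Longrightarrow> level (Suc k) d' dvd level k d"
  unfolding level_def by (intro le_imp_power_dvd min.mono) auto

lemma level_Suc_dvd_mult: "level (Suc k) d dvd int p * level k d"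
proof -
  have "int p * level k d = int p ^ Suc (min (k - d) (n - s + 1))" by (simp add: level_def)
  also have "level (Suc k) d dvd \<dots>"
    unfolding level_def by (rule le_imp_power_dvd) simp
  finally show ?thesis .
qed

text \<open>The distances a and b from \<open>l\<close> are positive. If k exceeds or equals both,
  then (k - a) + (k - b) \<ge> k + 1 - (a + b); otherwise the exponent on the left is 0.\<close>

lemma level_Suc_dvd_product:
  assumes "i < l" "l < j"
  shows "level (Suc k) (j - i) dvd level k (l - i) * level k (j - l)"
  unfolding level_def power_add[symmetric] using assms by (intro le_imp_power_dvd) auto

text \<open>The lower \<open>p\<close>-central filtration of \<open>U\<close> is bounded by the filtration that asks the \<open>d\<close>-th
  superdiagonal to vanish modulo \<open>p\<^sup>k\<^sup>-\<^sup>d\<close>. The exponent is cut off at that of \<open>q\<close>, since only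
  congruences modulo divisors of \<open>q\<close> are meaningful in \<open>\<int>/q\<close>.\<close>

definition level_cong :: "nat \<Rightarrow> (nat \<times> nat \<Rightarrow> int) \<Rightarrow> (nat \<times> nat \<Rightarrow> int) \<Rightarrow> bool" where
  "level_cong k M N \<longleftrightarrow>
    (\<forall>i j. 1 \<le> i \<longrightarrow> i < j \<longrightarrow> j \<le> s + 1 \<longrightarrow> [M (i, j) = N (i, j)] (mod level k (j - i)))"

definition level_subgroup :: "nat \<Rightarrow> (nat \<times> nat \<Rightarrow> int) set" where
  "level_subgroup k = {M \<in> carrier U. level_cong k M \<one>\<^bsub>U\<^esub>}"

lemma level_congD:
  "level_cong k M N \<Longrightarrow> 1 \<le> i \<Longrightarrow> i < j \<Longrightarrow> j \<le> s + 1 \<Longrightarrow> [M (i, j) = N (i, j)] (mod level k (j - i))"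
  unfolding level_cong_def by blast

lemma level_cong_sym: "level_cong k M N \<Longrightarrow> level_cong k N M"
  unfolding level_cong_def by (blast intro: cong_sym)

lemma level_subgroup_iff:
  "M \<in> level_subgroup k \<longleftrightarrow> M \<in> carrier U \<and>
    (\<forall>i j. 1 \<le> i \<longrightarrow> i < j \<longrightarrow> j \<le> s + 1 \<longrightarrow> level k (j - i) dvd M (i, j))"
  by (auto simp: level_subgroup_def level_cong_def one_UU_entry cong_0_iff)

lemma level_subgroupD:
  "M \<in> level_subgroup k \<Longrightarrow> 1 \<le> i \<Longrightarrow> i < j \<Longrightarrow> j \<le> s + 1 \<Longrightarrow> level k (j - i) dvd M (i, j)"
  unfolding level_subgroup_iff by blast

lemma mult_UU_entry_cong:
  assumes "M \<in> carrier U" "N \<in> carrier U" "1 \<le> i" "i < j" "j \<le> s + 1"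
  shows "[(M \<otimes>\<^bsub>U\<^esub> N) (i, j) = M (i, j) + N (i, j) + (\<Sum>l\<in>{i<..<j}. M (i, l) * N (l, j))]
    (mod level k d)"
  unfolding mult_UU_entry[OF assms]
  by (rule cong_dvd_modulus[OF _ level_dvd_q]) (simp add: cong_def)

text \<open>The factors of a cross term lie nearer to the diagonal than \<open>(i, j)\<close>, where
  the congruences are at least as strong by \<open>level_antimono\<close>.\<close>

lemma level_cong_mult:
  assumes "M \<in> carrier U" "N \<in> carrier U" "M' \<in> carrier U" "N' \<in> carrier U"
    and MM: "level_cong k M M'" and NN: "level_cong k N N'"
  shows "level_cong k (M \<otimes>\<^bsub>U\<^esub> N) (M' \<otimes>\<^bsub>U\<^esub> N')"
  unfolding level_cong_def
proof (intro allI impI)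
  fix i j assume ij: "1 \<le> i" "i < j" "j \<le> s + 1"
  let ?L = "level k (j - i)"
  have "[(\<Sum>l\<in>{i<..<j}. M (i, l) * N (l, j)) = (\<Sum>l\<in>{i<..<j}. M' (i, l) * N' (l, j))] (mod ?L)"
  proof (intro cong_sum cong_mult)
    fix l assume l: "l \<in> {i<..<j}"
    show "[M (i, l) = M' (i, l)] (mod ?L)"
      by (rule cong_dvd_modulus[OF level_congD[OF MM] level_antimono]) (use l ij in auto)
    show "[N (l, j) = N' (l, j)] (mod ?L)"
      by (rule cong_dvd_modulus[OF level_congD[OF NN] level_antimono]) (use l ij in auto)
  qed
  then have "[M (i, j) + N (i, j) + (\<Sum>l\<in>{i<..<j}. M (i, l) * N (l, j)) =
      M' (i, j) + N' (i, j) + (\<Sum>l\<in>{i<..<j}. M' (i, l) * N' (l, j))] (mod ?L)"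
    using level_congD[OF MM ij] level_congD[OF NN ij] by (intro cong_add)
  then show "[(M \<otimes>\<^bsub>U\<^esub> N) (i, j) = (M' \<otimes>\<^bsub>U\<^esub> N') (i, j)] (mod ?L)"
    using mult_UU_entry_cong[OF assms(1,2) ij] mult_UU_entry_cong[OF assms(3,4) ij]
    by (meson cong_sym cong_trans)
qed

lemma level_cong_refl: "level_cong k M M"
  by (simp add: level_cong_def)

lemma level_subgroup_mult:
  "M \<in> level_subgroup k \<Longrightarrow> N \<in> level_subgroup k \<Longrightarrow> M \<otimes>\<^bsub>U\<^esub> N \<in> level_subgroup k"
  using level_cong_mult[of M N "\<one>\<^bsub>U\<^esub>" "\<one>\<^bsub>U\<^esub>" k] mult_UU_closed[of M N]
    monoid.l_one[OF monoid_UU one_UU_closed]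
  by (auto simp: level_subgroup_def one_UU_closed)

lemma level_subgroup_pow:
  "M \<in> level_subgroup k \<Longrightarrow> M [^]\<^bsub>U\<^esub> (m::nat) \<in> level_subgroup k"
proof (induction m)
  case 0
  then show ?case by (simp add: level_subgroup_def one_UU_closed level_cong_refl)
next
  case (Suc m)
  then show ?case by (simp add: level_subgroup_mult)
qed

text \<open>Cross terms are products of two entries divisible at stage \<open>k\<close>, so
  \<open>level_Suc_dvd_product\<close> removes them at stage \<open>Suc k\<close>. Only the linear
  term survives, and for \<open>m = p\<close> it carries the extra factor \<open>p\<close>.\<close>

lemma pow_entry_cong:
  assumes M: "M \<in> level_subgroup k" and ij: "1 \<le> i" "i < j" "j \<le> s + 1"
  shows "[(M [^]\<^bsub>U\<^esub> m) (i, j) = int m * M (i, j)] (mod level (Suc k) (j - i))"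
proof (induction m)
  case 0
  show ?case using ij by (simp add: one_UU_entry)
next
  case (Suc m)
  let ?P = "M [^]\<^bsub>U\<^esub> m" and ?L = "level (Suc k) (j - i)"
  have P: "?P \<in> level_subgroup k" using M by (rule level_subgroup_pow)
  have "[(\<Sum>l\<in>{i<..<j}. ?P (i, l) * M (l, j)) = (\<Sum>l\<in>{i<..<j}. 0)] (mod ?L)"
  proof (intro cong_sum)
    fix l assume l: "l \<in> {i<..<j}"
    have "level k (l - i) * level k (j - l) dvd ?P (i, l) * M (l, j)"
      using P M l ij by (intro mult_dvd_mono) (auto simp: level_subgroup_iff)
    then show "[?P (i, l) * M (l, j) = 0] (mod ?L)"
      using dvd_trans[OF level_Suc_dvd_product[of i l j k]] l by (auto simp: cong_0_iff)
  qed
  then have "[?P (i, j) + M (i, j) + (\<Sum>l\<in>{i<..<j}. ?P (i, l) * M (l, j)) =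
      int m * M (i, j) + M (i, j) + (\<Sum>l\<in>{i<..<j}. 0)] (mod ?L)"
    using Suc by (intro cong_add cong_refl)
  moreover have "[(?P \<otimes>\<^bsub>U\<^esub> M) (i, j) = ?P (i, j) + M (i, j) + (\<Sum>l\<in>{i<..<j}. ?P (i, l) * M (l, j))] (mod ?L)"
    using P M ij by (intro mult_UU_entry_cong) (auto simp: level_subgroup_iff)
  ultimately have "[(?P \<otimes>\<^bsub>U\<^esub> M) (i, j) = int m * M (i, j) + M (i, j) + (\<Sum>l\<in>{i<..<j}. 0)] (mod ?L)"
    by (meson cong_trans)
  then show ?case by (simp add: algebra_simps)
qed

lemma pow_p_level_subgroup:
  assumes "M \<in> level_subgroup k"
  shows "M [^]\<^bsub>U\<^esub> p \<in> level_subgroup (Suc k)"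
  unfolding level_subgroup_iff
proof (intro conjI allI impI)
  show "M [^]\<^bsub>U\<^esub> p \<in> carrier U"
    using level_subgroup_pow[OF assms] by (simp add: level_subgroup_def)
  fix i j assume ij: "1 \<le> i" "i < j" "j \<le> s + 1"
  have "level (Suc k) (j - i) dvd int p * M (i, j)"
    by (rule dvd_trans[OF level_Suc_dvd_mult]) (use assms ij in \<open>auto simp: level_subgroup_iff\<close>)
  with pow_entry_cong[OF assms ij, of p] show "level (Suc k) (j - i) dvd (M [^]\<^bsub>U\<^esub> p) (i, j)"
    using cong_dvd_iff by blast
qed

lemma level_subgroup_1: "level_subgroup 1 = carrier U"
proof -
  have "level 1 (j - i) = 1" if "i < j" for i j
    using that by (simp add: level_def)
  then show ?thesis by (auto simp: level_subgroup_iff)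
qed

lemma level_subgroup_Suc_n: "level_subgroup (Suc n) = {\<one>\<^bsub>U\<^esub>}"
proof -
  have "M = \<one>\<^bsub>U\<^esub>" if M: "M \<in> level_subgroup (Suc n)" for M
  proof (rule UU_eqI)
    show "M \<in> carrier U" using M by (simp add: level_subgroup_def)
    fix i j assume ij: "1 \<le> i" "i < j" "j \<le> s + 1"
    \<comment> \<open>Distances are at most \<open>s\<close>, so
      \<open>Suc n - (j - i) \<ge> n - s + 1\<close> and the cap is reached.\<close>
    have "level (Suc n) (j - i) = q"
      using ij s unfolding level_def q_def by (intro arg_cong[of _ _ "\<lambda>k. int p ^ k"]) auto
    then have "q dvd M (i, j)" using level_subgroupD[OF M ij] by simp
    moreover have "M (i, j) \<in> {0..<q}"
      using M ij by (intro UU_entry_range) (auto simp: level_subgroup_iff)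
    ultimately show "M (i, j) = \<one>\<^bsub>U\<^esub> (i, j)"
      using ij by (auto simp: one_UU_entry dest: zdvd_imp_le)
  qed (rule one_UU_closed)
  then show ?thesis
    by (auto simp: level_subgroup_def one_UU_closed level_cong_refl)
qed

text \<open>The filtration already provides inverses in the monoid: each p-th power climbs one
  stage, so \<open>p ^ n\<close> annihilates \<open>M\<close>, and a power of \<open>M\<close> is
  its inverse.\<close>

sublocale U: group U
proof (rule group.intro[OF monoid_UU], unfold_locales)
  interpret monoid U by (rule monoid_UU)
  show "carrier U \<subseteq> Units U"
  proof
    fix M assume M: "M \<in> carrier U"
    have "M [^]\<^bsub>U\<^esub> (p ^ k) \<in> level_subgroup (Suc k)" for k
    proof (induction k)
      case 0
      then show ?case using M level_subgroup_1 by simp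
    next
      case (Suc k)
      have "M [^]\<^bsub>U\<^esub> (p ^ Suc k) = (M [^]\<^bsub>U\<^esub> (p ^ k)) [^]\<^bsub>U\<^esub> p"
        using M by (simp add: nat_pow_pow mult.commute)
      with pow_p_level_subgroup[OF Suc] show ?case by simp
    qed
    from this[of n] have one: "M [^]\<^bsub>U\<^esub> (p ^ n) = \<one>\<^bsub>U\<^esub>"
      by (simp add: level_subgroup_Suc_n)
    obtain m where m: "p ^ n = Suc m"
      using p by (metis not0_implies_Suc power_not_zero not_one_less_zero)
    have "M [^]\<^bsub>U\<^esub> m \<otimes>\<^bsub>U\<^esub> M = \<one>\<^bsub>U\<^esub>" "M \<otimes>\<^bsub>U\<^esub> M [^]\<^bsub>U\<^esub> m = \<one>\<^bsub>U\<^esub>"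
      using one M unfolding m by (simp_all add: nat_pow_Suc2[symmetric])
    then show "M \<in> Units U"
      using M unfolding Units_def by blast
  qed
qed

lemma subgroup_level_subgroup: "subgroup (level_subgroup k) U"
proof (rule U.subgroupI)
  show "level_subgroup k \<subseteq> carrier U" by (auto simp: level_subgroup_def)
  show "level_subgroup k \<noteq> {}"
    using one_UU_closed level_cong_refl by (auto simp: level_subgroup_def)
next
  fix M assume M: "M \<in> level_subgroup k"
  then have MU: "M \<in> carrier U" by (simp add: level_subgroup_def)
  \<comment> \<open>Multiply the congruence between \<open>M\<close> and the identity by the inverse
    of \<open>M\<close>.\<close>
  with M have "level_cong k (inv\<^bsub>U\<^esub> M \<otimes>\<^bsub>U\<^esub> M) (inv\<^bsub>U\<^esub> M \<otimes>\<^bsub>U\<^esub> \<one>\<^bsub>U\<^esub>)"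
    by (intro level_cong_mult) (auto simp: level_subgroup_def level_cong_refl)
  then show "inv\<^bsub>U\<^esub> M \<in> level_subgroup k"
    using MU by (auto simp: level_subgroup_def intro: level_cong_sym)
qed (rule level_subgroup_mult)

text \<open>The linear terms of the two products agree. Every cross term contains an entry of
  \<open>h\<close> strictly nearer to the diagonal, which \<open>level_Suc_dvd\<close> makes
  negligible at stage \<open>Suc k\<close>.\<close>

lemma level_cong_commute:
  assumes g: "g \<in> carrier U" and h: "h \<in> level_subgroup k"
  shows "level_cong (Suc k) (g \<otimes>\<^bsub>U\<^esub> h) (h \<otimes>\<^bsub>U\<^esub> g)"
  unfolding level_cong_def
proof (intro allI impI)
  fix i j assume ij: "1 \<le> i" "i < j" "j \<le> s + 1"
  let ?L = "level (Suc k) (j - i)"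
  have hU: "h \<in> carrier U" using h by (simp add: level_subgroup_def)
  have 1: "[(\<Sum>l\<in>{i<..<j}. g (i, l) * h (l, j)) = (\<Sum>l\<in>{i<..<j}. 0)] (mod ?L)"
  proof (intro cong_sum)
    fix l assume l: "l \<in> {i<..<j}"
    then have "level k (j - l) dvd h (l, j)" using h ij by (auto simp: level_subgroup_iff)
    then have "?L dvd h (l, j)" using l ij by (intro dvd_trans[OF level_Suc_dvd[of "j - l" "j - i"]]) auto
    then show "[g (i, l) * h (l, j) = 0] (mod ?L)" by (simp add: cong_0_iff)
  qed
  have 2: "[(\<Sum>l\<in>{i<..<j}. h (i, l) * g (l, j)) = (\<Sum>l\<in>{i<..<j}. 0)] (mod ?L)"
  proof (intro cong_sum)
    fix l assume l: "l \<in> {i<..<j}"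
    then have "level k (l - i) dvd h (i, l)" using h ij by (auto simp: level_subgroup_iff)
    then have "?L dvd h (i, l)" using l ij by (intro dvd_trans[OF level_Suc_dvd[of "l - i" "j - i"]]) auto
    then show "[h (i, l) * g (l, j) = 0] (mod ?L)" by (simp add: cong_0_iff)
  qed
  have "[g (i, j) + h (i, j) + (\<Sum>l\<in>{i<..<j}. g (i, l) * h (l, j)) =
      g (i, j) + h (i, j) + (\<Sum>l\<in>{i<..<j}. h (i, l) * g (l, j))] (mod ?L)"
    by (rule cong_add[OF cong_refl cong_trans[OF 1 cong_sym[OF 2]]])
  then have "[g (i, j) + h (i, j) + (\<Sum>l\<in>{i<..<j}. g (i, l) * h (l, j)) =
      h (i, j) + g (i, j) + (\<Sum>l\<in>{i<..<j}. h (i, l) * g (l, j))] (mod ?L)"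
    by (simp add: add.commute)
  then show "[(g \<otimes>\<^bsub>U\<^esub> h) (i, j) = (h \<otimes>\<^bsub>U\<^esub> g) (i, j)] (mod ?L)"
    using mult_UU_entry_cong[OF g hU ij] mult_UU_entry_cong[OF hU g ij]
    by (meson cong_sym cong_trans)
qed

text \<open>Replace the final factor \<open>gh\<close> of the commutator by the congruent
  \<open>hg\<close>; the result is the identity.\<close>

lemma commutator_level_subgroup:
  assumes g: "g \<in> carrier U" and h: "h \<in> level_subgroup k"
  shows "inv\<^bsub>U\<^esub> g \<otimes>\<^bsub>U\<^esub> inv\<^bsub>U\<^esub> h \<otimes>\<^bsub>U\<^esub> g \<otimes>\<^bsub>U\<^esub> h \<in> level_subgroup (Suc k)"
proof -
  have hU: "h \<in> carrier U" using h by (simp add: level_subgroup_def)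
  let ?x = "inv\<^bsub>U\<^esub> g \<otimes>\<^bsub>U\<^esub> inv\<^bsub>U\<^esub> h"
  have "level_cong (Suc k) (?x \<otimes>\<^bsub>U\<^esub> (g \<otimes>\<^bsub>U\<^esub> h)) (?x \<otimes>\<^bsub>U\<^esub> (h \<otimes>\<^bsub>U\<^esub> g))"
    using g hU by (intro level_cong_mult level_cong_refl level_cong_commute h) auto
  moreover have "?x \<otimes>\<^bsub>U\<^esub> (h \<otimes>\<^bsub>U\<^esub> g) = \<one>\<^bsub>U\<^esub>"
    using g hU by (simp add: U.inv_mult_group[symmetric])
  ultimately show ?thesis
    using g hU by (simp add: level_subgroup_def U.m_assoc)
qed

sublocale U: topological_group U "UU_topology p n s"
  unfolding UU_topology_def by (rule topological_group_discrete) (rule U.group_axioms)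

lemma lower_p_central_UU_subset:
  "k \<ge> 1 \<Longrightarrow> lower_p_central p U (UU_topology p n s) k \<subseteq> level_subgroup k"
proof (induction k rule: nat_induct_at_least)
  case base
  then show ?case using level_subgroup_1 by simp
next
  case (Suc k)
  have "closedin (UU_topology p n s) (level_subgroup (Suc k))"
    by (auto simp: UU_topology_def level_subgroup_def)
  moreover have "{h [^]\<^bsub>U\<^esub> p | h. h \<in> lower_p_central p U (UU_topology p n s) k} \<union>
      {inv\<^bsub>U\<^esub> g \<otimes>\<^bsub>U\<^esub> inv\<^bsub>U\<^esub> h \<otimes>\<^bsub>U\<^esub> g \<otimes>\<^bsub>U\<^esub> h | g h. g \<in> carrier U \<and>
        h \<in> lower_p_central p U (UU_topology p n s) k} \<subseteq> level_subgroup (Suc k)"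
    using Suc.IH pow_p_level_subgroup commutator_level_subgroup by blast
  ultimately show ?case
    unfolding U.lower_p_central_Suc[OF Suc.hyps]
    by (rule U.closed_subgroup_generated_minimal[OF subgroup_level_subgroup])
qed

section \<open>The central subgroup at the corner entry\<close>

abbreviation "incl \<equiv> UU_incl p n s"
abbreviation "A \<equiv> integer_mod_group p"

lemma carrier_A: "carrier A = {0..<int p}"
  using p by (simp add: carrier_integer_mod_group)

lemma q_eq: "q = int p * int p ^ (n - s)"
  by (simp add: q_def)

lemma incl_entry:
  "1 \<le> i \<Longrightarrow> i < j \<Longrightarrow> j \<le> s + 1 \<Longrightarrow> incl a (i, j) = (if i = 1 \<and> j = s + 1 then a * int p ^ (n - s) else 0)"
  by (auto simp: UU_incl_def)

lemma incl_closed: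
  assumes "a \<in> carrier A"
  shows "incl a \<in> carrier U"
proof -
  have "a * int p ^ (n - s) < q"
    unfolding q_eq using assms p by (intro mult_strict_right_mono) (auto simp: carrier_A)
  then show ?thesis
    using assms s q_gt_1 by (subst carrier_UU) (auto simp: UU_incl_def carrier_A)
qed

lemma incl_inj: "inj_on incl (carrier A)"
proof (rule inj_onI)
  fix a b assume "a \<in> carrier A" "b \<in> carrier A" "incl a = incl b"
  then have "incl a (1, s + 1) = incl b (1, s + 1)" by simp
  with s p show "a = b" by (simp add: incl_entry)
qed

text \<open>The nonzero off-diagonal entry of \<open>incl a\<close> is at the corner, and no cross
  term can reach it, because the intermediate index lies strictly between \<open>i\<close> and
  \<open>j\<close>. Centrality and additivity follow.\<close>

lemma incl_mult_entry:
  assumes "a \<in> carrier A" "M \<in> carrier U" "1 \<le> i" "i < j" "j \<le> s + 1"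
  shows "(incl a \<otimes>\<^bsub>U\<^esub> M) (i, j) = (incl a (i, j) + M (i, j)) mod q"
    and "(M \<otimes>\<^bsub>U\<^esub> incl a) (i, j) = (M (i, j) + incl a (i, j)) mod q"
proof -
  have "(\<Sum>l\<in>{i<..<j}. incl a (i, l) * M (l, j)) = 0" "(\<Sum>l\<in>{i<..<j}. M (i, l) * incl a (l, j)) = 0"
    using assms(3-5) by (auto intro!: sum.neutral simp: incl_entry)
  with assms show "(incl a \<otimes>\<^bsub>U\<^esub> M) (i, j) = (incl a (i, j) + M (i, j)) mod q"
    and "(M \<otimes>\<^bsub>U\<^esub> incl a) (i, j) = (M (i, j) + incl a (i, j)) mod q"
    by (simp_all add: mult_UU_entry incl_closed)
qed

lemma incl_central:
  assumes "a \<in> carrier A" "M \<in> carrier U"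
  shows "incl a \<otimes>\<^bsub>U\<^esub> M = M \<otimes>\<^bsub>U\<^esub> incl a"
  using assms by (intro UU_eqI) (simp_all add: incl_mult_entry incl_closed add.commute)

lemma incl_hom: "incl \<in> hom A U"
proof (rule homI)
  fix a b assume ab: "a \<in> carrier A" "b \<in> carrier A"
  have ab': "a \<otimes>\<^bsub>A\<^esub> b \<in> carrier A"
    using ab p by (simp add: carrier_A)
  show "incl (a \<otimes>\<^bsub>A\<^esub> b) = incl a \<otimes>\<^bsub>U\<^esub> incl b"
  proof (rule UU_eqI)
    fix i j assume ij: "1 \<le> i" "i < j" "j \<le> s + 1"
    \<comment> \<open>At the corner, reducing modulo \<open>p\<close> in \<open>A\<close> and then
      multiplying by \<open>p ^ (n - s)\<close> equals reducing modulo \<open>q\<close> after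
      multiplying.\<close>
    show "incl (a \<otimes>\<^bsub>A\<^esub> b) (i, j) = (incl a \<otimes>\<^bsub>U\<^esub> incl b) (i, j)"
      using ab ij incl_closed
      by (simp add: incl_mult_entry incl_entry q_eq mult_mod_left distrib_right)
  qed (use ab ab' incl_closed in auto)
qed (rule incl_closed)

text \<open>At stage \<open>n\<close> a distance \<open>d < s\<close> gives
  \<open>n - d \<ge> n - s + 1\<close>, so the entry is divisible by \<open>q\<close> and is 0. At
  the corner only the factor \<open>p ^ (n - s)\<close> is forced.\<close>

lemma lower_p_central_UU_subset_incl:
  "lower_p_central p U (UU_topology p n s) n \<subseteq> incl ` carrier A"
proof
  fix M assume "M \<in> lower_p_central p U (UU_topology p n s) n"
  then have M: "M \<in> level_subgroup n"
    using lower_p_central_UU_subset[of n] s by auto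
  then have MU: "M \<in> carrier U" by (simp add: level_subgroup_def)
  have "level n s = int p ^ (n - s)" by (simp add: level_def)
  then have "int p ^ (n - s) dvd M (1, s + 1)"
    using level_subgroupD[OF M, of 1 "s + 1"] s by simp
  then obtain a where a: "M (1, s + 1) = a * int p ^ (n - s)"
    by (auto simp: dvd_def mult.commute)
  have "M (1, s + 1) \<in> {0..<q}" using MU by (intro UU_entry_range) auto
  then have "0 \<le> a * int p ^ (n - s)" "a * int p ^ (n - s) < int p * int p ^ (n - s)"
    using a by (auto simp: q_eq)
  then have "a \<in> carrier A"
    using p by (auto simp: carrier_A zero_le_mult_iff mult_less_cancel_right)
  moreover have "M = incl a"
  proof (rule UU_eqI)
    fix i j assume ij: "1 \<le> i" "i < j" "j \<le> s + 1"
    show "M (i, j) = incl a (i, j)"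
    proof (cases "i = 1 \<and> j = s + 1")
      case True
      with a ij show ?thesis by (simp add: incl_entry)
    next
      case False
      with ij s have "level n (j - i) = q"
        unfolding level_def q_def by (intro arg_cong[of _ _ "\<lambda>k. int p ^ k"]) auto
      then have "q dvd M (i, j)" using level_subgroupD[OF M ij] by simp
      moreover have "M (i, j) \<in> {0..<q}"
        using MU ij by (intro UU_entry_range) auto
      ultimately show ?thesis
        using ij False by (auto simp: incl_entry dest: zdvd_imp_le)
    qed
  qed (use MU incl_closed \<open>a \<in> carrier A\<close> in auto)
  ultimately show "M \<in> incl ` carrier A" by blast
qed

end

section \<open>Second cohomology and central extensions\<close>

lemma continuous_map_discrete_binop:
  assumes "continuous_map T (discrete_topology B) f" "continuous_map T (discrete_topology C) g"
    and "\<And>x y. x \<in> B \<Longrightarrow> y \<in> C \<Longrightarrow> h x y \<in> D"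
  shows "continuous_map T (discrete_topology D) (\<lambda>x. h (f x) (g x))"
proof -
  have "continuous_map T (discrete_topology (B \<times> C)) (\<lambda>x. (f x, g x))"
    unfolding prod_topology_discrete_topology using assms by (simp add: continuous_map_pairedI)
  moreover have "continuous_map (discrete_topology (B \<times> C)) (discrete_topology D) (\<lambda>(x, y). h x y)"
    using assms(3) by auto
  ultimately have "continuous_map T (discrete_topology D) ((\<lambda>(x, y). h x y) \<circ> (\<lambda>x. (f x, g x)))"
    by (rule continuous_map_compose)
  then show ?thesis by (simp add: o_def)
qed

lemma continuous_map_discrete_unop:
  assumes "continuous_map T (discrete_topology B) f" "\<And>x. x \<in> B \<Longrightarrow> h x \<in> D"
  shows "continuous_map T (discrete_topology D) (\<lambda>x. h (f x))"
  using continuous_map_discrete_binop[OF assms(1) assms(1), of "\<lambda>x _. h x"] assms(2) by auto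

section \<open>Cocycles, coboundaries and the second cohomology group\<close>

locale trivial_coefficients = Q: topological_group Q TQ + A: comm_group A
  for Q :: "('a, 'b) monoid_scheme" and TQ :: "'a topology" and A :: "('c, 'd) monoid_scheme"
begin

abbreviation "Z \<equiv> cocycle2_group Q TQ A"
abbreviation "B \<equiv> coboundaries2 Q TQ A"
abbreviation "H \<equiv> H2 Q TQ A"

lemma cocycles2D:
  assumes "f \<in> cocycles2 Q TQ A"
  shows "f \<in> extensional (carrier Q \<times> carrier Q)"
    and "continuous_map (prod_topology TQ TQ) (discrete_topology (carrier A)) f"
    and "\<And>g h. g \<in> carrier Q \<Longrightarrow> h \<in> carrier Q \<Longrightarrow> f (g, h) \<in> carrier A"
    and "\<And>g h k. g \<in> carrier Q \<Longrightarrow> h \<in> carrier Q \<Longrightarrow> k \<in> carrier Q \<Longrightarrow>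
        f (h, k) \<otimes>\<^bsub>A\<^esub> f (g, h \<otimes>\<^bsub>Q\<^esub> k) = f (g \<otimes>\<^bsub>Q\<^esub> h, k) \<otimes>\<^bsub>A\<^esub> f (g, h)"
proof -
  show c: "continuous_map (prod_topology TQ TQ) (discrete_topology (carrier A)) f"
    using assms by (simp add: cocycles2_def)
  show "g \<in> carrier Q \<Longrightarrow> h \<in> carrier Q \<Longrightarrow> f (g, h) \<in> carrier A" for g h
    using continuous_map_funspace[OF c] by (auto simp: Q.topspace_eq Pi_iff)
qed (use assms in \<open>auto simp: cocycles2_def\<close>)

text \<open>Cocycles are restricted to the square of the carrier; continuity and the cocycle
  identity are easier to check for an unrestricted formula \<open>f'\<close> with the same values
  there.\<close>

lemma cocycles2I:
  assumes "f \<in> extensional (carrier Q \<times> carrier Q)"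
    and "continuous_map (prod_topology TQ TQ) (discrete_topology (carrier A)) f'"
    and "\<And>g h. g \<in> carrier Q \<Longrightarrow> h \<in> carrier Q \<Longrightarrow> f (g, h) = f' (g, h)"
    and "\<And>g h k. g \<in> carrier Q \<Longrightarrow> h \<in> carrier Q \<Longrightarrow> k \<in> carrier Q \<Longrightarrow>
        f' (h, k) \<otimes>\<^bsub>A\<^esub> f' (g, h \<otimes>\<^bsub>Q\<^esub> k) = f' (g \<otimes>\<^bsub>Q\<^esub> h, k) \<otimes>\<^bsub>A\<^esub> f' (g, h)"
  shows "f \<in> cocycles2 Q TQ A"
proof -
  have "continuous_map (prod_topology TQ TQ) (discrete_topology (carrier A)) f"
    by (rule continuous_map_eq[OF assms(2)]) (use assms(3) in \<open>auto simp: Q.topspace_eq\<close>)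
  then show ?thesis
    using assms by (simp add: cocycles2_def)
qed

lemma continuous_map_mult_coeff:
  assumes "continuous_map T (discrete_topology (carrier A)) f" "continuous_map T (discrete_topology (carrier A)) g"
  shows "continuous_map T (discrete_topology (carrier A)) (\<lambda>x. f x \<otimes>\<^bsub>A\<^esub> g x)"
  using assms by (rule continuous_map_discrete_binop) auto

lemma continuous_map_inv_coeff:
  assumes "continuous_map T (discrete_topology (carrier A)) f"
  shows "continuous_map T (discrete_topology (carrier A)) (\<lambda>x. inv\<^bsub>A\<^esub> f x)"
  using assms by (rule continuous_map_discrete_unop) auto

lemma comm_group_cocycle2_group: "comm_group Z"
proof (rule comm_groupI)
  fix f g assume "f \<in> carrier Z" "g \<in> carrier Z"
  then have f: "f \<in> cocycles2 Q TQ A" and g: "g \<in> cocycles2 Q TQ A"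
    by (auto simp: cocycle2_group_def)
  have "(\<lambda>x \<in> carrier Q \<times> carrier Q. f x \<otimes>\<^bsub>A\<^esub> g x) \<in> cocycles2 Q TQ A"
  proof (rule cocycles2I)
    show "continuous_map (prod_topology TQ TQ) (discrete_topology (carrier A)) (\<lambda>x. f x \<otimes>\<^bsub>A\<^esub> g x)"
      using cocycles2D(2)[OF f] cocycles2D(2)[OF g] by (rule continuous_map_mult_coeff)
  next
    fix a b c assume abc: "a \<in> carrier Q" "b \<in> carrier Q" "c \<in> carrier Q"
    note cl = cocycles2D(3)[OF f] cocycles2D(3)[OF g]
    have "f (b, c) \<otimes>\<^bsub>A\<^esub> g (b, c) \<otimes>\<^bsub>A\<^esub> (f (a, b \<otimes>\<^bsub>Q\<^esub> c) \<otimes>\<^bsub>A\<^esub> g (a, b \<otimes>\<^bsub>Q\<^esub> c)) =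
        (f (b, c) \<otimes>\<^bsub>A\<^esub> f (a, b \<otimes>\<^bsub>Q\<^esub> c)) \<otimes>\<^bsub>A\<^esub> (g (b, c) \<otimes>\<^bsub>A\<^esub> g (a, b \<otimes>\<^bsub>Q\<^esub> c))"
      using abc by (simp add: cl A.m_ac)
    also have "\<dots> = (f (a \<otimes>\<^bsub>Q\<^esub> b, c) \<otimes>\<^bsub>A\<^esub> f (a, b)) \<otimes>\<^bsub>A\<^esub> (g (a \<otimes>\<^bsub>Q\<^esub> b, c) \<otimes>\<^bsub>A\<^esub> g (a, b))"
      using abc cocycles2D(4)[OF f] cocycles2D(4)[OF g] by simp
    also have "\<dots> = f (a \<otimes>\<^bsub>Q\<^esub> b, c) \<otimes>\<^bsub>A\<^esub> g (a \<otimes>\<^bsub>Q\<^esub> b, c) \<otimes>\<^bsub>A\<^esub> (f (a, b) \<otimes>\<^bsub>A\<^esub> g (a, b))"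
      using abc by (simp add: cl A.m_ac)
    finally show "f (b, c) \<otimes>\<^bsub>A\<^esub> g (b, c) \<otimes>\<^bsub>A\<^esub> (f (a, b \<otimes>\<^bsub>Q\<^esub> c) \<otimes>\<^bsub>A\<^esub> g (a, b \<otimes>\<^bsub>Q\<^esub> c)) =
        f (a \<otimes>\<^bsub>Q\<^esub> b, c) \<otimes>\<^bsub>A\<^esub> g (a \<otimes>\<^bsub>Q\<^esub> b, c) \<otimes>\<^bsub>A\<^esub> (f (a, b) \<otimes>\<^bsub>A\<^esub> g (a, b))" .
  qed auto
  then show "f \<otimes>\<^bsub>Z\<^esub> g \<in> carrier Z" by (simp add: cocycle2_group_def)
  show "f \<otimes>\<^bsub>Z\<^esub> g = g \<otimes>\<^bsub>Z\<^esub> f"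
    using cocycles2D(3)[OF f] cocycles2D(3)[OF g]
    by (auto simp: cocycle2_group_def A.m_comm intro!: restrict_ext)
next
  have "(\<lambda>x \<in> carrier Q \<times> carrier Q. \<one>\<^bsub>A\<^esub>) \<in> cocycles2 Q TQ A"
    by (rule cocycles2I[where f' = "\<lambda>_. \<one>\<^bsub>A\<^esub>"]) auto
  then show "\<one>\<^bsub>Z\<^esub> \<in> carrier Z" by (simp add: cocycle2_group_def)
next
  fix f g h assume "f \<in> carrier Z" "g \<in> carrier Z" "h \<in> carrier Z"
  then have f: "f \<in> cocycles2 Q TQ A" "g \<in> cocycles2 Q TQ A" "h \<in> cocycles2 Q TQ A"
    by (auto simp: cocycle2_group_def)
  show "f \<otimes>\<^bsub>Z\<^esub> g \<otimes>\<^bsub>Z\<^esub> h = f \<otimes>\<^bsub>Z\<^esub> (g \<otimes>\<^bsub>Z\<^esub> h)"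
    using f[THEN cocycles2D(3)] by (auto simp: cocycle2_group_def A.m_assoc intro!: restrict_ext)
next
  fix f assume "f \<in> carrier Z"
  then have f: "f \<in> cocycles2 Q TQ A" by (simp add: cocycle2_group_def)
  have "(\<lambda>x\<in>carrier Q \<times> carrier Q. f x) = f"
    using cocycles2D(1)[OF f] by (rule extensional_restrict)
  moreover have "\<one>\<^bsub>Z\<^esub> \<otimes>\<^bsub>Z\<^esub> f = (\<lambda>x\<in>carrier Q \<times> carrier Q. f x)"
    using cocycles2D(3)[OF f] by (auto simp: cocycle2_group_def intro!: restrict_ext)
  ultimately show "\<one>\<^bsub>Z\<^esub> \<otimes>\<^bsub>Z\<^esub> f = f" by simp
  let ?g = "\<lambda>x \<in> carrier Q \<times> carrier Q. inv\<^bsub>A\<^esub> f x"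
  have "?g \<in> cocycles2 Q TQ A"
  proof (rule cocycles2I)
    show "continuous_map (prod_topology TQ TQ) (discrete_topology (carrier A)) (\<lambda>x. inv\<^bsub>A\<^esub> f x)"
      using cocycles2D(2)[OF f] by (rule continuous_map_inv_coeff)
  next
    fix a b c assume abc: "a \<in> carrier Q" "b \<in> carrier Q" "c \<in> carrier Q"
    show "inv\<^bsub>A\<^esub> f (b, c) \<otimes>\<^bsub>A\<^esub> inv\<^bsub>A\<^esub> f (a, b \<otimes>\<^bsub>Q\<^esub> c) = inv\<^bsub>A\<^esub> f (a \<otimes>\<^bsub>Q\<^esub> b, c) \<otimes>\<^bsub>A\<^esub> inv\<^bsub>A\<^esub> f (a, b)"
      using abc cocycles2D(4)[OF f abc] cocycles2D(3)[OF f]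
      by (simp add: A.inv_mult[symmetric])
  qed auto
  moreover have "?g \<otimes>\<^bsub>Z\<^esub> f = \<one>\<^bsub>Z\<^esub>"
    using cocycles2D(3)[OF f] by (auto simp: cocycle2_group_def intro!: restrict_ext)
  ultimately show "\<exists>g\<in>carrier Z. g \<otimes>\<^bsub>Z\<^esub> f = \<one>\<^bsub>Z\<^esub>"
    by (intro bexI[of _ ?g]) (simp_all add: cocycle2_group_def)
qed

sublocale Z: comm_group Z
  by (rule comm_group_cocycle2_group)

lemma carrier_Z: "carrier Z = cocycles2 Q TQ A"
  by (simp add: cocycle2_group_def)

lemma coboundary1_apply:
  "g \<in> carrier Q \<Longrightarrow> h \<in> carrier Q \<Longrightarrow>
    coboundary1 Q A b (g, h) = b h \<otimes>\<^bsub>A\<^esub> inv\<^bsub>A\<^esub> (b (g \<otimes>\<^bsub>Q\<^esub> h)) \<otimes>\<^bsub>A\<^esub> b g"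
  by (simp add: coboundary1_def)

lemma cochain1_closed:
  "continuous_map TQ (discrete_topology (carrier A)) b \<Longrightarrow> g \<in> carrier Q \<Longrightarrow> b g \<in> carrier A"
  using continuous_map_funspace[of TQ "discrete_topology (carrier A)" b] by (auto simp: Q.topspace_eq Pi_iff)

lemma coboundary1_closed:
  assumes b: "continuous_map TQ (discrete_topology (carrier A)) b"
  shows "coboundary1 Q A b \<in> carrier Z"
  unfolding carrier_Z
proof (rule cocycles2I)
  let ?f = "\<lambda>x. b (snd x) \<otimes>\<^bsub>A\<^esub> inv\<^bsub>A\<^esub> (b (fst x \<otimes>\<^bsub>Q\<^esub> snd x)) \<otimes>\<^bsub>A\<^esub> b (fst x)"
  show "coboundary1 Q A b \<in> extensional (carrier Q \<times> carrier Q)"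
    by (simp add: coboundary1_def)
  have "continuous_map (prod_topology TQ TQ) TQ (\<lambda>x. fst x \<otimes>\<^bsub>Q\<^esub> snd x)"
    using Q.continuous_mult by (simp add: case_prod_unfold)
  from continuous_map_compose[OF this b]
    continuous_map_compose[OF continuous_map_fst b, of TQ] continuous_map_compose[OF continuous_map_snd b, of TQ]
  show "continuous_map (prod_topology TQ TQ) (discrete_topology (carrier A)) ?f"
    by (intro continuous_map_mult_coeff continuous_map_inv_coeff) (simp_all add: o_def)
  show "coboundary1 Q A b (g, h) = ?f (g, h)" if "g \<in> carrier Q" "h \<in> carrier Q" for g h
    using that by (simp add: coboundary1_apply)
  fix g h k assume ghk: "g \<in> carrier Q" "h \<in> carrier Q" "k \<in> carrier Q"
  note cl = cochain1_closed[OF b]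
  \<comment> \<open>Here \<open>x\<close>, \<open>y\<close>, \<open>z\<close>, \<open>u\<close>,
    \<open>v\<close>, \<open>w\<close> stand for the values of \<open>b\<close> at g, h, k, gh, hk,
    ghk.\<close>
  have *: "(z \<otimes>\<^bsub>A\<^esub> inv\<^bsub>A\<^esub> v \<otimes>\<^bsub>A\<^esub> y) \<otimes>\<^bsub>A\<^esub> (v \<otimes>\<^bsub>A\<^esub> inv\<^bsub>A\<^esub> w \<otimes>\<^bsub>A\<^esub> x) =
      (z \<otimes>\<^bsub>A\<^esub> inv\<^bsub>A\<^esub> w \<otimes>\<^bsub>A\<^esub> u) \<otimes>\<^bsub>A\<^esub> (y \<otimes>\<^bsub>A\<^esub> inv\<^bsub>A\<^esub> u \<otimes>\<^bsub>A\<^esub> x)"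
    if "x \<in> carrier A" "y \<in> carrier A" "z \<in> carrier A" "u \<in> carrier A" "v \<in> carrier A" "w \<in> carrier A"
    for x y z u v w
  proof -
    have "(z \<otimes>\<^bsub>A\<^esub> inv\<^bsub>A\<^esub> v \<otimes>\<^bsub>A\<^esub> y) \<otimes>\<^bsub>A\<^esub> (v \<otimes>\<^bsub>A\<^esub> inv\<^bsub>A\<^esub> w \<otimes>\<^bsub>A\<^esub> x) =
        (v \<otimes>\<^bsub>A\<^esub> inv\<^bsub>A\<^esub> v) \<otimes>\<^bsub>A\<^esub> (z \<otimes>\<^bsub>A\<^esub> inv\<^bsub>A\<^esub> w \<otimes>\<^bsub>A\<^esub> y \<otimes>\<^bsub>A\<^esub> x)"
      using that by (simp only: A.m_ac A.inv_closed A.m_closed)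
    also have "\<dots> = (u \<otimes>\<^bsub>A\<^esub> inv\<^bsub>A\<^esub> u) \<otimes>\<^bsub>A\<^esub> (z \<otimes>\<^bsub>A\<^esub> inv\<^bsub>A\<^esub> w \<otimes>\<^bsub>A\<^esub> y \<otimes>\<^bsub>A\<^esub> x)"
      using that by simp
    also have "\<dots> = (z \<otimes>\<^bsub>A\<^esub> inv\<^bsub>A\<^esub> w \<otimes>\<^bsub>A\<^esub> u) \<otimes>\<^bsub>A\<^esub> (y \<otimes>\<^bsub>A\<^esub> inv\<^bsub>A\<^esub> u \<otimes>\<^bsub>A\<^esub> x)"
      using that by (simp only: A.m_ac A.inv_closed A.m_closed)
    finally show ?thesis .
  qed
  show "?f (h, k) \<otimes>\<^bsub>A\<^esub> ?f (g, h \<otimes>\<^bsub>Q\<^esub> k) = ?f (g \<otimes>\<^bsub>Q\<^esub> h, k) \<otimes>\<^bsub>A\<^esub> ?f (g, h)"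
    using ghk by (simp add: * cl Q.m_assoc)
qed

lemma subgroup_coboundaries2: "subgroup B Z"
proof (rule Z.subgroupI)
  show "B \<subseteq> carrier Z"
    using coboundary1_closed by (auto simp: coboundaries2_def)
  have "continuous_map TQ (discrete_topology (carrier A)) (\<lambda>_. \<one>\<^bsub>A\<^esub>)" by simp
  then show "B \<noteq> {}" unfolding coboundaries2_def by blast
next
  fix f assume "f \<in> B"
  then obtain b where b: "continuous_map TQ (discrete_topology (carrier A)) b" and f: "f = coboundary1 Q A b"
    by (auto simp: coboundaries2_def)
  let ?b = "\<lambda>g. inv\<^bsub>A\<^esub> b g"
  have b': "continuous_map TQ (discrete_topology (carrier A)) ?b"
    using b by (rule continuous_map_inv_coeff)
  note cl = cochain1_closed[OF b]
  have "coboundary1 Q A ?b \<otimes>\<^bsub>Z\<^esub> f = \<one>\<^bsub>Z\<^esub>"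
  proof -
    have "inv\<^bsub>A\<^esub> y \<otimes>\<^bsub>A\<^esub> inv\<^bsub>A\<^esub> (inv\<^bsub>A\<^esub> z) \<otimes>\<^bsub>A\<^esub> inv\<^bsub>A\<^esub> x \<otimes>\<^bsub>A\<^esub> (y \<otimes>\<^bsub>A\<^esub> inv\<^bsub>A\<^esub> z \<otimes>\<^bsub>A\<^esub> x) = \<one>\<^bsub>A\<^esub>"
      if xyz: "x \<in> carrier A" "y \<in> carrier A" "z \<in> carrier A" for x y z
    proof -
      have "inv\<^bsub>A\<^esub> y \<otimes>\<^bsub>A\<^esub> inv\<^bsub>A\<^esub> (inv\<^bsub>A\<^esub> z) \<otimes>\<^bsub>A\<^esub> inv\<^bsub>A\<^esub> x = inv\<^bsub>A\<^esub> (y \<otimes>\<^bsub>A\<^esub> inv\<^bsub>A\<^esub> z \<otimes>\<^bsub>A\<^esub> x)"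
        using xyz by (simp add: A.inv_mult)
      then show ?thesis using xyz by simp
    qed
    then show ?thesis
      using cl by (auto simp: f cocycle2_group_def coboundary1_apply intro!: restrict_ext)
  qed
  then have "inv\<^bsub>Z\<^esub> f = coboundary1 Q A ?b"
    using coboundary1_closed[OF b] coboundary1_closed[OF b'] f by (intro Z.inv_equality) auto
  then show "inv\<^bsub>Z\<^esub> f \<in> B" using b' by (auto simp: coboundaries2_def)
next
  fix f f' assume "f \<in> B" "f' \<in> B"
  then obtain b b' where b: "continuous_map TQ (discrete_topology (carrier A)) b" "f = coboundary1 Q A b"
    and b': "continuous_map TQ (discrete_topology (carrier A)) b'" "f' = coboundary1 Q A b'"
    by (auto simp: coboundaries2_def)
  note cl = cochain1_closed[OF b(1)] cochain1_closed[OF b'(1)]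
  have "f \<otimes>\<^bsub>Z\<^esub> f' = coboundary1 Q A (\<lambda>g. b g \<otimes>\<^bsub>A\<^esub> b' g)"
    using cl unfolding b b' cocycle2_group_def
    by (auto simp: coboundary1_def A.inv_mult A.m_ac intro!: restrict_ext)
  then show "f \<otimes>\<^bsub>Z\<^esub> f' \<in> B"
    using continuous_map_mult_coeff[OF b(1) b'(1)] by (auto simp: coboundaries2_def)
qed

sublocale B: normal B Z
  by (rule Z.subgroup_imp_normal[OF subgroup_coboundaries2])

lemma H2_eq: "H = Z Mod B"
  by (simp add: H2_def)

sublocale H: comm_group H
  unfolding H2_eq by (rule Z.abelian_FactGroup[OF subgroup_coboundaries2])

lemma cohomology_class_hom: "cohomology_class Q TQ A \<in> hom Z H"
  unfolding H2_eq cohomology_class_def[abs_def] by (rule B.r_coset_hom_Mod)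

lemma cohomology_class_eq_one: "f \<in> B \<Longrightarrow> cohomology_class Q TQ A f = \<one>\<^bsub>H\<^esub>"
  unfolding H2_eq cohomology_class_def
  using Z.coset_join2[of f B] subgroup_coboundaries2 B.mem_carrier by simp

lemma finprod_cohomology_class:
  assumes "finite W" "\<And>w. w \<in> W \<Longrightarrow> c w \<in> carrier Z"
  shows "(\<Otimes>\<^bsub>H\<^esub>w\<in>W. cohomology_class Q TQ A (c w) [^]\<^bsub>H\<^esub> (k w :: int)) =
    cohomology_class Q TQ A (\<Otimes>\<^bsub>Z\<^esub>w\<in>W. c w [^]\<^bsub>Z\<^esub> k w)"
  using assms
proof (induction W rule: finite_induct)
  case empty
  have "group_hom Z H (cohomology_class Q TQ A)"
    using cohomology_class_hom by unfold_locales
  then show ?case by (simp add: group_hom.hom_one)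
next
  case (insert w W)
  interpret group_hom Z H "cohomology_class Q TQ A"
    using cohomology_class_hom by unfold_locales
  from insert show ?case
    by (subst H.finprod_insert Z.finprod_insert; auto simp: Z.finprod_insert hom_int_pow intro!: H.int_pow_closed Z.int_pow_closed)
qed

lemma finprod_cocycle_apply:
  assumes "finite W" "\<And>w. w \<in> W \<Longrightarrow> f w \<in> carrier Z" "x \<in> carrier Q \<times> carrier Q"
  shows "(\<Otimes>\<^bsub>Z\<^esub>w\<in>W. f w) x = (\<Otimes>\<^bsub>A\<^esub>w\<in>W. f w x)"
  using assms
proof (induction W rule: finite_induct)
  case empty
  have "\<one>\<^bsub>Z\<^esub> x = \<one>\<^bsub>A\<^esub>" using empty.prems by (simp add: cocycle2_group_def)
  then show ?case by simp
next
  case (insert w W)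
  have cl: "g x \<in> carrier A" if "g \<in> carrier Z" for g
    using cocycles2D(3)[of g "fst x" "snd x"] that insert.prems by (auto simp: carrier_Z)
  have "(\<Otimes>\<^bsub>Z\<^esub>w\<in>insert w W. f w) x = f w x \<otimes>\<^bsub>A\<^esub> (\<Otimes>\<^bsub>Z\<^esub>w\<in>W. f w) x"
    using insert by (subst Z.finprod_insert) (auto simp: cocycle2_group_def)
  then show ?case using insert cl by (subst A.finprod_insert) auto
qed

lemma nat_pow_cocycle_apply:
  assumes "f \<in> carrier Z" "x \<in> carrier Q \<times> carrier Q"
  shows "(f [^]\<^bsub>Z\<^esub> (k::nat)) x = f x [^]\<^bsub>A\<^esub> k"
  using assms by (induction k) (auto simp: cocycle2_group_def)

text \<open>Changing \<open>f\<close> by the coboundary of \<open>b\<close> changes the pullback by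
  the coboundary of \<open>b\<close> composed with \<open>\<phi>\<close>. So all representatives
  have the same image, and \<open>the_elem\<close> is applied to a singleton.\<close>

lemma H2_pullback_cohomology_class:
  assumes Q': "topological_group Q' TQ'" and \<phi>: "\<phi> \<in> continuous_hom Q TQ Q' TQ'"
    and f: "f \<in> cocycles2 Q' TQ' A"
  shows "(\<lambda>(g, h) \<in> carrier Q \<times> carrier Q. f (\<phi> g, \<phi> h)) \<in> carrier Z" (is "?pull f \<in> _")
    and "H2_pullback Q TQ A \<phi> (cohomology_class Q' TQ' A f) =
      cohomology_class Q TQ A (\<lambda>(g, h) \<in> carrier Q \<times> carrier Q. f (\<phi> g, \<phi> h))"
proof -
  interpret Q': trivial_coefficients Q' TQ' A
    using Q' by (simp add: trivial_coefficients_def A.comm_group_axioms)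
  have hom: "\<phi> \<in> hom Q Q'" and cont: "continuous_map TQ TQ' \<phi>"
    using \<phi> by (auto simp: continuous_hom_def)
  have \<phi>_closed: "g \<in> carrier Q \<Longrightarrow> \<phi> g \<in> carrier Q'" for g
    using hom by (auto simp: hom_def)
  have pull_closed: "?pull f \<in> carrier Z" if f: "f \<in> cocycles2 Q' TQ' A" for f
    unfolding carrier_Z
  proof (rule cocycles2I)
    have "continuous_map (prod_topology TQ TQ) (prod_topology TQ' TQ') (\<lambda>x. (\<phi> (fst x), \<phi> (snd x)))"
      by (intro continuous_map_pairedI continuous_map_compose[OF continuous_map_fst cont, unfolded o_def]
          continuous_map_compose[OF continuous_map_snd cont, unfolded o_def])
    from continuous_map_compose[OF this Q'.cocycles2D(2)[OF f]]
    show "continuous_map (prod_topology TQ TQ) (discrete_topology (carrier A)) (\<lambda>x. f (\<phi> (fst x), \<phi> (snd x)))"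
      by (simp add: o_def)
    show "?pull f \<in> extensional (carrier Q \<times> carrier Q)" by (rule restrict_extensional)
  qed (use Q'.cocycles2D(4)[OF f] in \<open>auto simp: \<phi>_closed hom_mult[OF hom]\<close>)
  from this[OF f] show "?pull f \<in> carrier Z" .
  have "cohomology_class Q TQ A (?pull f') = cohomology_class Q TQ A (?pull f)"
    if f': "f' \<in> cohomology_class Q' TQ' A f" for f'
  proof -
    obtain d where d: "d \<in> coboundaries2 Q' TQ' A" and f'_eq: "f' = d \<otimes>\<^bsub>Q'.Z\<^esub> f"
      using f' by (auto simp: cohomology_class_def r_coset_def)
    then obtain b where b: "continuous_map TQ' (discrete_topology (carrier A)) b" and d_eq: "d = coboundary1 Q' A b"
      by (auto simp: coboundaries2_def)
    have "?pull f' = coboundary1 Q A (\<lambda>g. b (\<phi> g)) \<otimes>\<^bsub>Z\<^esub> ?pull f"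
      unfolding f'_eq d_eq cocycle2_group_def
      by (auto simp: coboundary1_def \<phi>_closed hom_mult[OF hom] intro!: restrict_ext)
    moreover have "coboundary1 Q A (\<lambda>g. b (\<phi> g)) \<in> B"
      using continuous_map_compose[OF cont b] by (auto simp: coboundaries2_def o_def)
    ultimately have "?pull f' \<in> B #>\<^bsub>Z\<^esub> ?pull f"
      by (auto simp: r_coset_def)
    then show ?thesis
      unfolding cohomology_class_def
      by (metis pull_closed[OF f] Z.repr_independence subgroup_coboundaries2)
  qed
  moreover have "f \<in> cohomology_class Q' TQ' A f"
    unfolding cohomology_class_def
    by (rule Q'.Z.rcos_self) (use f in \<open>auto simp: Q'.carrier_Z Q'.subgroup_coboundaries2\<close>)
  ultimately have "(\<lambda>f'. cohomology_class Q TQ A (?pull f')) ` cohomology_class Q' TQ' A f =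
      {cohomology_class Q TQ A (?pull f)}"
    by blast
  then show "H2_pullback Q TQ A \<phi> (cohomology_class Q' TQ' A f) = cohomology_class Q TQ A (?pull f)"
    unfolding H2_pullback_def by (simp only: the_elem_eq)
qed

end

section \<open>Central extensions of discrete groups\<close>

locale discrete_central_extension = E: topological_group E TE + A: comm_group A
  for E :: "('e, 'f) monoid_scheme" and TE :: "'e topology" and A :: "('c, 'd) monoid_scheme" +
  fixes \<iota> :: "'c \<Rightarrow> 'e" and p n :: nat
  assumes discrete: "TE = discrete_topology (carrier E)"
    and \<iota>_hom: "\<iota> \<in> hom A E"
    and \<iota>_inj: "inj_on \<iota> (carrier A)"
    and \<iota>_central: "a \<in> carrier A \<Longrightarrow> x \<in> carrier E \<Longrightarrow> \<iota> a \<otimes>\<^bsub>E\<^esub> x = x \<otimes>\<^bsub>E\<^esub> \<iota> a"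
    and lower_subset: "lower_p_central p E TE n \<subseteq> \<iota> ` carrier A"
begin

abbreviation "Q \<equiv> p_quotient p n E TE"
abbreviation "TQ \<equiv> p_quotient_topology p n E TE"
abbreviation "\<pi> \<equiv> p_proj p n E TE"

sublocale trivial_coefficients Q TQ A
  by (simp add: trivial_coefficients_def E.topological_group_p_quotient A.comm_group_axioms)

lemma \<iota>_closed: "a \<in> carrier A \<Longrightarrow> \<iota> a \<in> carrier E"
  using \<iota>_hom by (auto simp: hom_def)

lemma TQ_discrete: "TQ = discrete_topology (carrier Q)"
proof -
  have "openin TE V" if "V \<subseteq> carrier E" for V
    using that by (subst discrete) simp
  then have "openin TQ {q}" if "q \<in> carrier Q" for q
    using that unfolding p_quotient_topology_def openin_quotient_topology
    by (auto simp: E.topspace_eq E.p_proj_image)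
  then show ?thesis
    using Q.topspace_eq discrete_topology_unique[of "carrier Q" TQ] by auto
qed

text \<open>The very choice made in \<open>extension_class\<close>, so that the class can be
  computed with this section.\<close>

definition section_rep :: "'e set \<Rightarrow> 'e" where
  "section_rep = (SOME \<sigma>. continuous_map TQ TE \<sigma> \<and> (\<forall>q\<in>carrier Q. \<pi> (\<sigma> q) = q))"

lemma section_rep:
  "q \<in> carrier Q \<Longrightarrow> section_rep q \<in> carrier E" "q \<in> carrier Q \<Longrightarrow> \<pi> (section_rep q) = q"
proof -
  \<comment> \<open>The quotient is discrete, so any choice of preimages is a continuous
    section.\<close>
  have "\<exists>\<sigma>. continuous_map TQ TE \<sigma> \<and> (\<forall>q\<in>carrier Q. \<pi> (\<sigma> q) = q)"
    using E.p_proj_image[of p n]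
    by (intro exI[of _ "inv_into (carrier E) \<pi>"])
      (auto simp: TQ_discrete E.topspace_eq f_inv_into_f inv_into_into)
  then have *: "continuous_map TQ TE section_rep \<and> (\<forall>q\<in>carrier Q. \<pi> (section_rep q) = q)"
    unfolding section_rep_def by (rule someI_ex)
  then show "q \<in> carrier Q \<Longrightarrow> section_rep q \<in> carrier E" "q \<in> carrier Q \<Longrightarrow> \<pi> (section_rep q) = q"
    using continuous_map_funspace[of TQ TE section_rep] by (auto simp: Q.topspace_eq E.topspace_eq Pi_iff)
qed

text \<open>By \<open>lower_subset\<close>, elements with equal projection differ by a value of
  \<open>\<iota>\<close>. This makes \<open>inv_into\<close> meaningful in the factor set and in
  \<open>\<theta>\<close>.\<close>

lemma \<pi>_eq_imp:
  assumes "x \<in> carrier E" "y \<in> carrier E" "\<pi> x = \<pi> y"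
  shows "inv_into (carrier A) \<iota> (x \<otimes>\<^bsub>E\<^esub> inv\<^bsub>E\<^esub> y) \<in> carrier A"
    and "x = \<iota> (inv_into (carrier A) \<iota> (x \<otimes>\<^bsub>E\<^esub> inv\<^bsub>E\<^esub> y)) \<otimes>\<^bsub>E\<^esub> y"
proof -
  obtain k where "k \<in> lower_p_central p E TE n" "x = k \<otimes>\<^bsub>E\<^esub> y"
    using E.p_proj_eq_iff[OF assms(1,2)] assms(3) by blast
  then obtain a where a: "a \<in> carrier A" "x = \<iota> a \<otimes>\<^bsub>E\<^esub> y"
    using lower_subset by blast
  then have "x \<otimes>\<^bsub>E\<^esub> inv\<^bsub>E\<^esub> y = \<iota> a"
    using assms \<iota>_closed by (simp add: E.m_assoc)
  then have "inv_into (carrier A) \<iota> (x \<otimes>\<^bsub>E\<^esub> inv\<^bsub>E\<^esub> y) = a"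
    using a \<iota>_inj by simp
  with a show "inv_into (carrier A) \<iota> (x \<otimes>\<^bsub>E\<^esub> inv\<^bsub>E\<^esub> y) \<in> carrier A"
    and "x = \<iota> (inv_into (carrier A) \<iota> (x \<otimes>\<^bsub>E\<^esub> inv\<^bsub>E\<^esub> y)) \<otimes>\<^bsub>E\<^esub> y"
    by simp_all
qed

abbreviation "fs \<equiv> factor_set A \<iota> E Q section_rep"

lemma factor_set_eq:
  assumes "a \<in> carrier Q" "b \<in> carrier Q"
  shows "fs (a, b) \<in> carrier A"
    and "section_rep a \<otimes>\<^bsub>E\<^esub> section_rep b = \<iota> (fs (a, b)) \<otimes>\<^bsub>E\<^esub> section_rep (a \<otimes>\<^bsub>Q\<^esub> b)"
proof -
  have "\<pi> (section_rep a \<otimes>\<^bsub>E\<^esub> section_rep b) = \<pi> (section_rep (a \<otimes>\<^bsub>Q\<^esub> b))"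
    using assms by (simp add: hom_mult[OF E.p_proj_hom] section_rep)
  from \<pi>_eq_imp[OF _ _ this] assms
  show "fs (a, b) \<in> carrier A"
    and "section_rep a \<otimes>\<^bsub>E\<^esub> section_rep b = \<iota> (fs (a, b)) \<otimes>\<^bsub>E\<^esub> section_rep (a \<otimes>\<^bsub>Q\<^esub> b)"
    by (auto simp: factor_set_def section_rep)
qed

lemma \<iota>_cancel:
  assumes "a \<in> carrier A" "b \<in> carrier A" "x \<in> carrier E" "\<iota> a \<otimes>\<^bsub>E\<^esub> x = \<iota> b \<otimes>\<^bsub>E\<^esub> x"
  shows "a = b"
  using assms \<iota>_inj by (simp add: \<iota>_closed inj_on_eq_iff)

text \<open>Both sides arise from the product of the section values at \<open>g\<close>,
  \<open>h\<close>, \<open>k\<close>, bracketed in two ways. Centrality moves the values of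
  \<open>\<iota>\<close> to the front, and the section value at the triple product cancels.\<close>

lemma factor_set_cocycle: "fs \<in> cocycles2 Q TQ A"
proof (rule cocycles2I)
  show "fs \<in> extensional (carrier Q \<times> carrier Q)" by (simp add: factor_set_def)
  show "continuous_map (prod_topology TQ TQ) (discrete_topology (carrier A)) fs"
    using factor_set_eq(1) by (auto simp: TQ_discrete simp flip: prod_topology_discrete_topology)
  fix g h k assume ghk: "g \<in> carrier Q" "h \<in> carrier Q" "k \<in> carrier Q"
  let ?s = section_rep
  note cl = factor_set_eq(1) \<iota>_closed section_rep(1) Q.m_closed
  have mult: "\<iota> (x \<otimes>\<^bsub>A\<^esub> y) = \<iota> x \<otimes>\<^bsub>E\<^esub> \<iota> y" if "x \<in> carrier A" "y \<in> carrier A" for x y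
    using that \<iota>_hom by (simp add: hom_mult)
  have "\<iota> (fs (g \<otimes>\<^bsub>Q\<^esub> h, k) \<otimes>\<^bsub>A\<^esub> fs (g, h)) \<otimes>\<^bsub>E\<^esub> ?s (g \<otimes>\<^bsub>Q\<^esub> h \<otimes>\<^bsub>Q\<^esub> k) =
      \<iota> (fs (g, h)) \<otimes>\<^bsub>E\<^esub> (\<iota> (fs (g \<otimes>\<^bsub>Q\<^esub> h, k)) \<otimes>\<^bsub>E\<^esub> ?s (g \<otimes>\<^bsub>Q\<^esub> h \<otimes>\<^bsub>Q\<^esub> k))"
    using ghk by (simp add: A.m_comm[of "fs (g \<otimes>\<^bsub>Q\<^esub> h, k)"] mult cl E.m_assoc)
  also have "\<dots> = \<iota> (fs (g, h)) \<otimes>\<^bsub>E\<^esub> (?s (g \<otimes>\<^bsub>Q\<^esub> h) \<otimes>\<^bsub>E\<^esub> ?s k)"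
    using ghk by (simp only: factor_set_eq(2) Q.m_closed)
  also have "\<dots> = \<iota> (fs (g, h)) \<otimes>\<^bsub>E\<^esub> ?s (g \<otimes>\<^bsub>Q\<^esub> h) \<otimes>\<^bsub>E\<^esub> ?s k"
    using ghk by (simp add: cl E.m_assoc)
  also have "\<dots> = ?s g \<otimes>\<^bsub>E\<^esub> ?s h \<otimes>\<^bsub>E\<^esub> ?s k"
    by (simp only: factor_set_eq(2)[OF ghk(1,2)])
  also have "\<dots> = ?s g \<otimes>\<^bsub>E\<^esub> (?s h \<otimes>\<^bsub>E\<^esub> ?s k)"
    using ghk by (simp add: cl E.m_assoc)
  also have "\<dots> = ?s g \<otimes>\<^bsub>E\<^esub> \<iota> (fs (h, k)) \<otimes>\<^bsub>E\<^esub> ?s (h \<otimes>\<^bsub>Q\<^esub> k)"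
    using ghk by (simp add: factor_set_eq(2) cl E.m_assoc)
  also have "\<dots> = \<iota> (fs (h, k)) \<otimes>\<^bsub>E\<^esub> (?s g \<otimes>\<^bsub>E\<^esub> ?s (h \<otimes>\<^bsub>Q\<^esub> k))"
    using ghk by (simp add: \<iota>_central[of _ "?s g", symmetric] cl E.m_assoc[symmetric])
  also have "\<dots> = \<iota> (fs (h, k) \<otimes>\<^bsub>A\<^esub> fs (g, h \<otimes>\<^bsub>Q\<^esub> k)) \<otimes>\<^bsub>E\<^esub> ?s (g \<otimes>\<^bsub>Q\<^esub> h \<otimes>\<^bsub>Q\<^esub> k)"
    using ghk by (simp add: factor_set_eq(2) mult cl E.m_assoc Q.m_assoc)
  finally show "fs (h, k) \<otimes>\<^bsub>A\<^esub> fs (g, h \<otimes>\<^bsub>Q\<^esub> k) = fs (g \<otimes>\<^bsub>Q\<^esub> h, k) \<otimes>\<^bsub>A\<^esub> fs (g, h)"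
    using ghk by (intro \<iota>_cancel[of _ _ "?s (g \<otimes>\<^bsub>Q\<^esub> h \<otimes>\<^bsub>Q\<^esub> k)"]) (auto simp: cl)
qed (rule refl)

lemma extension_class_eq: "extension_class A \<iota> E TE \<pi> Q TQ = cohomology_class Q TQ A fs"
  by (simp add: extension_class_def section_rep_def)

text \<open>Pulled back to \<open>G\<close> itself, the extension splits: comparing \<open>\<rho>\<close> with the section gives a
  cochain \<open>\<theta>\<close> on \<open>G\<close> whose coboundary is the inverse of the pulled back factor set.\<close>

lemma pullback_extension_class:
  assumes G: "topological_group G T" and \<rho>: "\<rho> \<in> continuous_hom G T E TE"
  obtains c \<theta> where
    "c \<in> cocycles2 (p_quotient p n G T) (p_quotient_topology p n G T) A"
    "H2_pullback (p_quotient p n G T) (p_quotient_topology p n G T) A (p_induced p n G T E TE \<rho>)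
      (extension_class A \<iota> E TE \<pi> Q TQ) = cohomology_class (p_quotient p n G T) (p_quotient_topology p n G T) A c"
    "continuous_map T (discrete_topology (carrier A)) \<theta>"
    "\<And>g h. g \<in> carrier G \<Longrightarrow> h \<in> carrier G \<Longrightarrow>
      \<theta> (g \<otimes>\<^bsub>G\<^esub> h) = \<theta> g \<otimes>\<^bsub>A\<^esub> \<theta> h \<otimes>\<^bsub>A\<^esub> c (p_proj p n G T g, p_proj p n G T h)"
    "\<And>k g a. k \<in> lower_p_central p G T n \<Longrightarrow> g \<in> carrier G \<Longrightarrow> a \<in> carrier A \<Longrightarrow> \<rho> k = \<iota> a \<Longrightarrow>
      \<theta> (k \<otimes>\<^bsub>G\<^esub> g) = a \<otimes>\<^bsub>A\<^esub> \<theta> g"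
proof -
  interpret G: topological_group G T by fact
  interpret C: trivial_coefficients "p_quotient p n G T" "p_quotient_topology p n G T" A
    by (simp add: trivial_coefficients_def G.topological_group_p_quotient A.comm_group_axioms)
  let ?\<phi> = "p_induced p n G T E TE \<rho>" and ?\<pi> = "p_proj p n G T"
  have \<rho>_hom: "\<rho> \<in> hom G E" and \<rho>_cont: "continuous_map T TE \<rho>"
    using \<rho> by (auto simp: continuous_hom_def)
  have \<rho>_closed: "g \<in> carrier G \<Longrightarrow> \<rho> g \<in> carrier E" for g
    using \<rho>_hom by (auto simp: hom_def)
  have \<phi>: "?\<phi> \<in> continuous_hom (p_quotient p n G T) (p_quotient_topology p n G T) Q TQ"
    by (rule p_induced_continuous_hom[OF G E.topological_group_axioms \<rho>])
  have \<phi>_\<pi>: "g \<in> carrier G \<Longrightarrow> ?\<phi> (?\<pi> g) = \<pi> (\<rho> g)" for g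
    by (rule p_induced_p_proj[OF G E.topological_group_axioms \<rho>])
  have \<pi>_closed: "x \<in> carrier E \<Longrightarrow> \<pi> x \<in> carrier Q" for x
    using E.p_proj_hom[of p n] by (auto simp: hom_def)
  let ?c = "\<lambda>(g, h) \<in> carrier (p_quotient p n G T) \<times> carrier (p_quotient p n G T). fs (?\<phi> g, ?\<phi> h)"
  \<comment> \<open>\<open>\<theta> g\<close> is the central factor by which \<open>\<rho> g\<close>
    differs from the section value with the same projection.\<close>
  define \<theta> where "\<theta> g = inv_into (carrier A) \<iota> (\<rho> g \<otimes>\<^bsub>E\<^esub> inv\<^bsub>E\<^esub> section_rep (\<pi> (\<rho> g)))" for g
  have \<theta>: "\<theta> g \<in> carrier A" "\<rho> g = \<iota> (\<theta> g) \<otimes>\<^bsub>E\<^esub> section_rep (\<pi> (\<rho> g))" if "g \<in> carrier G" for g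
    using \<pi>_eq_imp[of "\<rho> g" "section_rep (\<pi> (\<rho> g))"] that
    by (simp_all add: \<theta>_def \<rho>_closed section_rep \<pi>_closed)
  have mult: "\<iota> (x \<otimes>\<^bsub>A\<^esub> y) = \<iota> x \<otimes>\<^bsub>E\<^esub> \<iota> y" if "x \<in> carrier A" "y \<in> carrier A" for x y
    using that \<iota>_hom by (simp add: hom_mult)
  note cl = factor_set_eq(1) \<iota>_closed section_rep(1) \<rho>_closed \<pi>_closed \<theta>(1)
  show thesis
  proof (rule that[of ?c \<theta>])
    show "?c \<in> cocycles2 (p_quotient p n G T) (p_quotient_topology p n G T) A"
      using C.H2_pullback_cohomology_class(1)[OF Q.topological_group_axioms \<phi> factor_set_cocycle]
      by (simp add: C.carrier_Z)
    show "H2_pullback (p_quotient p n G T) (p_quotient_topology p n G T) A ?\<phi> (extension_class A \<iota> E TE \<pi> Q TQ) =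
        cohomology_class (p_quotient p n G T) (p_quotient_topology p n G T) A ?c"
      unfolding extension_class_eq
      by (rule C.H2_pullback_cohomology_class(2)[OF Q.topological_group_axioms \<phi> factor_set_cocycle])
    show "continuous_map T (discrete_topology (carrier A)) \<theta>"
    proof -
      \<comment> \<open>\<open>\<theta> g\<close> depends on \<open>\<rho> g\<close> alone, and
        \<open>\<rho>\<close> is continuous into a discrete group.\<close>
      have "continuous_map T (discrete_topology (carrier E)) \<rho>" using \<rho>_cont discrete by simp
      then show ?thesis
        unfolding \<theta>_def
        by (rule continuous_map_discrete_unop)
          (use \<pi>_eq_imp(1) section_rep \<pi>_closed in \<open>auto simp: section_rep\<close>)
    qed
  next
    fix g h assume gh: "g \<in> carrier G" "h \<in> carrier G"
    have \<rho>gh: "\<rho> (g \<otimes>\<^bsub>G\<^esub> h) = \<rho> g \<otimes>\<^bsub>E\<^esub> \<rho> h"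
      using gh \<rho>_hom by (simp add: hom_mult)
    have \<pi>gh: "\<pi> (\<rho> (g \<otimes>\<^bsub>G\<^esub> h)) = \<pi> (\<rho> g) \<otimes>\<^bsub>Q\<^esub> \<pi> (\<rho> h)"
      using gh by (simp add: \<rho>gh hom_mult[OF E.p_proj_hom] \<rho>_closed)
    let ?sg = "section_rep (\<pi> (\<rho> g))" and ?sh = "section_rep (\<pi> (\<rho> h))" and ?f = "fs (\<pi> (\<rho> g), \<pi> (\<rho> h))"
    have "\<iota> (\<theta> (g \<otimes>\<^bsub>G\<^esub> h)) \<otimes>\<^bsub>E\<^esub> section_rep (\<pi> (\<rho> (g \<otimes>\<^bsub>G\<^esub> h))) = \<rho> g \<otimes>\<^bsub>E\<^esub> \<rho> h"
      using \<theta>(2)[of "g \<otimes>\<^bsub>G\<^esub> h"] gh \<rho>gh by simp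
    also have "\<dots> = (\<iota> (\<theta> g) \<otimes>\<^bsub>E\<^esub> ?sg) \<otimes>\<^bsub>E\<^esub> (\<iota> (\<theta> h) \<otimes>\<^bsub>E\<^esub> ?sh)"
      using gh by (simp flip: \<theta>(2))
    also have "\<dots> = \<iota> (\<theta> g) \<otimes>\<^bsub>E\<^esub> (?sg \<otimes>\<^bsub>E\<^esub> \<iota> (\<theta> h)) \<otimes>\<^bsub>E\<^esub> ?sh"
      using gh by (simp add: cl E.m_assoc)
    also have "?sg \<otimes>\<^bsub>E\<^esub> \<iota> (\<theta> h) = \<iota> (\<theta> h) \<otimes>\<^bsub>E\<^esub> ?sg"
      using gh by (intro \<iota>_central[symmetric]) (auto simp: cl)
    also have "\<iota> (\<theta> g) \<otimes>\<^bsub>E\<^esub> (\<iota> (\<theta> h) \<otimes>\<^bsub>E\<^esub> ?sg) \<otimes>\<^bsub>E\<^esub> ?sh = \<iota> (\<theta> g) \<otimes>\<^bsub>E\<^esub> \<iota> (\<theta> h) \<otimes>\<^bsub>E\<^esub> (?sg \<otimes>\<^bsub>E\<^esub> ?sh)"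
      using gh by (simp add: cl E.m_assoc)
    also have "?sg \<otimes>\<^bsub>E\<^esub> ?sh = \<iota> ?f \<otimes>\<^bsub>E\<^esub> section_rep (\<pi> (\<rho> (g \<otimes>\<^bsub>G\<^esub> h)))"
      unfolding \<pi>gh using gh by (intro factor_set_eq(2)) (auto simp: cl)
    also have "\<iota> (\<theta> g) \<otimes>\<^bsub>E\<^esub> \<iota> (\<theta> h) \<otimes>\<^bsub>E\<^esub> (\<iota> ?f \<otimes>\<^bsub>E\<^esub> section_rep (\<pi> (\<rho> (g \<otimes>\<^bsub>G\<^esub> h)))) =
        \<iota> (\<theta> g \<otimes>\<^bsub>A\<^esub> \<theta> h \<otimes>\<^bsub>A\<^esub> ?f) \<otimes>\<^bsub>E\<^esub> section_rep (\<pi> (\<rho> (g \<otimes>\<^bsub>G\<^esub> h)))"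
      using gh by (simp add: cl mult E.m_assoc)
    finally have "\<theta> (g \<otimes>\<^bsub>G\<^esub> h) = \<theta> g \<otimes>\<^bsub>A\<^esub> \<theta> h \<otimes>\<^bsub>A\<^esub> ?f"
      using gh by (intro \<iota>_cancel[of _ _ "section_rep (\<pi> (\<rho> (g \<otimes>\<^bsub>G\<^esub> h)))"]) (auto simp: cl)
    moreover have "?\<pi> g \<in> carrier (p_quotient p n G T)" "?\<pi> h \<in> carrier (p_quotient p n G T)"
      using gh G.p_proj_image[of p n] by auto
    ultimately show "\<theta> (g \<otimes>\<^bsub>G\<^esub> h) = \<theta> g \<otimes>\<^bsub>A\<^esub> \<theta> h \<otimes>\<^bsub>A\<^esub> ?c (?\<pi> g, ?\<pi> h)"
      using gh by (simp add: \<phi>_\<pi>)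
  next
    fix k g a assume k: "k \<in> lower_p_central p G T n" and g: "g \<in> carrier G"
      and a: "a \<in> carrier A" "\<rho> k = \<iota> a"
    have kG: "k \<in> carrier G" using k G.lower_p_central_subset by blast
    have \<rho>kg: "\<rho> (k \<otimes>\<^bsub>G\<^esub> g) = \<iota> a \<otimes>\<^bsub>E\<^esub> \<rho> g"
      using kG g a \<rho>_hom by (simp add: hom_mult)
    \<comment> \<open>Multiplication by \<open>\<rho> k\<close> does not change the projection, so
      the section value stays and \<open>\<iota> a\<close> passes entirely into
      \<open>\<theta>\<close>.\<close>
    have "\<rho> k \<in> lower_p_central p E TE n"
      using continuous_hom_lower_p_central[OF G E.topological_group_axioms \<rho>] k by blast
    then have "\<pi> (\<rho> (k \<otimes>\<^bsub>G\<^esub> g)) = \<pi> (\<rho> g)"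
      using g a \<rho>kg by (subst E.p_proj_eq_iff) (auto simp: cl)
    then have "\<iota> (\<theta> (k \<otimes>\<^bsub>G\<^esub> g)) \<otimes>\<^bsub>E\<^esub> section_rep (\<pi> (\<rho> g)) = \<iota> a \<otimes>\<^bsub>E\<^esub> \<rho> g"
      using \<theta>(2)[of "k \<otimes>\<^bsub>G\<^esub> g"] kG g \<rho>kg by simp
    also have "\<dots> = \<iota> a \<otimes>\<^bsub>E\<^esub> (\<iota> (\<theta> g) \<otimes>\<^bsub>E\<^esub> section_rep (\<pi> (\<rho> g)))"
      using g by (simp flip: \<theta>(2))
    also have "\<dots> = \<iota> (a \<otimes>\<^bsub>A\<^esub> \<theta> g) \<otimes>\<^bsub>E\<^esub> section_rep (\<pi> (\<rho> g))"
      using g a by (simp add: cl mult E.m_assoc)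
    finally show "\<theta> (k \<otimes>\<^bsub>G\<^esub> g) = a \<otimes>\<^bsub>A\<^esub> \<theta> g"
      using g kG a by (intro \<iota>_cancel[of _ _ "section_rep (\<pi> (\<rho> g))"]) (auto simp: cl)
  qed
qed

end

section \<open>The Magnus homomorphism\<close>

lemma continuous_map_discrete_sum:
  fixes f :: "'i \<Rightarrow> 'z \<Rightarrow> int"
  assumes "finite I" "\<And>i. i \<in> I \<Longrightarrow> continuous_map T (discrete_topology UNIV) (f i)"
  shows "continuous_map T (discrete_topology UNIV) (\<lambda>z. \<Sum>i\<in>I. f i z)"
  using assms
proof (induction I rule: finite_induct)
  case (insert i I)
  then show ?case
    by (simp add: continuous_map_discrete_binop[where B = UNIV and C = UNIV and h = "(+)"])
qed simp

lemma continuous_map_discrete_sum_list: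
  fixes f :: "'i \<Rightarrow> 'z \<Rightarrow> int"
  assumes "\<And>i. i \<in> set xs \<Longrightarrow> continuous_map T (discrete_topology UNIV) (f i)"
  shows "continuous_map T (discrete_topology UNIV) (\<lambda>z. \<Sum>i\<leftarrow>xs. f i z)"
  using assms
proof (induction xs)
  case (Cons i xs)
  then show ?case
    by (simp add: continuous_map_discrete_binop[where B = UNIV and C = UNIV and h = "(+)"])
qed simp

lemma continuous_map_conv:
  fixes F G :: "'z \<Rightarrow> 'x list \<Rightarrow> int"
  assumes "\<And>u. u \<in> lists X \<Longrightarrow> continuous_map T (discrete_topology UNIV) (\<lambda>z. F z u)"
    and "\<And>u. u \<in> lists X \<Longrightarrow> continuous_map T (discrete_topology UNIV) (\<lambda>z. G z u)"
    and "w \<in> lists X"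
  shows "continuous_map T (discrete_topology UNIV) (\<lambda>z. conv (F z) (G z) w)"
  unfolding conv_eq_sum
proof (rule continuous_map_discrete_sum)
  fix i
  show "continuous_map T (discrete_topology UNIV) (\<lambda>z. F z (take i w) * G z (drop i w))"
    using assms(1)[OF lists_take_drop(1)[OF assms(3)]] assms(2)[OF lists_take_drop(2)[OF assms(3)]]
    by (rule continuous_map_discrete_binop) simp
qed simp

text \<open>Each fibre is cut out by finitely many open conditions on coordinates, so fibres and all
  unions of them are open.\<close>

lemma continuous_map_discrete_finite_product:
  assumes "finite I" "f \<in> topspace T \<rightarrow> D" "D \<subseteq> extensional I"
    and "\<And>i. i \<in> I \<Longrightarrow> continuous_map T (discrete_topology UNIV) (\<lambda>z. f z i)"
  shows "continuous_map T (discrete_topology D) f"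
  unfolding continuous_map_def
proof (intro conjI allI impI)
  show "f \<in> topspace T \<rightarrow> topspace (discrete_topology D)" using assms(2) by simp
  fix V assume "openin (discrete_topology D) V"
  then have V: "V \<subseteq> D" by simp
  have "{z \<in> topspace T. f z \<in> V} = (\<Union>M\<in>V. (\<Inter>i\<in>I. {z \<in> topspace T. f z i \<in> {M i}}) \<inter> topspace T)"
  proof (intro equalityI subsetI)
    fix z assume "z \<in> (\<Union>M\<in>V. (\<Inter>i\<in>I. {z \<in> topspace T. f z i \<in> {M i}}) \<inter> topspace T)"
    then obtain M where M: "M \<in> V" and z: "z \<in> topspace T" and eq: "\<And>i. i \<in> I \<Longrightarrow> f z i = M i" by auto
    have "f z = M"
      by (rule extensionalityI[of _ I]) (use M z eq V assms(2,3) in auto)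
    with M z show "z \<in> {z \<in> topspace T. f z \<in> V}" by simp
  qed auto
  moreover have "openin T {z \<in> topspace T. f z i \<in> {M i}}" if "i \<in> I" for M i
    by (rule openin_continuous_map_preimage[OF assms(4)[OF that]]) simp
  then have "openin T ((\<Inter>i\<in>I. {z \<in> topspace T. f z i \<in> {M i}}) \<inter> topspace T)" for M
    using assms(1) by (intro openin_INT)
  then have "openin T (\<Union>M\<in>V. (\<Inter>i\<in>I. {z \<in> topspace T. f z i \<in> {M i}}) \<inter> topspace T)"
    by (intro openin_Union) blast
  ultimately show "openin T {z \<in> topspace T. f z \<in> V}"
    by (simp only:)
qed

section \<open>Power series over \<int>/q and their profinite unit group\<close>

locale residue_power_series =
  fixes q :: int and X :: "'x set"
  assumes q: "q > 1"
begin

abbreviation "R \<equiv> residue_ring q"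
abbreviation "P \<equiv> power_series_ring R X"
abbreviation "TP \<equiv> product_topology (\<lambda>_. discrete_topology (carrier R)) (lists X)"
abbreviation "TU \<equiv> power_series_units_topology R (discrete_topology (carrier R)) X"

lemma carrier_R: "carrier R = {0..<q}"
  by (auto simp: residue_ring_def)

lemma carrier_P: "carrier P = lists X \<rightarrow>\<^sub>E {0..<q}"
  by (simp add: power_series_ring_def carrier_R)

lemma topspace_TP: "topspace TP = carrier P"
  by (simp add: carrier_P carrier_R)

lemma mult_P:
  assumes "f \<in> carrier P" "g \<in> carrier P"
  shows "f \<otimes>\<^bsub>P\<^esub> g = (\<lambda>w \<in> lists X. conv f g w mod q)"
proof -
  interpret R: residues q R by unfold_locales (rule q)
  have "(\<Oplus>\<^bsub>R\<^esub>i\<in>{..length w}. f (take i w) \<otimes>\<^bsub>R\<^esub> g (drop i w)) = conv f g w mod q" if "w \<in> lists X" for w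
  proof -
    have "(\<Oplus>\<^bsub>R\<^esub>i\<in>{..length w}. f (take i w) \<otimes>\<^bsub>R\<^esub> g (drop i w)) = (\<Sum>i\<le>length w. f (take i w) \<otimes>\<^bsub>R\<^esub> g (drop i w)) mod q"
      using q by (intro R.finsum_eq_sum_mod) (auto simp: R.res_mult_eq R.res_carrier_eq)
    then show ?thesis by (simp only: R.res_mult_eq mod_sum_eq conv_eq_sum)
  qed
  then show ?thesis
    by (simp add: power_series_ring_def cong: restrict_cong)
qed

lemma mult_P_apply:
  "f \<in> carrier P \<Longrightarrow> g \<in> carrier P \<Longrightarrow> w \<in> lists X \<Longrightarrow> (f \<otimes>\<^bsub>P\<^esub> g) w = conv f g w mod q"
  by (simp add: mult_P)

lemma one_P: "\<one>\<^bsub>P\<^esub> = (\<lambda>w \<in> lists X. unit_series w)"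
  by (auto simp: power_series_ring_def residue_ring_def unit_series_def intro!: restrict_ext)

lemma P_range: "f \<in> carrier P \<Longrightarrow> w \<in> lists X \<Longrightarrow> f w \<in> {0..<q}"
  unfolding carrier_P by (rule PiE_mem)

lemma P_eqI:
  assumes "f \<in> carrier P" "g \<in> carrier P" "\<And>w. w \<in> lists X \<Longrightarrow> [f w = g w] (mod q)"
  shows "f = g"
proof (rule PiE_ext)
  show "f \<in> lists X \<rightarrow>\<^sub>E {0..<q}" "g \<in> lists X \<rightarrow>\<^sub>E {0..<q}" using assms by (simp_all add: carrier_P)
  show "f w = g w" if "w \<in> lists X" for w
    using assms(3)[OF that] P_range[OF assms(1) that] P_range[OF assms(2) that] by (simp add: cong_def)
qed

lemma mult_P_closed: "f \<in> carrier P \<Longrightarrow> g \<in> carrier P \<Longrightarrow> f \<otimes>\<^bsub>P\<^esub> g \<in> carrier P"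
  using q by (simp add: mult_P) (simp add: carrier_P)

lemma one_P_closed: "\<one>\<^bsub>P\<^esub> \<in> carrier P"
  unfolding one_P carrier_P using q by (auto simp: unit_series_def)

lemma conv_restrict:
  assumes "w \<in> lists X"
  shows "conv (\<lambda>w \<in> lists X. F w) G w = conv F G w" "conv F (\<lambda>w \<in> lists X. G w) w = conv F G w"
  using lists_take_drop[OF assms] by (intro conv_cong; simp)+

lemma monoid_P: "monoid P"
proof (rule monoidI)
  fix f g h assume fgh: "f \<in> carrier P" "g \<in> carrier P" "h \<in> carrier P"
  show "f \<otimes>\<^bsub>P\<^esub> g \<otimes>\<^bsub>P\<^esub> h = f \<otimes>\<^bsub>P\<^esub> (g \<otimes>\<^bsub>P\<^esub> h)"
  proof (rule P_eqI)
    fix w assume w: "w \<in> lists X"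
    have "(f \<otimes>\<^bsub>P\<^esub> g \<otimes>\<^bsub>P\<^esub> h) w = conv (f \<otimes>\<^bsub>P\<^esub> g) h w mod q"
      using fgh w mult_P_closed by (intro mult_P_apply) auto
    also have "\<dots> = conv (conv f g) h w mod q"
      unfolding mult_P[OF fgh(1,2)] conv_restrict[OF w] by (rule conv_mod)
    also have "\<dots> = conv f (conv g h) w mod q"
      by (simp only: conv_assoc)
    also have "\<dots> = conv f (g \<otimes>\<^bsub>P\<^esub> h) w mod q"
      unfolding mult_P[OF fgh(2,3)] conv_restrict[OF w] by (rule conv_mod[symmetric])
    also have "\<dots> = (f \<otimes>\<^bsub>P\<^esub> (g \<otimes>\<^bsub>P\<^esub> h)) w"
      using fgh w mult_P_closed by (intro mult_P_apply[symmetric]) auto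
    finally show "[(f \<otimes>\<^bsub>P\<^esub> g \<otimes>\<^bsub>P\<^esub> h) w = (f \<otimes>\<^bsub>P\<^esub> (g \<otimes>\<^bsub>P\<^esub> h)) w] (mod q)"
      by (simp add: cong_def)
  qed (use fgh mult_P_closed in auto)
next
  fix f assume f: "f \<in> carrier P"
  show "\<one>\<^bsub>P\<^esub> \<otimes>\<^bsub>P\<^esub> f = f"
  proof (rule P_eqI)
    fix w assume w: "w \<in> lists X"
    show "[(\<one>\<^bsub>P\<^esub> \<otimes>\<^bsub>P\<^esub> f) w = f w] (mod q)"
      unfolding mult_P_apply[OF one_P_closed f w] by (simp add: one_P conv_restrict[OF w] cong_def)
  qed (use f mult_P_closed one_P_closed in auto)
  show "f \<otimes>\<^bsub>P\<^esub> \<one>\<^bsub>P\<^esub> = f"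
  proof (rule P_eqI)
    fix w assume w: "w \<in> lists X"
    show "[(f \<otimes>\<^bsub>P\<^esub> \<one>\<^bsub>P\<^esub>) w = f w] (mod q)"
      unfolding mult_P_apply[OF f one_P_closed w] by (simp add: one_P conv_restrict[OF w] cong_def)
  qed (use f mult_P_closed one_P_closed in auto)
qed (auto simp: mult_P_closed one_P_closed)

sublocale P: monoid P
  by (rule monoid_P)

sublocale V: group "units_of P"
  by (rule P.units_group)

lemma topspace_TU: "topspace TU = Units P"
  unfolding power_series_units_topology_def topspace_subtopology topspace_TP
  by (auto simp: Units_def)

lemma continuous_map_into_TU:
  "continuous_map T TU f \<longleftrightarrow> continuous_map T TP f \<and> f \<in> topspace T \<rightarrow> Units P"
  unfolding power_series_units_topology_def by (rule continuous_map_in_subtopology)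

lemma continuous_coordinate:
  assumes "continuous_map T TP f" "w \<in> lists X"
  shows "continuous_map T (discrete_topology UNIV) (\<lambda>z. f z w)"
proof -
  have "continuous_map T (discrete_topology (carrier R)) (\<lambda>z. f z w)"
    using assms continuous_map_componentwise[of T "\<lambda>_. discrete_topology (carrier R)" "lists X" f] by auto
  then show ?thesis by (rule continuous_map_discrete_unop[where h = "\<lambda>x. x"]) simp
qed

lemma continuous_map_mult_P:
  assumes f: "continuous_map T TP f" and g: "continuous_map T TP g"
  shows "continuous_map T TP (\<lambda>z. f z \<otimes>\<^bsub>P\<^esub> g z)"
  unfolding continuous_map_componentwise
proof (intro conjI ballI)
  have cl: "f z \<in> carrier P" "g z \<in> carrier P" if "z \<in> topspace T" for z
    using continuous_map_funspace[OF f] continuous_map_funspace[OF g] that topspace_TP by auto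
  then show "(\<lambda>z. f z \<otimes>\<^bsub>P\<^esub> g z) ` topspace T \<subseteq> extensional (lists X)"
    by (auto simp: mult_P)
  fix w assume w: "w \<in> lists X"
  have "continuous_map T (discrete_topology UNIV) (\<lambda>z. conv (f z) (g z) w)"
    by (rule continuous_map_conv[OF continuous_coordinate[OF f] continuous_coordinate[OF g] w])
  then have "continuous_map T (discrete_topology (carrier R)) (\<lambda>z. conv (f z) (g z) w mod q)"
    by (rule continuous_map_discrete_unop) (use q in \<open>simp add: carrier_R\<close>)
  then show "continuous_map T (discrete_topology (carrier R)) (\<lambda>z. (f z \<otimes>\<^bsub>P\<^esub> g z) w)"
    by (rule continuous_map_eq) (simp add: cl mult_P_apply w)
qed

lemma compact_space_TP: "compact_space TP"
  by (auto simp: compact_space_product_topology compact_space_discrete_topology carrier_R)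

lemma Hausdorff_space_TP: "Hausdorff_space TP"
  by (auto simp: Hausdorff_space_product_topology)

lemma Hausdorff_space_TU: "Hausdorff_space TU"
  unfolding power_series_units_topology_def by (rule Hausdorff_space_subtopology[OF Hausdorff_space_TP])

text \<open>The unit group is the image of the compact space of pairs of mutually inverse series, which makes
  it compact and its inversion continuous.\<close>

definition "inverse_pairs = {z \<in> carrier P \<times> carrier P. fst z \<otimes>\<^bsub>P\<^esub> snd z = \<one>\<^bsub>P\<^esub> \<and> snd z \<otimes>\<^bsub>P\<^esub> fst z = \<one>\<^bsub>P\<^esub>}"

abbreviation "TK \<equiv> subtopology (prod_topology TP TP) inverse_pairs"

lemma inverse_pairs_iff:
  "z \<in> inverse_pairs \<longleftrightarrow> fst z \<in> Units P \<and> snd z = inv\<^bsub>units_of P\<^esub> (fst z)"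
proof
  assume z: "z \<in> inverse_pairs"
  then have u: "fst z \<in> Units P" by (auto simp: inverse_pairs_def Units_def)
  have "inv\<^bsub>P\<^esub> (fst z) = snd z"
    using z by (intro P.inv_unique'[symmetric]) (auto simp: inverse_pairs_def)
  with u show "fst z \<in> Units P \<and> snd z = inv\<^bsub>units_of P\<^esub> (fst z)"
    by (simp add: P.units_of_inv)
next
  assume "fst z \<in> Units P \<and> snd z = inv\<^bsub>units_of P\<^esub> (fst z)"
  then show "z \<in> inverse_pairs"
    by (cases z) (auto simp: inverse_pairs_def P.units_of_inv)
qed

lemma topspace_TK: "topspace TK = inverse_pairs"
  by (auto simp: topspace_subtopology topspace_TP inverse_pairs_def simp del: topspace_product_topology)

lemma continuous_fst_TK: "continuous_map TK TP fst" and continuous_snd_TK: "continuous_map TK TP snd"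
  by (auto intro: continuous_map_from_subtopology continuous_map_fst continuous_map_snd)

lemma compact_space_TK: "compact_space TK"
proof -
  have "closedin (prod_topology TP TP) {z \<in> topspace (prod_topology TP TP). fst z \<otimes>\<^bsub>P\<^esub> snd z = \<one>\<^bsub>P\<^esub>}"
    "closedin (prod_topology TP TP) {z \<in> topspace (prod_topology TP TP). snd z \<otimes>\<^bsub>P\<^esub> fst z = \<one>\<^bsub>P\<^esub>}"
    using one_P_closed
    by (intro closedin_continuous_maps_eq[OF Hausdorff_space_TP] continuous_map_mult_P
        continuous_map_fst continuous_map_snd; simp add: topspace_TP del: topspace_product_topology)+
  then have "closedin (prod_topology TP TP)
      ({z \<in> topspace (prod_topology TP TP). fst z \<otimes>\<^bsub>P\<^esub> snd z = \<one>\<^bsub>P\<^esub>} \<inter>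
       {z \<in> topspace (prod_topology TP TP). snd z \<otimes>\<^bsub>P\<^esub> fst z = \<one>\<^bsub>P\<^esub>})"
    by (rule closedin_Int)
  also have "{z \<in> topspace (prod_topology TP TP). fst z \<otimes>\<^bsub>P\<^esub> snd z = \<one>\<^bsub>P\<^esub>} \<inter>
       {z \<in> topspace (prod_topology TP TP). snd z \<otimes>\<^bsub>P\<^esub> fst z = \<one>\<^bsub>P\<^esub>} = inverse_pairs"
    unfolding topspace_prod_topology topspace_TP inverse_pairs_def by auto
  finally have "compactin (prod_topology TP TP) inverse_pairs"
    by (intro closedin_compact_space) (simp_all add: compact_space_prod_topology compact_space_TP)
  then show ?thesis by (rule compact_space_subtopology)
qed

text \<open>A continuous surjection from a compact space onto a Hausdorff space is a quotient
  map.\<close>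

lemma quotient_map_fst_TK: "quotient_map TK TU fst"
proof (rule continuous_imp_quotient_map[OF _ compact_space_TK Hausdorff_space_TU])
  show "continuous_map TK TU fst"
    unfolding continuous_map_into_TU
    using continuous_fst_TK by (auto simp: topspace_TK inverse_pairs_iff simp del: topspace_subtopology)
  have "(f, inv\<^bsub>units_of P\<^esub> f) \<in> inverse_pairs" if "f \<in> Units P" for f
    using that by (simp add: inverse_pairs_iff)
  then show "fst ` topspace TK = topspace TU"
    unfolding topspace_TK topspace_TU
    by (metis (no_types, lifting) fst_conv image_eqI image_subsetI inverse_pairs_iff subsetI subset_antisym)
qed

lemma profinite_group_units: "profinite_group (units_of P) TU"
proof (unfold_locales)
  show "topspace TU = carrier (units_of P)"
    by (simp add: topspace_TU units_of_carrier)
  have TU_TP: "continuous_map TU TP (\<lambda>x. x)"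
    unfolding power_series_units_topology_def by (intro continuous_map_from_subtopology) simp
  show "continuous_map (prod_topology TU TU) TU (\<lambda>(x, y). x \<otimes>\<^bsub>units_of P\<^esub> y)"
    unfolding case_prod_unfold units_of_mult continuous_map_into_TU
  proof (intro conjI continuous_map_mult_P)
    show "continuous_map (prod_topology TU TU) TP fst" "continuous_map (prod_topology TU TU) TP snd"
      using continuous_map_compose[OF continuous_map_fst TU_TP, of TU]
        continuous_map_compose[OF continuous_map_snd TU_TP, of TU] by (simp_all add: o_def)
    show "(\<lambda>x. fst x \<otimes>\<^bsub>P\<^esub> snd x) \<in> topspace (prod_topology TU TU) \<rightarrow> Units P"
      by (auto simp: topspace_TU)
  qed
  \<comment> \<open>On inverse pairs, inversion after \<open>fst\<close> is simply
    \<open>snd\<close>; its continuity descends along the quotient map \<open>fst\<close>.\<close>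
  have "continuous_map TK TU (\<lambda>x. snd x)"
    unfolding continuous_map_into_TU
    using continuous_snd_TK V.inv_closed
    by (auto simp: topspace_TK inverse_pairs_iff units_of_carrier simp del: topspace_subtopology)
  then have "continuous_map TK TU ((\<lambda>x. inv\<^bsub>units_of P\<^esub> x) \<circ> fst)"
    by (rule continuous_map_eq) (simp add: topspace_TK inverse_pairs_iff del: topspace_subtopology)
  then show "continuous_map TU TU (\<lambda>x. inv\<^bsub>units_of P\<^esub> x)"
    by (rule continuous_compose_quotient_map[OF quotient_map_fst_TK])
  have "compactin TU (fst ` topspace TK)"
    using compact_space_TK quotient_imp_continuous_map[OF quotient_map_fst_TK]
    unfolding compact_space_def by (rule image_compactin)
  then show "compact_space TU"
    unfolding compact_space_def quotient_imp_surjective_map[OF quotient_map_fst_TK] .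
  show "Hausdorff_space TU" by (rule Hausdorff_space_TU)
  fix C assume C: "connectedin TU C"
  show "\<exists>x. C \<subseteq> {x}"
  proof (cases "C = {}")
    case False
    then obtain f where f: "f \<in> C" by blast
    have CU: "C \<subseteq> Units P"
      using connectedin_subset_topspace[OF C] topspace_TU by simp
    have "g = f" if g: "g \<in> C" for g
    proof (rule P_eqI)
      show "f \<in> carrier P" "g \<in> carrier P" using f g CU by (auto simp: Units_def)
      \<comment> \<open>Each coefficient is a continuous map to a discrete space, hence constant on
        the connected set \<open>C\<close>.\<close>
      fix w assume "w \<in> lists X"
      then have "connectedin (discrete_topology UNIV) ((\<lambda>h. h w) ` C)"
        using connectedin_continuous_map_image[OF continuous_coordinate[OF TU_TP] C] by blast
      then obtain a where "(\<lambda>h. h w) ` C \<subseteq> {a}"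
        by (auto simp: connectedin_discrete_topology)
      with f g have "g w = f w" by blast
      then show "[g w = f w] (mod q)" by simp
    qed
    then show ?thesis by blast
  qed simp
qed

section \<open>The units \<open>1 + x\<close>\<close>

definition one_plus_var :: "'x \<Rightarrow> 'x list \<Rightarrow> int" where
  "one_plus_var x = \<one>\<^bsub>P\<^esub> \<oplus>\<^bsub>P\<^esub> power_series_var R X x"

lemma one_plus_var_eq:
  "one_plus_var x = (\<lambda>w \<in> lists X. of_bool (w = []) + of_bool (w = [x]))"
  unfolding one_plus_var_def power_series_ring_def power_series_var_def residue_ring_def
  using q by (auto intro!: restrict_ext)

lemma one_plus_var_closed: "one_plus_var x \<in> carrier P"
  unfolding one_plus_var_eq carrier_P using q by auto

text \<open>\<open>G\<close> is the geometric series 1 - x + x^2 - ..., where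
  \<open>set w \<subseteq> {x}\<close> says that \<open>w\<close> is a power of \<open>x\<close>.
  The left derivatives of \<open>F\<close> are multiples of the unit series, so a case distinction
  settles the first product; those of \<open>G\<close> are multiples of \<open>G\<close>, so the
  second needs induction.\<close>

lemma one_plus_var_inverse:
  fixes x :: 'x
  defines "F \<equiv> \<lambda>w::'x list. of_bool (w = []) + of_bool (w = [x]) :: int"
    and "G \<equiv> \<lambda>w. of_bool (set w \<subseteq> {x}) * (- 1) ^ length w"
  shows "conv F G w = unit_series w" "conv G F w = unit_series w"
proof -
  show "conv F G w = unit_series w"
  proof (cases w)
    case (Cons y v)
    have "(\<lambda>w. F (y # w)) = (\<lambda>w. of_bool (y = x) * unit_series w)"
      by (auto simp: F_def unit_series_def)
    then have "conv F G (y # v) = G (y # v) + of_bool (y = x) * G v"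
      by (simp add: conv_scale_left) (simp add: F_def)
    with Cons show ?thesis by (auto simp: G_def unit_series_def)
  qed (simp add: F_def G_def unit_series_def)
  show "conv G F w = unit_series w"
  proof (induction w)
    case (Cons y v)
    have "(\<lambda>w. G (y # w)) = (\<lambda>w. (- of_bool (y = x)) * G w)"
      by (auto simp: G_def)
    then have "conv (\<lambda>w. G (y # w)) F v = - of_bool (y = x) * conv G F v"
      by (simp only: conv_scale_left)
    moreover have "G [] = 1" by (simp add: G_def)
    ultimately have "conv G F (y # v) = F (y # v) - of_bool (y = x) * conv G F v"
      by simp
    with Cons show ?case by (auto simp: F_def unit_series_def)
  qed (simp add: F_def G_def unit_series_def)
qed

lemma one_plus_var_unit: "one_plus_var x \<in> Units P"
proof -
  let ?G = "\<lambda>w. of_bool (set w \<subseteq> {x}) * (- 1) ^ length w :: int"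
  let ?g = "\<lambda>w \<in> lists X. ?G w mod q"
  have g: "?g \<in> carrier P" unfolding carrier_P using q by auto
  have "?g \<otimes>\<^bsub>P\<^esub> one_plus_var x = \<one>\<^bsub>P\<^esub>"
  proof (rule P_eqI)
    fix w assume w: "w \<in> lists X"
    have "(?g \<otimes>\<^bsub>P\<^esub> one_plus_var x) w = conv (?g) (one_plus_var x) w mod q"
      by (rule mult_P_apply[OF g one_plus_var_closed w])
    also have "\<dots> = unit_series w mod q"
      unfolding one_plus_var_eq conv_restrict[OF w] conv_mod one_plus_var_inverse ..
    finally show "[(?g \<otimes>\<^bsub>P\<^esub> one_plus_var x) w = \<one>\<^bsub>P\<^esub> w] (mod q)"
      using w by (simp add: cong_def one_P)
  qed (use g one_plus_var_closed mult_P_closed one_P_closed in auto)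
  moreover have "one_plus_var x \<otimes>\<^bsub>P\<^esub> ?g = \<one>\<^bsub>P\<^esub>"
  proof (rule P_eqI)
    fix w assume w: "w \<in> lists X"
    have "(one_plus_var x \<otimes>\<^bsub>P\<^esub> ?g) w = conv (one_plus_var x) (?g) w mod q"
      by (rule mult_P_apply[OF one_plus_var_closed g w])
    also have "\<dots> = unit_series w mod q"
      unfolding one_plus_var_eq conv_restrict[OF w] conv_mod one_plus_var_inverse ..
    finally show "[(one_plus_var x \<otimes>\<^bsub>P\<^esub> ?g) w = \<one>\<^bsub>P\<^esub> w] (mod q)"
      using w by (simp add: cong_def one_P)
  qed (use g one_plus_var_closed mult_P_closed one_P_closed in auto)
  ultimately show ?thesis
    using g one_plus_var_closed unfolding Units_def by blast
qed

text \<open>A basic neighbourhood of 1 restricts the coefficients at finitely many words, and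
  \<open>one_plus_var x\<close> differs from 1 only at \<open>[x]\<close>. So only finitely many
  \<open>x\<close> can leave it.\<close>

lemma one_plus_var_converges: "converges_to_one X one_plus_var (units_of P) TU"
  unfolding converges_to_one_def
proof (intro allI impI)
  fix N assume N: "N \<lhd> units_of P \<and> openin TU N"
  then have one: "\<one>\<^bsub>P\<^esub> \<in> N"
    using subgroup.one_closed[OF normal_imp_subgroup, of N "units_of P"] by (simp add: units_of_one)
  from N obtain W where W: "openin TP W" "N = W \<inter> Units P"
    by (auto simp: power_series_units_topology_def openin_subtopology)
  with one have "\<one>\<^bsub>P\<^esub> \<in> W" by blast
  from bspec[OF W(1)[unfolded openin_product_topology_alt] this] obtain Y where Y: "finite {w \<in> lists X. Y w \<noteq> topspace (discrete_topology (carrier R))}"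
    "\<one>\<^bsub>P\<^esub> \<in> Pi\<^sub>E (lists X) Y" "Pi\<^sub>E (lists X) Y \<subseteq> W"
    by (elim exE conjE)
  let ?J = "{w \<in> lists X. Y w \<noteq> carrier R}"
  have "one_plus_var x \<in> N" if x: "x \<in> X" "[x] \<notin> ?J" for x
  proof -
    have "one_plus_var x w \<in> Y w" if w: "w \<in> lists X" for w
    proof (cases "w = [x]")
      case True
      then have "Y w = carrier R" using x by auto
      then show ?thesis using P_range[OF one_plus_var_closed w] by (simp add: carrier_R)
    next
      case False
      then have "one_plus_var x w = \<one>\<^bsub>P\<^esub> w"
        using w by (simp add: one_plus_var_eq one_P unit_series_def)
      then show ?thesis using PiE_mem[OF Y(2) w] by simp
    qed
    moreover have "one_plus_var x \<in> extensional (lists X)"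
      by (simp add: one_plus_var_eq)
    ultimately have "one_plus_var x \<in> Pi\<^sub>E (lists X) Y" by (auto simp: PiE_def)
    then show ?thesis using Y(3) W(2) one_plus_var_unit by blast
  qed
  then have "{x \<in> X. one_plus_var x \<notin> N} \<subseteq> (\<lambda>x. [x]) -` ?J" by blast
  moreover have "finite ((\<lambda>x. [x]) -` ?J)"
    using Y(1) by (intro finite_vimageI) (auto simp: inj_def)
  ultimately show "finite {x \<in> X. one_plus_var x \<notin> N}" by (rule finite_subset)
qed

end

section \<open>Magnus series are grouplike\<close>

locale magnus = free_profinite_group S T X + residue_power_series q X
  for S :: "('a, 'b) monoid_scheme" and T :: "'a topology" and X :: "'a set" and q :: int
begin

abbreviation "\<Lambda> \<equiv> magnus_hom R (discrete_topology (carrier R)) S T X"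

text \<open>Series over \<open>X\<close> with integer representatives have the type at which
  \<open>universal\<close> is stated, so existence and uniqueness give the description
  \<open>THE\<close> its meaning.\<close>

lemma magnus_hom:
  "\<Lambda> \<in> continuous_hom S T (units_of P) TU" "x \<in> X \<Longrightarrow> \<Lambda> x = one_plus_var x"
proof -
  have "\<exists>!h. h \<in> continuous_hom S T (units_of P) TU \<and> h \<in> extensional (carrier S) \<and> (\<forall>x\<in>X. h x = one_plus_var x)"
    by (rule universal[OF profinite_group_units _ one_plus_var_converges])
      (simp add: units_of_carrier one_plus_var_unit)
  from theI'[OF this]
  have "\<Lambda> \<in> continuous_hom S T (units_of P) TU \<and> \<Lambda> \<in> extensional (carrier S) \<and> (\<forall>x\<in>X. \<Lambda> x = one_plus_var x)"
    unfolding magnus_hom_def one_plus_var_def .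
  then show "\<Lambda> \<in> continuous_hom S T (units_of P) TU" "x \<in> X \<Longrightarrow> \<Lambda> x = one_plus_var x"
    by blast+
qed

lemma magnus_closed: "\<sigma> \<in> carrier S \<Longrightarrow> \<Lambda> \<sigma> \<in> Units P" "\<sigma> \<in> carrier S \<Longrightarrow> \<Lambda> \<sigma> \<in> carrier P"
  using magnus_hom(1) by (auto simp: continuous_hom_def hom_def units_of_carrier)

lemma magnus_mult:
  assumes "\<sigma> \<in> carrier S" "\<tau> \<in> carrier S" "w \<in> lists X"
  shows "\<Lambda> (\<sigma> \<otimes>\<^bsub>S\<^esub> \<tau>) w = conv (\<Lambda> \<sigma>) (\<Lambda> \<tau>) w mod q"
proof -
  have "\<Lambda> (\<sigma> \<otimes>\<^bsub>S\<^esub> \<tau>) = \<Lambda> \<sigma> \<otimes>\<^bsub>P\<^esub> \<Lambda> \<tau>"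
    using magnus_hom(1) assms by (auto simp: continuous_hom_def hom_def units_of_mult)
  with assms show ?thesis by (simp add: mult_P_apply magnus_closed)
qed

lemma magnus_one: "\<Lambda> \<one>\<^bsub>S\<^esub> = \<one>\<^bsub>P\<^esub>"
proof -
  interpret group_hom S "units_of P" \<Lambda>
    using magnus_hom(1) by unfold_locales (simp add: continuous_hom_def)
  show ?thesis using hom_one by (simp add: units_of_one)
qed

lemma continuous_map_magnus:
  "w \<in> lists X \<Longrightarrow> continuous_map T (discrete_topology UNIV) (\<lambda>\<sigma>. \<Lambda> \<sigma> w)"
  using magnus_hom(1)
  by (intro continuous_coordinate)
    (simp_all add: continuous_hom_def power_series_units_topology_def continuous_map_in_subtopology)

lemma closedin_preimage_discrete:
  assumes "continuous_map T (discrete_topology UNIV) f"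
  shows "closedin T {\<sigma> \<in> carrier S. f \<sigma> \<in> C}"
  using closedin_continuous_map_preimage[OF assms, of C] topspace_eq by simp

text \<open>Each relation involves finitely many coefficients, which are continuous with discrete
  values. The whole condition is an intersection of closed ones.\<close>

lemma closedin_grouplike: "closedin T {\<sigma> \<in> carrier S. grouplike q X (\<Lambda> \<sigma>)}"
proof -
  have one: "closedin T {\<sigma> \<in> carrier S. \<Lambda> \<sigma> [] \<in> {1}}"
    by (rule closedin_preimage_discrete[OF continuous_map_magnus]) simp
  have "closedin T {\<sigma> \<in> carrier S. coproduct (\<Lambda> \<sigma>) u v - \<Lambda> \<sigma> u * \<Lambda> \<sigma> v \<in> {d. q dvd d}}"
    if uv: "u \<in> lists X" "v \<in> lists X" for u v
  proof (rule closedin_preimage_discrete)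
    have "continuous_map T (discrete_topology UNIV) (\<lambda>\<sigma>. coproduct (\<Lambda> \<sigma>) u v)"
      unfolding coproduct_def
      by (rule continuous_map_discrete_sum_list[OF continuous_map_magnus])
        (rule set_infiltration_lists[OF uv])
    moreover have "continuous_map T (discrete_topology UNIV) (\<lambda>\<sigma>. \<Lambda> \<sigma> u * \<Lambda> \<sigma> v)"
      using continuous_map_magnus[OF uv(1)] continuous_map_magnus[OF uv(2)]
      by (rule continuous_map_discrete_binop) simp
    ultimately show "continuous_map T (discrete_topology UNIV) (\<lambda>\<sigma>. coproduct (\<Lambda> \<sigma>) u v - \<Lambda> \<sigma> u * \<Lambda> \<sigma> v)"
      by (rule continuous_map_discrete_binop) simp
  qed
  then have "closedin T (\<Inter>u\<in>lists X. \<Inter>v\<in>lists X.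
      {\<sigma> \<in> carrier S. coproduct (\<Lambda> \<sigma>) u v - \<Lambda> \<sigma> u * \<Lambda> \<sigma> v \<in> {d. q dvd d}})"
    by (intro closedin_Inter) auto
  from closedin_Int[OF one this] show ?thesis
    by (rule back_subst[of "closedin T"]) (auto simp: grouplike_def cong_iff_dvd_diff)
qed

text \<open>The elements with grouplike series form a closed subgroup containing \<open>X\<close>,
  and \<open>X\<close> generates \<open>S\<close> topologically.\<close>

lemma grouplike_magnus:
  assumes "\<sigma> \<in> carrier S"
  shows "grouplike q X (\<Lambda> \<sigma>)"
proof -
  let ?K = "{\<sigma> \<in> carrier S. grouplike q X (\<Lambda> \<sigma>)}"
  have base: "grouplike q X (\<Lambda> x)" if x: "x \<in> X" for x
    unfolding grouplike_def
  proof (intro conjI ballI)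
    let ?F = "\<lambda>w. of_bool (w = []) + of_bool (w = [x]) :: int"
    show "\<Lambda> x [] = 1" using x by (simp add: magnus_hom(2) one_plus_var_eq)
    fix u v assume uv: "u \<in> lists X" "v \<in> lists X"
    have "coproduct (\<Lambda> x) u v = coproduct ?F u v"
      using set_infiltration_lists[OF uv] x
      by (intro coproduct_cong) (simp add: magnus_hom(2) one_plus_var_eq)
    also have "\<dots> = ?F u * ?F v" by (rule coproduct_one_plus_var)
    also have "\<dots> = \<Lambda> x u * \<Lambda> x v" using uv x by (simp add: magnus_hom(2) one_plus_var_eq)
    finally show "[coproduct (\<Lambda> x) u v = \<Lambda> x u * \<Lambda> x v] (mod q)" by simp
  qed
  have "subgroup ?K S"
  proof (rule subgroupI)
    have "grouplike q X (\<Lambda> \<one>\<^bsub>S\<^esub>)"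
      unfolding grouplike_def magnus_one
    proof (intro conjI ballI)
      show "\<one>\<^bsub>P\<^esub> [] = 1" by (simp add: one_P unit_series_def)
      fix u v assume uv: "u \<in> lists X" "v \<in> lists X"
      have "coproduct \<one>\<^bsub>P\<^esub> u v = coproduct unit_series u v"
        using set_infiltration_lists[OF uv] by (intro coproduct_cong) (simp add: one_P)
      then show "[coproduct \<one>\<^bsub>P\<^esub> u v = \<one>\<^bsub>P\<^esub> u * \<one>\<^bsub>P\<^esub> v] (mod q)"
        using uv by (simp add: one_P coproduct_unit) (simp add: unit_series_def)
    qed
    then show "?K \<noteq> {}" by auto
  next
    fix \<sigma> assume "\<sigma> \<in> ?K"
    then have \<sigma>: "\<sigma> \<in> carrier S" "grouplike q X (\<Lambda> \<sigma>)" by auto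
    have *: "[conv (\<Lambda> \<sigma>) (\<Lambda> (inv\<^bsub>S\<^esub> \<sigma>)) w = unit_series w] (mod q)" if "w \<in> lists X" for w
      using magnus_mult[of \<sigma> "inv\<^bsub>S\<^esub> \<sigma>" w] \<sigma> that magnus_one one_P q
      by (simp add: cong_def unit_series_def)
    \<comment> \<open>\<open>grouplike\<close> asks for the constant term 1 itself. The product
      gives it modulo \<open>q\<close>, and the range of representatives makes it exact.\<close>
    have "\<Lambda> (inv\<^bsub>S\<^esub> \<sigma>) [] \<in> {0..<q}"
      using \<sigma> by (intro P_range magnus_closed) auto
    with *[of "[]"] \<sigma> q have "\<Lambda> (inv\<^bsub>S\<^esub> \<sigma>) [] = 1"
      by (simp add: grouplike_def unit_series_def cong_def)
    with \<sigma> * show "inv\<^bsub>S\<^esub> \<sigma> \<in> ?K"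
      using grouplike_inverse[OF \<sigma>(2), of "\<Lambda> (inv\<^bsub>S\<^esub> \<sigma>)"] by simp
  next
    fix \<sigma> \<tau> assume "\<sigma> \<in> ?K" "\<tau> \<in> ?K"
    then have \<sigma>\<tau>: "\<sigma> \<in> carrier S" "grouplike q X (\<Lambda> \<sigma>)" "\<tau> \<in> carrier S" "grouplike q X (\<Lambda> \<tau>)" by auto
    have "grouplike q X (\<Lambda> (\<sigma> \<otimes>\<^bsub>S\<^esub> \<tau>))"
    proof (rule grouplike_mult[OF \<sigma>\<tau>(2,4)])
      show "[\<Lambda> (\<sigma> \<otimes>\<^bsub>S\<^esub> \<tau>) w = conv (\<Lambda> \<sigma>) (\<Lambda> \<tau>) w] (mod q)" if "w \<in> lists X" for w
        using magnus_mult[OF \<sigma>\<tau>(1,3) that] by (simp add: cong_def)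
      show "\<Lambda> (\<sigma> \<otimes>\<^bsub>S\<^esub> \<tau>) [] = 1"
        using magnus_mult[OF \<sigma>\<tau>(1,3), of "[]"] \<sigma>\<tau> q by (simp add: grouplike_def)
    qed
    with \<sigma>\<tau> show "\<sigma> \<otimes>\<^bsub>S\<^esub> \<tau> \<in> ?K" by simp
  qed auto
  then have "closed_subgroup_generated S T X \<subseteq> ?K"
    by (rule closed_subgroup_generated_minimal[OF _ closedin_grouplike]) (use base basis_subset in auto)
  with assms show ?thesis using basis_generates by blast
qed

end

section \<open>The shuffle relations\<close>

locale free_unipotent = unipotent_setting p n s + free_profinite_group S T X
  for p n s :: nat and S :: "('a, 'b) monoid_scheme" and T :: "'a topology" and X :: "'a set"
begin

sublocale magnus S T X q
  by unfold_locales (rule q_gt_1)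

sublocale extension: discrete_central_extension U "UU_topology p n s" A incl p n
  by (intro discrete_central_extension.intro discrete_central_extension_axioms.intro
      U.topological_group_axioms abelian_integer_mod_group)
    (auto simp: UU_topology_def incl_hom incl_inj incl_central
      intro: subsetD[OF lower_p_central_UU_subset_incl, unfolded UU_topology_def])

sublocale coefficients: trivial_coefficients "p_quotient p n S T" "p_quotient_topology p n S T" A
  by (simp add: trivial_coefficients_def topological_group_p_quotient)

abbreviation "\<rho> \<equiv> rho p n S T X"

definition subword :: "'a list \<Rightarrow> nat \<Rightarrow> nat \<Rightarrow> 'a list" where
  "subword w i j = take (j - i) (drop (i - 1) w)"

lemma subword_lists: "w \<in> lists X \<Longrightarrow> subword w i j \<in> lists X"
  unfolding subword_def by (intro lists_take_drop)

lemma subword_self [simp]: "subword w i i = []"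
  by (simp add: subword_def)

lemma subword_split:
  assumes "1 \<le> i" "i \<le> l" "l \<le> j" "j \<le> length w + 1"
  shows "take (l - i) (subword w i j) = subword w i l" "drop (l - i) (subword w i j) = subword w l j"
  using assms by (simp_all add: subword_def drop_take)

lemma length_subword: "1 \<le> i \<Longrightarrow> i \<le> j \<Longrightarrow> j \<le> length w + 1 \<Longrightarrow> length (subword w i j) = j - i"
  by (simp add: subword_def)

lemma rho_eq:
  assumes "length w = s"
  shows "\<rho> w \<sigma> = (\<lambda>(i, j) \<in> {1..s+1} \<times> {1..s+1}.
    if i < j then \<Lambda> \<sigma> (subword w i j) else if i = j then 1 else 0)"
  unfolding rho_def Let_def magnus_coeff_def Zmod_def q_def subword_def assms ..

lemma rho_entry:
  "length w = s \<Longrightarrow> 1 \<le> i \<Longrightarrow> i < j \<Longrightarrow> j \<le> s + 1 \<Longrightarrow> \<rho> w \<sigma> (i, j) = \<Lambda> \<sigma> (subword w i j)"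
  by (simp add: rho_eq)

lemma rho_closed:
  assumes "w \<in> lists X" "length w = s" "\<sigma> \<in> carrier S"
  shows "\<rho> w \<sigma> \<in> carrier U"
proof -
  have "\<Lambda> \<sigma> (subword w i j) \<in> {0..<q}" for i j
    using assms by (intro P_range magnus_closed subword_lists)
  then show ?thesis
    unfolding carrier_UU using q_gt_1 assms(2) by (auto simp: rho_eq)
qed

lemma magnus_Nil: "\<sigma> \<in> carrier S \<Longrightarrow> \<Lambda> \<sigma> [] = 1"
  using grouplike_magnus by (simp add: grouplike_def)

text \<open>Cutting the word between rows \<open>i\<close> and \<open>j\<close> at \<open>l\<close>
  corresponds to the intermediate index \<open>l\<close> of the matrix product. The cuts at
  \<open>l = i\<close> and \<open>l = j\<close> leave an empty word, whose coefficient 1 is the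
  diagonal entry.\<close>

lemma rho_mult:
  assumes w: "w \<in> lists X" "length w = s" and \<sigma>\<tau>: "\<sigma> \<in> carrier S" "\<tau> \<in> carrier S"
  shows "\<rho> w (\<sigma> \<otimes>\<^bsub>S\<^esub> \<tau>) = \<rho> w \<sigma> \<otimes>\<^bsub>U\<^esub> \<rho> w \<tau>"
proof (rule UU_eqI)
  show "\<rho> w (\<sigma> \<otimes>\<^bsub>S\<^esub> \<tau>) \<in> carrier U" "\<rho> w \<sigma> \<otimes>\<^bsub>U\<^esub> \<rho> w \<tau> \<in> carrier U"
    by (intro rho_closed mult_UU_closed w \<sigma>\<tau> m_closed)+
  fix i j assume ij: "1 \<le> i" "i < j" "j \<le> s + 1"
  let ?v = "subword w i j"
  have "conv (\<Lambda> \<sigma>) (\<Lambda> \<tau>) ?v = (\<Sum>k\<le>j - i. \<Lambda> \<sigma> (take k ?v) * \<Lambda> \<tau> (drop k ?v))"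
    using ij w by (simp add: conv_eq_sum length_subword)
  \<comment> \<open>The cut after \<open>k\<close> letters becomes the matrix index
    \<open>l = k + i\<close>.\<close>
  also have "\<dots> = (\<Sum>l\<in>{i..j}. \<Lambda> \<sigma> (take (l - i) ?v) * \<Lambda> \<tau> (drop (l - i) ?v))"
    by (rule sum.reindex_bij_witness[where i = "\<lambda>l. l - i" and j = "\<lambda>k. k + i"]) (use ij in auto)
  also have "\<dots> = (\<Sum>l\<in>{i..j}. \<Lambda> \<sigma> (subword w i l) * \<Lambda> \<tau> (subword w l j))"
    using ij w by (intro sum.cong) (auto simp: subword_split)
  also have "{i..j} = insert i (insert j {i<..<j})" using ij by auto
  also have "(\<Sum>l\<in>\<dots>. \<Lambda> \<sigma> (subword w i l) * \<Lambda> \<tau> (subword w l j)) =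
      \<rho> w \<sigma> (i, j) + \<rho> w \<tau> (i, j) + (\<Sum>l\<in>{i<..<j}. \<rho> w \<sigma> (i, l) * \<rho> w \<tau> (l, j))"
  proof -
    have "(\<Sum>l\<in>{i<..<j}. \<Lambda> \<sigma> (subword w i l) * \<Lambda> \<tau> (subword w l j)) =
        (\<Sum>l\<in>{i<..<j}. \<rho> w \<sigma> (i, l) * \<rho> w \<tau> (l, j))"
      using ij w by (intro sum.cong) (auto simp: rho_entry)
    then show ?thesis using ij w \<sigma>\<tau> by (simp add: rho_entry magnus_Nil)
  qed
  finally have "conv (\<Lambda> \<sigma>) (\<Lambda> \<tau>) ?v =
      \<rho> w \<sigma> (i, j) + \<rho> w \<tau> (i, j) + (\<Sum>l\<in>{i<..<j}. \<rho> w \<sigma> (i, l) * \<rho> w \<tau> (l, j))" .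
  moreover have "\<rho> w (\<sigma> \<otimes>\<^bsub>S\<^esub> \<tau>) (i, j) = conv (\<Lambda> \<sigma>) (\<Lambda> \<tau>) ?v mod q"
    using ij w \<sigma>\<tau> by (simp add: rho_entry magnus_mult subword_lists)
  ultimately show "\<rho> w (\<sigma> \<otimes>\<^bsub>S\<^esub> \<tau>) (i, j) = (\<rho> w \<sigma> \<otimes>\<^bsub>U\<^esub> \<rho> w \<tau>) (i, j)"
    using ij w \<sigma>\<tau> by (simp add: mult_UU_entry rho_closed)
qed

lemma rho_continuous_hom:
  assumes w: "w \<in> lists X" "length w = s"
  shows "\<rho> w \<in> continuous_hom S T U (UU_topology p n s)"
proof (rule continuous_homI)
  show "\<rho> w \<in> hom S U"
    using assms by (intro homI) (auto simp: rho_closed rho_mult)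
  show "continuous_map T (UU_topology p n s) (\<rho> w)"
    unfolding UU_topology_def
  proof (rule continuous_map_discrete_finite_product[of "{1..s+1} \<times> {1..s+1}"])
    show "\<rho> w \<in> topspace T \<rightarrow> carrier U" using assms by (auto simp: topspace_eq rho_closed)
    show "carrier U \<subseteq> extensional ({1..s+1} \<times> {1..s+1})"
      using carrier_UU by (auto simp: PiE_def)
    fix x assume x: "x \<in> {1..s+1} \<times> {1..s+1}"
    obtain i j where ij: "x = (i, j)" by (cases x)
    show "continuous_map T (discrete_topology UNIV) (\<lambda>\<sigma>. \<rho> w \<sigma> x)"
      using x w continuous_map_magnus[OF subword_lists[OF w(1)], of i j] by (simp add: rho_eq ij)
  qed auto
qed

lemma rho_lower_p_central:
  assumes "w \<in> lists X" "length w = s" "k \<in> lower_p_central p S T n"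
  obtains a where "a \<in> carrier A" "\<rho> w k = incl a"
  using continuous_hom_lower_p_central[OF topological_group_axioms U.topological_group_axioms
      rho_continuous_hom[OF assms(1,2)], of p n] assms(3) lower_p_central_UU_subset_incl
  by blast

text \<open>Padding \<open>v\<close> on the right to a word of length \<open>s\<close> displays its
  coefficient, modulo the same \<open>q\<close>, in the first row of a matrix
  \<open>\<rho> w k\<close>. Since \<open>v\<close> is too short, the entry is not the
  corner.\<close>

lemma magnus_vanishes:
  assumes k: "k \<in> lower_p_central p S T n" and v: "v \<in> lists X" "v \<noteq> []" "length v < s"
  shows "\<Lambda> k v = 0"
proof -
  \<comment> \<open>The first letter of \<open>v\<close> serves as padding and keeps the word over
    \<open>X\<close>.\<close>
  obtain x v' where "v = x # v'" using v by (cases v) auto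
  define w where "w = v @ replicate (s - length v) x"
  have w: "w \<in> lists X" "length w = s"
    using v \<open>v = x # v'\<close> by (auto simp: w_def)
  obtain a where a: "\<rho> w k = incl a"
    using rho_lower_p_central[OF w k] by blast
  have "subword w 1 (length v + 1) = v" by (simp add: subword_def w_def)
  then have "\<Lambda> k v = \<rho> w k (1, length v + 1)"
    using v w by (subst rho_entry) auto
  also have "\<dots> = 0"
    unfolding a using v by (subst incl_entry) auto
  finally show ?thesis .
qed

text \<open>In the grouplike relation at \<open>u\<close> and \<open>v\<close>, the product vanishes
  on \<open>k\<close> because \<open>u\<close> is shorter than \<open>s\<close>, and so do the
  infiltrations that are not shuffles. The remaining coefficients are
  \<open>a w * int p ^ (n - s)\<close>, and dividing the congruence modulo \<open>q\<close> by
  \<open>int p ^ (n - s)\<close> leaves one modulo \<open>p\<close>.\<close>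

lemma shuffle_relation:
  assumes k: "k \<in> lower_p_central p S T n"
    and uv: "u \<in> lists X" "u \<noteq> []" "v \<in> lists X" "v \<noteq> []" "s = length u + length v"
    and a: "\<And>w. w \<in> lists X \<Longrightarrow> length w = s \<Longrightarrow> \<rho> w k = incl (a w)"
  shows "int p dvd (\<Sum>w | w \<in> lists X \<and> length w = s \<and> shuffle u v w \<noteq> 0. shuffle u v w * a w)"
    (is "_ dvd sum _ ?W")
proof -
  have kS: "k \<in> carrier S" using k lower_p_central_subset by blast
  have "[coproduct (\<Lambda> k) u v = \<Lambda> k u * \<Lambda> k v] (mod q)"
    by (rule grouplikeD[OF grouplike_magnus[OF kS] uv(1,3)])
  moreover have "\<Lambda> k u = 0"
    using uv by (intro magnus_vanishes[OF k]) (cases v; simp)+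
  moreover have "coproduct (\<Lambda> k) u v = (\<Sum>w\<in>?W. shuffle u v w * \<Lambda> k w)"
    unfolding uv(5) using uv magnus_vanishes[OF k] by (intro coproduct_eq_sum_shuffle) auto
  moreover have "\<Lambda> k w = a w * int p ^ (n - s)" if "w \<in> ?W" for w
  proof -
    have "\<rho> w k (1, s + 1) = \<Lambda> k w"
      using that s by (simp add: rho_entry subword_def)
    moreover have "\<rho> w k (1, s + 1) = a w * int p ^ (n - s)"
      using that s a[of w] by (simp add: incl_entry)
    ultimately show ?thesis by simp
  qed
  ultimately have "[(\<Sum>w\<in>?W. shuffle u v w * (a w * int p ^ (n - s))) = 0] (mod q)"
    by simp
  moreover have "(\<Sum>w\<in>?W. shuffle u v w * (a w * int p ^ (n - s))) =
      (\<Sum>w\<in>?W. shuffle u v w * a w) * int p ^ (n - s)"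
    by (simp add: sum_distrib_right mult.assoc)
  ultimately have "int p * int p ^ (n - s) dvd (\<Sum>w\<in>?W. shuffle u v w * a w) * int p ^ (n - s)"
    by (simp add: cong_0_iff q_eq)
  then show ?thesis
    using p by simp
qed

lemma alpha_cochain:
  assumes w: "w \<in> lists X" "length w = s"
  obtains c \<theta> where
    "c \<in> carrier coefficients.Z"
    "alpha p n S T X w = cohomology_class (p_quotient p n S T) (p_quotient_topology p n S T) A c"
    "continuous_map T (discrete_topology (carrier A)) \<theta>"
    "\<And>g h. g \<in> carrier S \<Longrightarrow> h \<in> carrier S \<Longrightarrow>
      \<theta> (g \<otimes>\<^bsub>S\<^esub> h) = \<theta> g \<otimes>\<^bsub>A\<^esub> \<theta> h \<otimes>\<^bsub>A\<^esub> c (p_proj p n S T g, p_proj p n S T h)"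
    "\<And>k g a. k \<in> lower_p_central p S T n \<Longrightarrow> g \<in> carrier S \<Longrightarrow> a \<in> carrier A \<Longrightarrow> \<rho> w k = incl a \<Longrightarrow>
      \<theta> (k \<otimes>\<^bsub>S\<^esub> g) = a \<otimes>\<^bsub>A\<^esub> \<theta> g"
proof -
  have "alpha p n S T X w = H2_pullback (p_quotient p n S T) (p_quotient_topology p n S T) A
      (p_induced p n S T U (UU_topology p n s) (\<rho> w))
      (extension_class A incl U (UU_topology p n s) extension.\<pi> extension.Q extension.TQ)"
    unfolding alpha_def Let_def gamma_def w(2) ..
  note alpha = this
  show thesis
  proof (rule extension.pullback_extension_class[OF topological_group_axioms rho_continuous_hom[OF w]])
    fix c \<theta>
    assume "c \<in> cocycles2 (p_quotient p n S T) (p_quotient_topology p n S T) A"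
    then have "c \<in> carrier coefficients.Z" by (simp only: coefficients.carrier_Z)
    note \<theta> = that[OF this, of \<theta>, unfolded alpha]
    assume "H2_pullback (p_quotient p n S T) (p_quotient_topology p n S T) A
        (p_induced p n S T U (UU_topology p n s) (\<rho> w))
        (extension_class A incl U (UU_topology p n s) extension.\<pi> extension.Q extension.TQ) =
      cohomology_class (p_quotient p n S T) (p_quotient_topology p n S T) A c"
      "continuous_map T (discrete_topology (carrier A)) \<theta>"
      "\<And>g h. g \<in> carrier S \<Longrightarrow> h \<in> carrier S \<Longrightarrow>
        \<theta> (g \<otimes>\<^bsub>S\<^esub> h) = \<theta> g \<otimes>\<^bsub>A\<^esub> \<theta> h \<otimes>\<^bsub>A\<^esub> c (p_proj p n S T g, p_proj p n S T h)"
      "\<And>k g a. k \<in> lower_p_central p S T n \<Longrightarrow> g \<in> carrier S \<Longrightarrow> a \<in> carrier A \<Longrightarrow> \<rho> w k = incl a \<Longrightarrow>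
        \<theta> (k \<otimes>\<^bsub>S\<^esub> g) = a \<otimes>\<^bsub>A\<^esub> \<theta> g"
    then show thesis by (rule \<theta>)
  qed
qed

end

section \<open>Descent of the combined cochain to the quotient of \<open>S\<close>\<close>

lemma finprod_integer_mod_group:
  assumes "p > 0" "finite W" "\<And>w. w \<in> W \<Longrightarrow> f w \<in> carrier (integer_mod_group p)"
  shows "(\<Otimes>\<^bsub>integer_mod_group p\<^esub>w\<in>W. f w) = (\<Sum>w\<in>W. f w) mod int p"
proof -
  interpret A: comm_group "integer_mod_group p" by simp
  show ?thesis using assms(2,3)
  proof (induction W rule: finite_induct)
    case (insert w W)
    then show ?case by (simp add: A.finprod_insert Pi_def mod_add_right_eq)
  qed simp
qed

theorem theorem9p4:
  fixes S :: "('a, 'b) monoid_scheme" and T :: "'a topology" and X :: "'a set"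
    and r :: "('a \<times> 'a) set" and p n s :: nat and u v :: "'a list"
  assumes "prime p"
    and "X \<noteq> {}"
    and "linear_order_on X r"
    and "free_profinite_group S T X"
    and "n \<ge> 2"
    and "u \<in> lists X" and "u \<noteq> []"
    and "v \<in> lists X" and "v \<noteq> []"
    and "s = length u + length v" and "s \<le> n"
  defines "H \<equiv> H2 (p_quotient p n S T) (p_quotient_topology p n S T) (integer_mod_group p)"
  shows "(\<Otimes>\<^bsub>H\<^esub>w \<in> {w \<in> lists X. length w = s \<and> shuffle u v w \<noteq> 0}.
            alpha p n S T X w [^]\<^bsub>H\<^esub> shuffle u v w) = \<one>\<^bsub>H\<^esub>"
proof -
  let ?W = "{w \<in> lists X. length w = s \<and> shuffle u v w \<noteq> 0}"
  let ?Q = "p_quotient p n S T" and ?TQ = "p_quotient_topology p n S T" and ?A = "integer_mod_group p"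
    and ?\<pi> = "p_proj p n S T" and ?N = "lower_p_central p S T n" and ?sh = "shuffle u v"
  have "1 < p" using \<open>prime p\<close> by (rule prime_gt_1_nat)
  moreover have "1 \<le> s"
    using \<open>u \<noteq> []\<close> \<open>s = length u + length v\<close> by (simp add: Suc_le_eq)
  ultimately have "unipotent_setting p n s"
    using \<open>s \<le> n\<close> by (rule unipotent_setting.intro)
  then interpret free_unipotent p n s S T X
    using assms by (simp add: free_unipotent_def)
  have W: "finite ?W"
    by (rule finite_subset[OF _ finite_shuffle_support[of u v]]) auto
  have "\<forall>w\<in>?W. \<exists>c \<theta>. c \<in> carrier coefficients.Z \<and>
      alpha p n S T X w = cohomology_class ?Q ?TQ ?A c \<and>
      continuous_map T (discrete_topology (carrier ?A)) \<theta> \<and>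
      (\<forall>g\<in>carrier S. \<forall>h\<in>carrier S. \<theta> (g \<otimes>\<^bsub>S\<^esub> h) = \<theta> g \<otimes>\<^bsub>?A\<^esub> \<theta> h \<otimes>\<^bsub>?A\<^esub> c (?\<pi> g, ?\<pi> h)) \<and>
      (\<forall>k\<in>?N. \<forall>g\<in>carrier S. \<forall>a\<in>carrier ?A. \<rho> w k = incl a \<longrightarrow> \<theta> (k \<otimes>\<^bsub>S\<^esub> g) = a \<otimes>\<^bsub>?A\<^esub> \<theta> g)"
  proof
    fix w assume "w \<in> ?W"
    then have "w \<in> lists X" "length w = s" by auto
    from alpha_cochain[OF this] show "\<exists>c \<theta>. c \<in> carrier coefficients.Z \<and>
      alpha p n S T X w = cohomology_class ?Q ?TQ ?A c \<and>
      continuous_map T (discrete_topology (carrier ?A)) \<theta> \<and>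
      (\<forall>g\<in>carrier S. \<forall>h\<in>carrier S. \<theta> (g \<otimes>\<^bsub>S\<^esub> h) = \<theta> g \<otimes>\<^bsub>?A\<^esub> \<theta> h \<otimes>\<^bsub>?A\<^esub> c (?\<pi> g, ?\<pi> h)) \<and>
      (\<forall>k\<in>?N. \<forall>g\<in>carrier S. \<forall>a\<in>carrier ?A. \<rho> w k = incl a \<longrightarrow> \<theta> (k \<otimes>\<^bsub>S\<^esub> g) = a \<otimes>\<^bsub>?A\<^esub> \<theta> g)"
      by (smt (verit))
  qed
  then obtain c \<theta> where c: "\<And>w. w \<in> ?W \<Longrightarrow> c w \<in> carrier coefficients.Z"
    and alpha: "\<And>w. w \<in> ?W \<Longrightarrow> alpha p n S T X w = cohomology_class ?Q ?TQ ?A (c w)"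
    and \<theta>_cont: "\<And>w. w \<in> ?W \<Longrightarrow> continuous_map T (discrete_topology (carrier ?A)) (\<theta> w)"
    and \<theta>_mult: "\<And>w g h. w \<in> ?W \<Longrightarrow> g \<in> carrier S \<Longrightarrow> h \<in> carrier S \<Longrightarrow>
      \<theta> w (g \<otimes>\<^bsub>S\<^esub> h) = \<theta> w g \<otimes>\<^bsub>?A\<^esub> \<theta> w h \<otimes>\<^bsub>?A\<^esub> c w (?\<pi> g, ?\<pi> h)"
    and \<theta>_central: "\<And>w k g a. w \<in> ?W \<Longrightarrow> k \<in> ?N \<Longrightarrow> g \<in> carrier S \<Longrightarrow> a \<in> carrier ?A \<Longrightarrow>
      \<rho> w k = incl a \<Longrightarrow> \<theta> w (k \<otimes>\<^bsub>S\<^esub> g) = a \<otimes>\<^bsub>?A\<^esub> \<theta> w g"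
    unfolding bchoice_iff by blast
  \<comment> \<open>\<open>\<Theta>\<close> and \<open>C\<close> are plain integer combinations,
    reduced modulo \<open>p\<close> only when compared with \<open>f\<close>, which is the
    combination inside the group of cocycles.\<close>
  define \<Theta> where "\<Theta> g = (\<Sum>w\<in>?W. ?sh w * \<theta> w g)" for g
  define C where "C x = (\<Sum>w\<in>?W. ?sh w * c w x)" for x
  define f where "f = (\<Otimes>\<^bsub>coefficients.Z\<^esub>w\<in>?W. c w [^]\<^bsub>coefficients.Z\<^esub> ?sh w)"

  have f_closed: "f \<in> carrier coefficients.Z"
    unfolding f_def using c by (intro coefficients.Z.finprod_closed) auto
  have f_apply: "f x = C x mod int p" if x: "x \<in> carrier ?Q \<times> carrier ?Q" for x
  proof -
    have closed: "c w x \<in> carrier ?A" if "w \<in> ?W" for w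
      using coefficients.cocycles2D(3)[of "c w" "fst x" "snd x"] c[OF that] x
      by (auto simp: coefficients.carrier_Z)
    \<comment> \<open>A shuffle coefficient is a cardinality, so the integer power is a natural one,
      which can be evaluated pointwise.\<close>
    have pow: "(c w [^]\<^bsub>coefficients.Z\<^esub> ?sh w) x = (?sh w * c w x) mod int p" if "w \<in> ?W" for w
      unfolding shuffle_eq_card int_pow_int
      using coefficients.nat_pow_cocycle_apply[OF c[OF that] x] closed[OF that]
      by (simp add: pow_integer_mod_group)
    have "f x = (\<Otimes>\<^bsub>?A\<^esub>w\<in>?W. (c w [^]\<^bsub>coefficients.Z\<^esub> ?sh w) x)"
      unfolding f_def using c by (intro coefficients.finprod_cocycle_apply W x) auto
    also have "\<dots> = (\<Sum>w\<in>?W. (c w [^]\<^bsub>coefficients.Z\<^esub> ?sh w) x) mod int p"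
      using p W by (intro finprod_integer_mod_group) (simp_all only: pow, simp_all add: carrier_A)
    also have "\<dots> = C x mod int p"
      unfolding C_def by (simp only: pow mod_sum_eq cong: sum.cong)
    finally show ?thesis .
  qed

  have \<Theta>_mult: "[\<Theta> (g \<otimes>\<^bsub>S\<^esub> h) = \<Theta> g + \<Theta> h + C (?\<pi> g, ?\<pi> h)] (mod int p)"
    if gh: "g \<in> carrier S" "h \<in> carrier S" for g h
  proof -
    have "[\<Theta> (g \<otimes>\<^bsub>S\<^esub> h) = (\<Sum>w\<in>?W. ?sh w * (\<theta> w g + \<theta> w h + c w (?\<pi> g, ?\<pi> h)))] (mod int p)"
      unfolding \<Theta>_def using gh
      by (intro cong_sum cong_mult cong_refl) (simp add: \<theta>_mult cong_def mod_add_left_eq)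
    then show ?thesis
      by (simp add: \<Theta>_def C_def sum.distrib distrib_left)
  qed
  have \<Theta>_central: "[\<Theta> (k \<otimes>\<^bsub>S\<^esub> g) = \<Theta> g] (mod int p)" if kg: "k \<in> ?N" "g \<in> carrier S" for k g
  proof -
    have "\<exists>a\<in>carrier ?A. \<rho> w k = incl a" if "w \<in> lists X \<and> length w = s" for w
      using rho_lower_p_central[of w k] kg that by blast
    then obtain a where a: "\<And>w. w \<in> lists X \<Longrightarrow> length w = s \<Longrightarrow> a w \<in> carrier ?A \<and> \<rho> w k = incl (a w)"
      by metis
    have "[\<Theta> (k \<otimes>\<^bsub>S\<^esub> g) = (\<Sum>w\<in>?W. ?sh w * (a w + \<theta> w g))] (mod int p)"
      unfolding \<Theta>_def
    proof (intro cong_sum cong_mult cong_refl)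
      fix w assume w: "w \<in> ?W"
      then have "\<theta> w (k \<otimes>\<^bsub>S\<^esub> g) = a w \<otimes>\<^bsub>?A\<^esub> \<theta> w g"
        using a[of w] kg by (intro \<theta>_central) auto
      then show "[\<theta> w (k \<otimes>\<^bsub>S\<^esub> g) = a w + \<theta> w g] (mod int p)"
        by (simp add: cong_def)
    qed
    also have "(\<Sum>w\<in>?W. ?sh w * (a w + \<theta> w g)) = (\<Sum>w\<in>?W. ?sh w * a w) + \<Theta> g"
      by (simp add: \<Theta>_def sum.distrib distrib_left)
    \<comment> \<open>Here the particular coefficients of the shuffle product enter: they make the
      combined variation along the coset a multiple of \<open>p\<close>.\<close>
    also have "[\<dots> = 0 + \<Theta> g] (mod int p)"
      using shuffle_relation[OF kg(1) assms(6-10)] a by (intro cong_add cong_refl) (simp add: cong_0_iff)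
    finally show ?thesis by simp
  qed

  \<comment> \<open>The coboundary of \<open>\<Theta>\<close> is -\<open>C\<close>, hence the minus
    sign. The representative of the coset is arbitrary, by \<open>\<Theta>_central\<close>.\<close>
  define b where "b x = (- \<Theta> (inv_into (carrier S) ?\<pi> x)) mod int p" for x
  have b_apply: "b (?\<pi> g) = (- \<Theta> g) mod int p" if g: "g \<in> carrier S" for g
  proof -
    let ?g = "inv_into (carrier S) ?\<pi> (?\<pi> g)"
    have "?g \<in> carrier S" "?\<pi> ?g = ?\<pi> g"
      using g by (simp_all add: inv_into_into f_inv_into_f)
    then obtain k where "k \<in> ?N" "?g = k \<otimes>\<^bsub>S\<^esub> g"
      using p_proj_eq_iff[of ?g g] g by blast
    then have "[\<Theta> ?g = \<Theta> g] (mod int p)" using \<Theta>_central[of k g] g by simp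
    then show ?thesis unfolding b_def by (metis cong_def mod_minus_cong)
  qed
  \<comment> \<open>Continuity is tested on \<open>S\<close>, where \<open>\<Theta>\<close> is a
    finite sum of continuous functions, and descends along the quotient map.\<close>
  have b_cont: "continuous_map ?TQ (discrete_topology (carrier ?A)) b"
  proof (rule continuous_compose_quotient_map[OF quotient_map_p_proj])
    have "continuous_map T (discrete_topology UNIV) (\<lambda>g. ?sh w * \<theta> w g)" if "w \<in> ?W" for w
      by (rule continuous_map_discrete_unop[OF \<theta>_cont[OF that]]) simp
    then have "continuous_map T (discrete_topology UNIV) \<Theta>"
      unfolding \<Theta>_def by (intro continuous_map_discrete_sum W)
    then have "continuous_map T (discrete_topology (carrier ?A)) (\<lambda>g. (- \<Theta> g) mod int p)"
      by (rule continuous_map_discrete_unop) (use p in \<open>simp add: carrier_A\<close>)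
    then show "continuous_map T (discrete_topology (carrier ?A)) (b \<circ> ?\<pi>)"
      by (rule continuous_map_eq) (simp add: topspace_eq b_apply)
  qed
  have "f = coboundary1 ?Q ?A b"
  proof (rule extensionalityI)
    show "f \<in> extensional (carrier ?Q \<times> carrier ?Q)"
      using f_closed coefficients.cocycles2D(1) by (simp add: coefficients.carrier_Z)
    show "coboundary1 ?Q ?A b \<in> extensional (carrier ?Q \<times> carrier ?Q)"
      by (simp add: coboundary1_def)
    fix x assume x: "x \<in> carrier ?Q \<times> carrier ?Q"
    then obtain g h where gh: "g \<in> carrier S" "h \<in> carrier S" "x = (?\<pi> g, ?\<pi> h)"
      unfolding p_proj_image[of p n, symmetric] by blast
    have mult: "?\<pi> g \<otimes>\<^bsub>?Q\<^esub> ?\<pi> h = ?\<pi> (g \<otimes>\<^bsub>S\<^esub> h)"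
      using gh p_proj_hom[of p n] by (simp add: hom_mult)
    have "(- \<Theta> (g \<otimes>\<^bsub>S\<^esub> h)) mod int p \<in> carrier ?A" using p by (simp add: carrier_A)
    then have "coboundary1 ?Q ?A b x = (- \<Theta> h + \<Theta> (g \<otimes>\<^bsub>S\<^esub> h) - \<Theta> g) mod int p"
      using x gh unfolding gh(3)
      by (simp add: coefficients.coboundary1_apply mult b_apply mod_simps)
    also have "\<dots> = C x mod int p"
      using \<Theta>_mult[OF gh(1,2)] unfolding gh(3) by (simp add: cong_iff_dvd_diff mod_eq_dvd_iff algebra_simps)
    also have "\<dots> = f x" using f_apply[OF x] by simp
    finally show "f x = coboundary1 ?Q ?A b x" by simp
  qed
  with b_cont have "f \<in> coboundaries2 ?Q ?TQ ?A"
    by (auto simp: coboundaries2_def)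
  then have "cohomology_class ?Q ?TQ ?A f = \<one>\<^bsub>H\<^esub>"
    unfolding H_def by (rule coefficients.cohomology_class_eq_one)
  moreover have "(\<Otimes>\<^bsub>H\<^esub>w\<in>?W. alpha p n S T X w [^]\<^bsub>H\<^esub> ?sh w) =
      (\<Otimes>\<^bsub>H\<^esub>w\<in>?W. cohomology_class ?Q ?TQ ?A (c w) [^]\<^bsub>H\<^esub> ?sh w)"
    unfolding H_def using alpha c coefficients.cohomology_class_hom
    by (intro coefficients.H.finprod_cong') (auto simp: hom_def Pi_iff)
  moreover have "\<dots> = cohomology_class ?Q ?TQ ?A f"
    unfolding H_def f_def using c by (intro coefficients.finprod_cohomology_class W) auto
  ultimately show ?thesis by simp
qed

end
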